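(* Let $t\in\mathbb{C}^\times$ and $c=13-6t-6t^{-1}$. Let $\mathcal{V}_1$ and $\mathcal{V}_2$ be Virasoro Verma modules of central charge $c$ and lowest conformal weights $h_1$ and $h_2$, respectively. If $$h_2=h_1+\frac{1}{4t}-\frac{1}{2t}\sqrt{4th_1+(t-1)^2}$$ for some choice of square root such that $\frac{1}{t}\sqrt{4th_1+(t-1)^2}\notin\mathbb{Z}_{\ge 1}$, then there is a unique up to scale surjective intertwining operator of type $\binom{\mathcal{V}_2}{\mathcal{K}_{1,2}\,\mathcal{V}_1}$.
   Context: $\mathfrak{Vir}$ is the Lie algebra with basis $\{L_n\}_{n\in\mathbb{Z}}\cup\{C\}$, $C$ central, $[L_m,L_n]=(m-n)L_{m+n}+\frac{m^3-m}{12}\delta_{m,-n}C$; central charge $c$ means $C$ acts by $c$. The Verma module of central charge $c$ and lowest conformal weight $h$ is $U(\mathfrak{Vir})$ induced from a one-dimensional module $\mathbb{C}v$ of the span of $C$ and the $L_n$, $n\ge0$, with $L_0v=hv$, $L_nv=0$ for $n>0$, $Cv=cv$. Let $\mathcal{V}_{1,2}$ be the Verma module of central charge $c$ and lowest conformal weight $h_{1,2}=-\frac12+\frac{3}{4t}$, with generator $v_{1,2}$. The vector $(L_{-1}^2-t^{-1}L_{-2})v_{1,2}$ is singular, and $\mathcal{K}_{1,2}=\mathcal{V}_{1,2}/\langle(L_{-1}^2-t^{-1}L_{-2})v_{1,2}\rangle$. For modules $W_1,W_2,W_3$ of the universal Virasoro vertex operator algebra $V_c$ (i.e. $\mathfrak{Vir}$-modules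 of central charge $c$ on which each vector is killed by $L_n$ for $n\gg0$, graded by finite-dimensional generalized $L_0$-eigenspaces with weights bounded below in each coset of $\mathbb{Z}$), an intertwining operator of type $\binom{W_3}{W_1\,W_2}$ is a linear map $\mathcal{Y}:W_1\to\mathrm{Hom}(W_2,W_3)\{z\}[\log z]$, $\mathcal{Y}(w_1,z)=\sum_{h\in\mathbb{C}}\sum_{k\ge 0}(w_1)_{h;k}z^{-h-1}(\log z)^k$, such that: for all $w_1,w_2,h$, $(w_1)_{h+n;k}w_2=0$ for $n\in\mathbb{Z}$ sufficiently positive, independently of $k$; $L_n\mathcal{Y}(w_1,z)=\mathcal{Y}(w_1,z)L_n+\sum_{i\ge0}\binom{n+1}{i}z^{n+1-i}\mathcal{Y}(L_{i-1}w_1,z)$ for $n\in\mathbb{Z}$; $\mathcal{Y}(L_nw_1,z)=\sum_{i\ge0}(-1)^i\binom{n+1}{i}\left(L_{n-i}z^i\mathcal{Y}(w_1,z)+(-1)^nz^{n+1-i}\mathcal{Y}(w_1,z)L_{i-1}\right)$ for $n\in\mathbb{Z}$; and $\mathcal{Y}(L_{-1}w_1,z)=\frac{d}{dz}\mathcal{Y}(w_1,z)$. It is surjective if $W_3$ is spanned by all the vectors $(w_1)_{h;k}w_2$. *)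

theory Defs
  imports Complex_Main "HOL-Library.Poly_Mapping" "HOL-Library.Groups_Big_Fun"
begin

section \<open>The universal enveloping algebra of the Virasoro algebra\<close>

text \<open>
  The tensor algebra of the Virasoro Lie algebra is the free associative algebra on its basis
  \<open>{L\<^sub>n} \<union> {C}\<close>, realised as the monoid algebra of the monoid of words in the basis elements.
\<close>

datatype vir_basis = Lgen int | Cgen

instantiation list :: (type) monoid_add
begin
definition zero_list :: "'a list" where "zero_list = []"
definition plus_list :: "'a list \<Rightarrow> 'a list \<Rightarrow> 'a list" where "plus_list = (@)"
instance by standard (simp_all add: zero_list_def plus_list_def)
end

type_synonym vir_tensor = "vir_basis list \<Rightarrow>\<^sub>0 complex"

definition tgen :: "vir_basis \<Rightarrow> vir_tensor" where
  "tgen x = Poly_Mapping.single [x] 1"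

definition tscale :: "complex \<Rightarrow> vir_tensor \<Rightarrow> vir_tensor" where
  "tscale a p = Poly_Mapping.single 0 a * p"

lemma tscale_mult_left: "tscale a p * q = tscale a (p * q)"
  by (simp add: tscale_def mult.assoc)

lemma vir_tensor_induct [case_names single sum]:
  fixes p :: vir_tensor
  assumes single: "\<And>k v. P (Poly_Mapping.single k v)"
    and sum: "\<And>p q. P p \<Longrightarrow> P q \<Longrightarrow> P (p + q)"
  shows "P p"
proof (induction p rule: Poly_Mapping.update_induct)
  case const
  then show ?case using single[of _ 0] by simp
next
  case (update f a b)
  have "Poly_Mapping.update a b f = f + Poly_Mapping.single a b"
    using update by (intro poly_mapping_eqI)
      (auto simp: lookup_update lookup_add lookup_single in_keys_iff when_def)
  then show ?case using update sum single by simp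
qed

lemma single_0_commute: "Poly_Mapping.single 0 a * p = p * Poly_Mapping.single 0 (a::complex)"
  for p :: vir_tensor
proof (induction p rule: vir_tensor_induct)
  case (single k v)
  then show ?case by (simp add: mult_single mult.commute)
next
  case (sum p1 p2)
  then show ?case by (simp add: distrib_left distrib_right)
qed

lemma tscale_mult_right: "p * tscale a q = tscale a (p * q)"
proof -
  have "p * (Poly_Mapping.single 0 a * q) = (p * Poly_Mapping.single 0 a) * q"
    by (simp only: mult.assoc)
  also have "\<dots> = (Poly_Mapping.single 0 a * p) * q" by (simp only: single_0_commute)
  finally show ?thesis by (simp only: tscale_def mult.assoc)
qed

interpretation vtensor: vector_space tscale
proof
  fix a b :: complex and x y :: vir_tensor
  show "tscale a (x + y) = tscale a x + tscale a y"
    by (simp add: tscale_def distrib_left)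
  show "tscale (a + b) x = tscale a x + tscale b x"
    by (simp add: tscale_def single_add distrib_right)
  show "tscale a (tscale b x) = tscale (a * b) x"
    by (simp add: tscale_def mult_single flip: mult.assoc)
  show "tscale 1 x = x"
    by (simp add: tscale_def)
qed

text \<open>
  The elements \<open>x \<otimes> y - y \<otimes> x - [x, y]\<close> for basis elements \<open>x\<close>, \<open>y\<close>; those for
  \<open>(L\<^sub>n, C)\<close> and \<open>(C, C)\<close> are omitted, being the negatives of those listed or zero.
\<close>

definition vir_relations :: "vir_tensor set" where
  "vir_relations =
     {tgen (Lgen m) * tgen (Lgen n) - tgen (Lgen n) * tgen (Lgen m)
        - (tscale (of_int (m - n)) (tgen (Lgen (m + n)))
           + (if m = - n then tscale (of_int (m^3 - m) / 12) (tgen Cgen) else 0)) | m n. True}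
     \<union> {tgen Cgen * tgen (Lgen n) - tgen (Lgen n) * tgen Cgen | n. True}"

definition vir_ideal :: "vir_tensor set" where
  "vir_ideal = vtensor.span {p * r * q | p r q. r \<in> vir_relations}"

lemma vir_ideal_mult_left: "x \<in> vir_ideal \<Longrightarrow> y * x \<in> vir_ideal"
  unfolding vir_ideal_def
proof (induction rule: vtensor.span_induct_alt)
  case base
  then show ?case by (simp add: vtensor.span_zero)
next
  case (step a x z)
  then obtain p r q where "x = p * r * q" "r \<in> vir_relations" by blast
  then have "y * x \<in> vtensor.span {p * r * q | p r q. r \<in> vir_relations}"
    by (intro vtensor.span_base CollectI exI[of _ "y * p"] exI[of _ r] exI[of _ q])
       (auto simp: mult.assoc)
  with step show ?case
    by (simp add: distrib_left tscale_mult_right vtensor.span_add vtensor.span_scale)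
qed

lemma vir_ideal_mult_right: "x \<in> vir_ideal \<Longrightarrow> x * y \<in> vir_ideal"
  unfolding vir_ideal_def
proof (induction rule: vtensor.span_induct_alt)
  case base
  then show ?case by (simp add: vtensor.span_zero)
next
  case (step a x z)
  then obtain p r q where "x = p * r * q" "r \<in> vir_relations" by blast
  then have "x * y \<in> vtensor.span {p * r * q | p r q. r \<in> vir_relations}"
    by (intro vtensor.span_base CollectI exI[of _ p] exI[of _ r] exI[of _ "q * y"])
       (auto simp: mult.assoc)
  with step show ?case
    by (simp add: distrib_right tscale_mult_left vtensor.span_add vtensor.span_scale)
qed

lemma vir_ideal_zero: "0 \<in> vir_ideal"
  and vir_ideal_add: "\<lbrakk>x \<in> vir_ideal; y \<in> vir_ideal\<rbrakk> \<Longrightarrow> x + y \<in> vir_ideal"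
  and vir_ideal_minus: "x \<in> vir_ideal \<Longrightarrow> - x \<in> vir_ideal"
  and vir_ideal_scale: "x \<in> vir_ideal \<Longrightarrow> tscale a x \<in> vir_ideal"
  unfolding vir_ideal_def
  by (simp_all add: vtensor.span_zero vtensor.span_add vtensor.span_neg vtensor.span_scale)

definition vir_cong :: "vir_tensor \<Rightarrow> vir_tensor \<Rightarrow> bool" where
  "vir_cong p q \<longleftrightarrow> p - q \<in> vir_ideal"

quotient_type vir_uea = vir_tensor / vir_cong
proof (rule equivpI)
  show "reflp vir_cong" by (rule reflpI) (simp add: vir_cong_def vir_ideal_zero)
  show "symp vir_cong"
  proof (rule sympI)
    fix x y assume "vir_cong x y"
    then show "vir_cong y x" using vir_ideal_minus[of "x - y"] by (simp add: vir_cong_def)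
  qed
  show "transp vir_cong"
  proof (rule transpI)
    fix x y z assume "vir_cong x y" "vir_cong y z"
    then show "vir_cong x z" using vir_ideal_add[of "x - y" "y - z"] by (simp add: vir_cong_def)
  qed
qed

lemma lookup_mult_Nil:
  "Poly_Mapping.lookup (p * q) [] = Poly_Mapping.lookup p [] * Poly_Mapping.lookup q []"
  for p q :: vir_tensor
proof (induction p rule: vir_tensor_induct)
  case (single k v)
  show ?case
  proof (induction q rule: vir_tensor_induct)
    case (single l w)
    show ?case
      by (auto simp: mult_single lookup_single plus_list_def when_def)
  next
    case (sum p1 p2)
    then show ?case by (simp add: distrib_left lookup_add)
  qed
next
  case (sum p1 p2)
  then show ?case by (simp add: distrib_right lookup_add)
qed

lemma vir_ideal_lookup_Nil: "x \<in> vir_ideal \<Longrightarrow> Poly_Mapping.lookup x [] = 0"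
  unfolding vir_ideal_def
proof (induction rule: vtensor.span_induct_alt)
  case base
  then show ?case by simp
next
  case (step a x z)
  have "Poly_Mapping.lookup r [] = 0" if "r \<in> vir_relations" for r
    using that
    by (auto simp: vir_relations_def tgen_def tscale_def lookup_minus lookup_add lookup_mult_Nil
        lookup_single when_def)
  with step show ?case
    by (auto simp: lookup_add tscale_def lookup_mult_Nil)
qed

instantiation vir_uea :: ring_1
begin

lift_definition zero_vir_uea :: vir_uea is 0 .
lift_definition one_vir_uea :: vir_uea is 1 .

lift_definition plus_vir_uea :: "vir_uea \<Rightarrow> vir_uea \<Rightarrow> vir_uea" is "(+)"
proof -
  fix a b c d assume "vir_cong a b" "vir_cong c d"
  then show "vir_cong (a + c) (b + d)"
    using vir_ideal_add[of "a - b" "c - d"] by (simp add: vir_cong_def algebra_simps)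
qed

lift_definition uminus_vir_uea :: "vir_uea \<Rightarrow> vir_uea" is uminus
proof -
  fix a b assume "vir_cong a b"
  then show "vir_cong (- a) (- b)"
    using vir_ideal_minus[of "a - b"] by (simp add: vir_cong_def algebra_simps)
qed

definition minus_vir_uea :: "vir_uea \<Rightarrow> vir_uea \<Rightarrow> vir_uea" where
  "minus_vir_uea u w = u + - w"

lift_definition times_vir_uea :: "vir_uea \<Rightarrow> vir_uea \<Rightarrow> vir_uea" is "(*)"
proof -
  fix a b c d assume "vir_cong a b" "vir_cong c d"
  moreover have "a * c - b * d = (a - b) * c + b * (c - d)" by (simp add: algebra_simps)
  ultimately show "vir_cong (a * c) (b * d)"
    by (simp add: vir_cong_def vir_ideal_add vir_ideal_mult_left vir_ideal_mult_right)
qed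

instance
proof
  fix a b c :: vir_uea
  show "a + b + c = a + (b + c)" by transfer (simp add: vir_cong_def vir_ideal_zero add.assoc)
  show "a + b = b + a" by transfer (simp add: vir_cong_def vir_ideal_zero)
  show "0 + a = a" by transfer (simp add: vir_cong_def vir_ideal_zero)
  show "- a + a = 0" by transfer (simp add: vir_cong_def vir_ideal_zero)
  show "a - b = a + - b" by (rule minus_vir_uea_def)
  show "a * b * c = a * (b * c)" by transfer (simp add: vir_cong_def vir_ideal_zero mult.assoc)
  show "1 * a = a" by transfer (simp add: vir_cong_def vir_ideal_zero)
  show "a * 1 = a" by transfer (simp add: vir_cong_def vir_ideal_zero)
  show "(a + b) * c = a * c + b * c"
    by transfer (simp add: vir_cong_def vir_ideal_zero distrib_right)
  show "a * (b + c) = a * b + a * c"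
    by transfer (simp add: vir_cong_def vir_ideal_zero distrib_left)
  show "(0::vir_uea) \<noteq> 1"
  proof transfer
    have "Poly_Mapping.lookup (0 - 1 :: vir_tensor) [] = -1"
      by (simp add: lookup_minus lookup_one zero_list_def)
    then show "\<not> vir_cong 0 1"
      using vir_ideal_lookup_Nil by (force simp: vir_cong_def)
  qed
qed

end

lift_definition uscale :: "complex \<Rightarrow> vir_uea \<Rightarrow> vir_uea" is tscale
proof -
  fix a b c assume "vir_cong b c"
  then show "vir_cong (tscale a b) (tscale a c)"
    using vir_ideal_scale[of "b - c" a]
    by (simp add: vir_cong_def vtensor.scale_right_diff_distrib)
qed

interpretation vuea: vector_space uscale
proof
  fix a b :: complex and x y :: vir_uea
  show "uscale a (x + y) = uscale a x + uscale a y"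
    by transfer (simp add: vir_cong_def vir_ideal_zero vtensor.scale_right_distrib)
  show "uscale (a + b) x = uscale a x + uscale b x"
    by transfer (simp add: vir_cong_def vir_ideal_zero vtensor.scale_left_distrib)
  show "uscale a (uscale b x) = uscale (a * b) x"
    by transfer (simp add: vir_cong_def vir_ideal_zero)
  show "uscale 1 x = x"
    by transfer (simp add: vir_cong_def vir_ideal_zero)
qed

lift_definition ugen :: "vir_basis \<Rightarrow> vir_uea" is tgen .

section \<open>Virasoro modules of a fixed central charge\<close>

locale virasoro_module = vector_space scale
  for scale :: "complex \<Rightarrow> 'v::ab_group_add \<Rightarrow> 'v" +
  fixes L :: "int \<Rightarrow> 'v \<Rightarrow> 'v"
    and c :: complex
  assumes linear_L: "Vector_Spaces.linear scale scale (L n)"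
    and L_bracket:
      "L m (L n w) - L n (L m w) =
         scale (of_int (m - n)) (L (m + n) w)
         + (if m = - n then scale (of_int (m^3 - m) / 12 * c) w else 0)"
begin

definition generated_submodule :: "'v set \<Rightarrow> 'v set" where
  "generated_submodule A = \<Inter>{S. subspace S \<and> (\<forall>n. \<forall>w\<in>S. L n w \<in> S) \<and> A \<subseteq> S}"

definition generalized_eigenspace :: "complex \<Rightarrow> 'v set" where
  "generalized_eigenspace h = {w. \<exists>N. ((\<lambda>x. L 0 x - scale h x) ^^ N) w = 0}"

end

text \<open>
  Inducing the one-dimensional module \<open>\<complex>v\<close> of \<open>\<bb> = span {C, L\<^sub>n | n \<ge> 0}\<close> gives
  \<open>U(Vir) \<otimes>\<^bsub>U(\<bb>)\<^esub> \<complex>v\<close>, which is the quotient of \<open>U(Vir)\<close> by the left ideal generated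
  by the elements \<open>x - \<lambda>(x)\<close>, \<open>x \<in> \<bb>\<close>, where \<open>x v = \<lambda>(x) v\<close>.
\<close>

definition verma_left_ideal :: "complex \<Rightarrow> complex \<Rightarrow> vir_uea set" where
  "verma_left_ideal c h =
     vuea.span {u * x | u x.
       x \<in> {ugen (Lgen n) | n. n > 0} \<union> {ugen (Lgen 0) - uscale h 1, ugen Cgen - uscale c 1}}"

text \<open>
  Verma modules are given up to isomorphism: \<open>\<phi>\<close> induces an isomorphism of Virasoro modules from
  the induced module onto the given one, sending the generator to \<open>v\<close>.
\<close>

locale verma_module = virasoro_module scale L c
  for scale :: "complex \<Rightarrow> 'v::ab_group_add \<Rightarrow> 'v" and L c +
  fixes h :: complex and v :: 'v
  assumes iso_induced_module:
    "\<exists>\<phi>. Vector_Spaces.linear uscale scale \<phi> \<and>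
         (\<forall>n u. \<phi> (ugen (Lgen n) * u) = L n (\<phi> u)) \<and>
         (\<forall>u. \<phi> (ugen Cgen * u) = scale c (\<phi> u)) \<and>
         \<phi> 1 = v \<and> surj \<phi> \<and> {u. \<phi> u = 0} = verma_left_ideal c h"

text \<open>\<open>W\<close>, with projection \<open>\<pi>\<close>, is the quotient of \<open>V\<close> by the submodule generated by \<open>A\<close>.\<close>

locale virasoro_quotient =
  V: virasoro_module scaleV LV c + W: virasoro_module scaleW LW c
  for scaleV :: "complex \<Rightarrow> 'v::ab_group_add \<Rightarrow> 'v" and LV
    and scaleW :: "complex \<Rightarrow> 'w::ab_group_add \<Rightarrow> 'w" and LW and c +
  fixes A :: "'v set" and \<pi> :: "'v \<Rightarrow> 'w"
  assumes linear_proj: "Vector_Spaces.linear scaleV scaleW \<pi>"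
    and proj_L: "\<pi> (LV n x) = LW n (\<pi> x)"
    and surj_proj: "surj \<pi>"
    and ker_proj: "{x. \<pi> x = 0} = V.generated_submodule A"

text \<open>
  Modules of the universal Virasoro vertex operator algebra of central charge \<open>c\<close>. Generalized
  eigenspaces for distinct eigenvalues are linearly independent, so the spanning condition says
  that the module is their direct sum.
\<close>

locale Vc_module = virasoro_module scale L c
  for scale :: "complex \<Rightarrow> 'v::ab_group_add \<Rightarrow> 'v" and L c +
  assumes restricted: "\<exists>N. \<forall>n\<ge>N. L n w = 0"
    and graded: "span (\<Union>h. generalized_eigenspace h) = UNIV"
    and finite_dimensional: "\<exists>B. finite B \<and> generalized_eigenspace h \<subseteq> span B"
    and bounded_below: "\<exists>N::int. \<forall>n<N. generalized_eigenspace (h + of_int n) = {0}"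

section \<open>Intertwining operators\<close>

text \<open>
  \<open>Y h k w\<^sub>1 w\<^sub>2\<close> is \<open>(w\<^sub>1)\<^bsub>h;k\<^esub> w\<^sub>2\<close>, the coefficient of \<open>z\<^bsup>-h-1\<^esup> (log z)\<^bsup>k\<^esup>\<close> in
  \<open>\<Y>(w\<^sub>1, z) w\<^sub>2\<close>. The formal-series identities are stated by comparing coefficients of
  \<open>z\<^bsup>-h-1\<^esup> (log z)\<^bsup>k\<^esup>\<close>; multiplication by \<open>z\<^bsup>m\<^esup>\<close> replaces \<open>h\<close> by \<open>h + m\<close>. Log-degrees are
  bounded for fixed \<open>w\<^sub>1\<close>, uniformly in \<open>h\<close> and \<open>w\<^sub>2\<close>, because \<open>\<Y>(w\<^sub>1, z)\<close> is a polynomial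
  in \<open>log z\<close> with coefficients in \<open>Hom(W\<^sub>2, W\<^sub>3){z}\<close>. The sums over \<open>i\<close> have finitely many
  nonzero terms by restrictedness of the modules and lower truncation, so \<^const>\<open>Sum_any\<close> is
  the actual sum.
\<close>

locale intertwining_operator =
  W1: Vc_module scale1 L1 c + W2: Vc_module scale2 L2 c + W3: Vc_module scale3 L3 c
  for scale1 :: "complex \<Rightarrow> 'a::ab_group_add \<Rightarrow> 'a" and L1
    and scale2 :: "complex \<Rightarrow> 'b::ab_group_add \<Rightarrow> 'b" and L2
    and scale3 :: "complex \<Rightarrow> 'd::ab_group_add \<Rightarrow> 'd" and L3 and c +
  fixes Y :: "complex \<Rightarrow> nat \<Rightarrow> 'a \<Rightarrow> 'b \<Rightarrow> 'd"
  assumes linear_left: "Vector_Spaces.linear scale1 scale3 (\<lambda>w1. Y h k w1 w2)"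
    and linear_right: "Vector_Spaces.linear scale2 scale3 (\<lambda>w2. Y h k w1 w2)"
    and log_polynomial: "\<exists>K. \<forall>k>K. \<forall>h w2. Y h k w1 w2 = 0"
    and lower_truncation: "\<exists>N::int. \<forall>n\<ge>N. \<forall>k. Y (h + of_int n) k w1 w2 = 0"
    and commutator_formula:
      "L3 n (Y h k w1 w2) =
         Y h k w1 (L2 n w2)
         + Sum_any (\<lambda>i::nat. scale3 (of_int (n + 1) gchoose i)
             (Y (h + of_int (n + 1 - int i)) k (L1 (int i - 1) w1) w2))"
    and iterate_formula:
      "Y h k (L1 n w1) w2 =
         Sum_any (\<lambda>i::nat. scale3 ((-1) ^ i * (of_int (n + 1) gchoose i))
           (L3 (n - int i) (Y (h + of_nat i) k w1 w2)
            + scale3 ((-1) powi n)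
                (Y (h + of_int (n + 1 - int i)) k w1 (L2 (int i - 1) w2))))"
    and derivative_formula:
      "Y h k (L1 (-1) w1) w2 =
         scale3 (- h) (Y (h - 1) k w1 w2)
         + scale3 (of_nat (k + 1)) (Y (h - 1) (k + 1) w1 w2)"

locale surjective_intertwining_operator = intertwining_operator +
  assumes surjective: "W3.span {Y h k w1 w2 | h k w1 w2. True} = UNIV"

end

theory Submission
  imports Defs "HOL-Library.Function_Algebras" "HOL-Computational_Algebra.Formal_Power_Series"
begin

text \<open>
  An intertwining operator out of \<open>K\<^bsub>1,2\<^esub> \<otimes> V\<^sub>1\<close> is determined by one vector-valued series. Let
  \<open>w\<close> be the lowest weight vector of \<open>K\<^bsub>1,2\<^esub>\<close>. The commutator and iterate formulas recover
  \<open>\<Y>\<close> from \<open>\<phi>(z) = \<Y>(w, z) v\<^sub>1\<close>, because \<open>w\<close> and \<open>v\<^sub>1\<close> generate their modules. Since \<open>L\<^sub>0\<close> acts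
  semisimply on \<open>V\<^sub>2\<close>, no logarithms occur and \<open>\<phi>(z) = \<Sum>\<^sub>N \<phi>\<^sub>N z\<^bsup>N + x\<^esup>\<close>, where
  \<open>x = h\<^sub>2 - h\<^sub>1 - h\<^bsub>1,2\<^esub>\<close> and \<open>\<phi>\<^sub>N\<close> has weight \<open>h\<^sub>2 + N\<close>. The null vector relation
  \<open>(L\<^bsub>-1\<^esub>\<^sup>2 - t\<^bsup>-1\<^esup> L\<^bsub>-2\<^esub>) w = 0\<close> then becomes
  \<open>(t N\<^sup>2 - s N) \<phi>\<^sub>N = \<Sum>\<^bsub>k<N\<^esub> L\<^bsub>k-N\<^esub> \<phi>\<^sub>k\<close>, where \<open>s\<close> is the chosen square root: the
  relation between \<open>h\<^sub>1\<close> and \<open>h\<^sub>2\<close> says that \<open>x\<close> is a root of the indicial equation, and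
  \<open>s / t \<notin> \<int>\<^bsub>\<ge>1\<^esub>\<close> says that no \<open>N \<ge> 1\<close> is resonant. So \<open>\<phi>\<close> is determined by
  \<open>\<phi>\<^sub>0 \<in> \<complex> v\<^sub>2\<close>, which is uniqueness (lemmas \<open>intertwining_generator\<close> and
  \<open>intertwining_determined\<close>).

  For existence, the recursion starting at \<open>\<phi>\<^sub>0 = v\<^sub>2\<close> defines \<open>\<phi>\<close>, and its commutators with
  \<open>L\<^sub>1\<close> and \<open>L\<^sub>2\<close> come out right by induction on \<open>N\<close> (lemmas \<open>L1_phi\<close> and \<open>L2_phi\<close>). These say that
  \<open>\<phi>\<close> is a lowest weight vector for a twisted action on series, so the universal property of
  \<open>V\<^sub>1\<close> extends \<open>\<phi>\<close> to a primary field \<open>\<psi>(z) : V\<^sub>1 \<rightarrow> V\<^sub>2\<close>. The iterate formula, read as a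
  definition, makes local translation covariant fields into a Virasoro module of central charge
  \<open>c\<close> (lemma \<open>fields_action\<close>). In it \<open>\<psi>\<close> is a lowest weight vector of weight \<open>h\<^bsub>1,2\<^esub>\<close>, so
  \<open>\<chi> = (L\<^bsub>-1\<^esub>\<^sup>2 - t\<^bsup>-1\<^esup> L\<^bsub>-2\<^esub>) \<psi>\<close> is again primary; it kills \<open>v\<^sub>1\<close> by the recursion, hence
  vanishes (lemma \<open>chi_eq_0\<close>). Therefore the universal property of the Verma module of weight
  \<open>h\<^bsub>1,2\<^esub>\<close> gives a map from \<open>K\<^bsub>1,2\<^esub>\<close> to fields, which is the intertwining operator. It is
  surjective because \<open>v\<^sub>2 = \<phi>\<^sub>0\<close> is one of its coefficients.
\<close>

section \<open>Virasoro actions and the universal property of Verma modules\<close>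

text \<open>
  The operators \<open>T n\<close> are only required to behave on a subspace \<open>S\<close>: the actions on spaces of
  series used below are given by infinite sums that make sense under truncation conditions.
\<close>

locale virasoro_action = vector_space sc
  for sc :: "complex \<Rightarrow> 'w::ab_group_add \<Rightarrow> 'w" +
  fixes S :: "'w set" and T :: "int \<Rightarrow> 'w \<Rightarrow> 'w" and c :: complex
  assumes subspace_S: "subspace S"
    and T_closed: "x \<in> S \<Longrightarrow> T n x \<in> S"
    and T_add: "x \<in> S \<Longrightarrow> y \<in> S \<Longrightarrow> T n (x + y) = T n x + T n y"
    and T_scale: "x \<in> S \<Longrightarrow> T n (sc a x) = sc a (T n x)"
    and T_bracket: "x \<in> S \<Longrightarrow> T m (T n x) - T n (T m x) =
          sc (of_int (m - n)) (T (m + n) x)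
          + (if m = - n then sc (of_int (m^3 - m) / 12 * c) x else 0)"
begin

fun word_act :: "vir_basis list \<Rightarrow> 'w \<Rightarrow> 'w" where
  "word_act [] x = x"
| "word_act (Lgen n # k) x = T n (word_act k x)"
| "word_act (Cgen # k) x = sc c (word_act k x)"

definition tensor_act :: "vir_tensor \<Rightarrow> 'w \<Rightarrow> 'w" where
  "tensor_act p x = (\<Sum>k\<in>Poly_Mapping.keys p. sc (Poly_Mapping.lookup p k) (word_act k x))"

lemma word_act_closed: "x \<in> S \<Longrightarrow> word_act k x \<in> S"
  by (induction k x rule: word_act.induct) (auto intro: T_closed subspace_scale[OF subspace_S])

lemma word_act_append: "word_act (k @ l) x = word_act k (word_act l x)"
  by (induction k x rule: word_act.induct) auto

lemma word_act_add: "x \<in> S \<Longrightarrow> y \<in> S \<Longrightarrow>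
    word_act k (x + y) = word_act k x + word_act k y"
  by (induction k x rule: word_act.induct)
     (auto simp: T_add word_act_closed scale_right_distrib)

lemma word_act_scale: "x \<in> S \<Longrightarrow> word_act k (sc a x) = sc a (word_act k x)"
  by (induction k x rule: word_act.induct)
     (auto simp: T_scale word_act_closed mult.commute)

lemma word_act_zero: "word_act k 0 = 0"
  using word_act_scale[of 0 k 0] subspace_0[OF subspace_S] by simp

lemma tensor_act_superset:
  assumes "finite A" "Poly_Mapping.keys p \<subseteq> A"
  shows "tensor_act p x = (\<Sum>k\<in>A. sc (Poly_Mapping.lookup p k) (word_act k x))"
  unfolding tensor_act_def
  by (rule sum.mono_neutral_left) (use assms in \<open>auto simp: in_keys_iff\<close>)

lemma tensor_act_single: "tensor_act (Poly_Mapping.single k a) x = sc a (word_act k x)"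
  by (subst tensor_act_superset[of "{k}"]) (auto simp: lookup_single)

lemma tensor_act_add: "tensor_act (p + q) x = tensor_act p x + tensor_act q x"
proof -
  let ?A = "Poly_Mapping.keys p \<union> Poly_Mapping.keys q"
  have "Poly_Mapping.keys (p + q) \<subseteq> ?A" by (rule Poly_Mapping.keys_add)
  then show ?thesis
    by (simp add: tensor_act_superset[of ?A] lookup_add scale_left_distrib sum.distrib)
qed

lemma tensor_act_closed: "x \<in> S \<Longrightarrow> tensor_act p x \<in> S"
  unfolding tensor_act_def
  by (intro subspace_sum[OF subspace_S] subspace_scale[OF subspace_S] word_act_closed)

lemma word_act_tensor_act:
  assumes "x \<in> S"
  shows "word_act k (tensor_act p x) = tensor_act (Poly_Mapping.single k 1 * p) x"
proof (induction p rule: vir_tensor_induct)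
  case (single l v)
  then show ?case using assms
    by (simp add: mult_single tensor_act_single word_act_scale word_act_closed plus_list_def
        word_act_append)
next
  case (sum p q)
  then show ?case using assms
    by (simp add: tensor_act_add distrib_left word_act_add tensor_act_closed)
qed

lemma tensor_act_scale: "tensor_act (tscale a p) x = sc a (tensor_act p x)"
proof (induction p rule: vir_tensor_induct)
  case (single k v)
  then show ?case by (simp add: tscale_def mult_single tensor_act_single)
next
  case (sum p q)
  then show ?case
    by (simp add: vtensor.scale_right_distrib tensor_act_add scale_right_distrib)
qed

lemma tensor_act_mult: "x \<in> S \<Longrightarrow> tensor_act (p * q) x = tensor_act p (tensor_act q x)"
proof (induction p rule: vir_tensor_induct)
  case (single k v)
  have "Poly_Mapping.single k v * q = tscale v (Poly_Mapping.single k 1 * q)"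
    by (simp add: tscale_def mult_single flip: mult.assoc)
  then show ?case using single
    by (simp only: tensor_act_scale tensor_act_single word_act_tensor_act)
next
  case (sum p1 p2)
  then show ?case by (simp add: distrib_right tensor_act_add)
qed

lemma tensor_act_diff: "tensor_act (p - q) x = tensor_act p x - tensor_act q x"
  and tensor_act_0: "tensor_act 0 x = 0"
proof -
  show z: "tensor_act 0 x = 0" by (simp add: tensor_act_def)
  have m: "tensor_act (- p) x = - tensor_act p x" for p
    using tensor_act_add[of p "- p" x] z by (simp add: eq_neg_iff_add_eq_0 add.commute)
  show "tensor_act (p - q) x = tensor_act p x - tensor_act q x"
    using tensor_act_add[of p "- q" x] by (simp add: m)
qed

lemma tensor_act_tgen:
  "tensor_act (tgen (Lgen n)) x = T n x" "tensor_act (tgen Cgen) x = sc c x"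
  by (simp_all add: tgen_def tensor_act_single)

lemma tensor_act_relation:
  assumes "r \<in> vir_relations" "x \<in> S"
  shows "tensor_act r x = 0"
  using assms(1) unfolding vir_relations_def
proof (elim UnE CollectE exE conjE)
  fix m n assume r: "r = tgen (Lgen m) * tgen (Lgen n) - tgen (Lgen n) * tgen (Lgen m)
        - (tscale (of_int (m - n)) (tgen (Lgen (m + n)))
           + (if m = - n then tscale (of_int (m^3 - m) / 12) (tgen Cgen) else 0))"
  have "tensor_act (if m = - n then tscale (of_int (m^3 - m) / 12) (tgen Cgen) else 0) x
      = (if m = - n then sc (of_int (m^3 - m) / 12 * c) x else 0)"
    by (simp add: tensor_act_scale tensor_act_tgen tensor_act_0)
  then show ?thesis using T_bracket[OF assms(2), of m n]
    unfolding r tensor_act_diff tensor_act_add tensor_act_mult[OF assms(2)] tensor_act_scale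
      tensor_act_tgen
    by simp
next
  fix n assume "r = tgen Cgen * tgen (Lgen n) - tgen (Lgen n) * tgen Cgen"
  then show ?thesis using assms(2)
    by (simp add: tensor_act_diff tensor_act_mult tensor_act_tgen T_scale)
qed

text \<open>
  By this, and multiplicativity, the action of the tensor algebra factors through \<open>U(Vir)\<close>.
\<close>

lemma tensor_act_ideal:
  assumes "p \<in> vir_ideal" "x \<in> S"
  shows "tensor_act p x = 0"
  using assms(1) unfolding vir_ideal_def
proof (induction rule: vtensor.span_induct_alt)
  case base
  then show ?case by (rule tensor_act_0)
next
  case (step a y z)
  then obtain p r q where "y = p * r * q" "r \<in> vir_relations" by blast
  moreover have "tensor_act p 0 = 0" for p
    by (simp add: tensor_act_def word_act_zero)
  ultimately have "tensor_act y x = 0"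
    using assms(2) by (simp add: tensor_act_mult tensor_act_relation tensor_act_closed)
  with step show ?case by (simp add: tensor_act_add tensor_act_scale)
qed

text \<open>
  The kernel of \<open>U(Vir) \<rightarrow> V\<close>, \<open>u \<mapsto> u v\<close>, is generated as a left ideal by elements that kill
  \<open>s\<close>, so \<open>u v \<mapsto> u s\<close> is well defined.
\<close>

lemma verma_universal_property:
  fixes scale :: "complex \<Rightarrow> 'v::ab_group_add \<Rightarrow> 'v"
  assumes verma: "verma_module scale L c h v"
    and s: "s \<in> S" "T 0 s = sc h s" "\<And>n. n > 0 \<Longrightarrow> T n s = 0"
  obtains f where "Vector_Spaces.linear scale sc f" "\<And>n x. f (L n x) = T n (f x)"
    "f v = s" "\<And>x. f x \<in> S"
proof -
  interpret V: verma_module scale L c h v by (rule verma)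
  obtain \<phi> where lin: "Vector_Spaces.linear uscale scale \<phi>"
    and L: "\<And>n u. \<phi> (ugen (Lgen n) * u) = L n (\<phi> u)"
    and one: "\<phi> 1 = v" and surj: "surj \<phi>" and ker: "{u. \<phi> u = 0} = verma_left_ideal c h"
    using V.iso_induced_module by blast
  interpret \<phi>: Vector_Spaces.linear uscale scale \<phi> by (rule lin)
  define g where "g u = tensor_act (rep_vir_uea u) s" for u
  have g_abs: "g (abs_vir_uea p) = tensor_act p s" for p
  proof -
    have "vir_cong (rep_vir_uea (abs_vir_uea p)) p"
      by (simp add: Quotient3_abs_rep[OF Quotient3_vir_uea] flip: vir_uea.abs_eq_iff)
    then show ?thesis
      using tensor_act_ideal[of "rep_vir_uea (abs_vir_uea p) - p", OF _ s(1)]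
      by (simp add: g_def vir_cong_def tensor_act_diff)
  qed
  have abs: "\<exists>p. u = abs_vir_uea p" for u
    by (metis Quotient3_abs_rep[OF Quotient3_vir_uea])
  have g_add: "g (u + w) = g u + g w" for u w
    using abs[of u] abs[of w] by (auto simp: plus_vir_uea.abs_eq g_abs tensor_act_add)
  have g_scale: "g (uscale a u) = sc a (g u)" for a u
    using abs[of u] by (auto simp: uscale.abs_eq g_abs tensor_act_scale)
  have g_mult: "g (abs_vir_uea p * u) = tensor_act p (g u)" for p u
    using abs[of u] by (auto simp: times_vir_uea.abs_eq g_abs tensor_act_mult s(1))
  have g_gen: "g (ugen (Lgen n) * u) = T n (g u)" for n u
    using g_mult[of "tgen (Lgen n)" u] by (simp add: ugen.abs_eq tensor_act_tgen)
  have g_1: "g 1 = s"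
    by (simp add: one_vir_uea.abs_eq g_abs single_one [symmetric] tensor_act_single zero_list_def
        del: single_one)
  have g_ideal: "g u = 0" if "u \<in> verma_left_ideal c h" for u
    using that unfolding verma_left_ideal_def
  proof (induction rule: vuea.span_induct_alt)
    case base
    then show ?case using g_scale[of 0 0] by simp
  next
    case (step a y z)
    then obtain u x where y: "y = u * x"
      and x: "x \<in> {ugen (Lgen n) | n. n > 0} \<union> {ugen (Lgen 0) - uscale h 1, ugen Cgen
          - uscale c 1}"
      by blast
    have minus: "g (a - b) = g a - g b" for a b
      using g_add[of "a - b" b] by (simp add: algebra_simps)
    have "g (ugen Cgen) = sc c s"
      using g_mult[of "tgen Cgen" 1] by (simp add: ugen.abs_eq[symmetric] tensor_act_tgen g_1)
    moreover have "g (ugen (Lgen n)) = T n s" for n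
      using g_gen[of n 1] by (simp add: g_1)
    ultimately have "g x = 0" using x s
      by (auto simp: minus g_scale g_1)
    moreover obtain p where "u = abs_vir_uea p" using abs by blast
    ultimately have "g y = 0"
      by (simp add: y g_mult tensor_act_def word_act_zero)
    with step show ?case by (simp add: g_add g_scale)
  qed
  define f where "f x = g (inv \<phi> x)" for x
  have f_\<phi>: "f (\<phi> u) = g u" for u
  proof -
    have "\<phi> (inv \<phi> (\<phi> u) - u) = 0" using surj by (simp add: \<phi>.diff surj_f_inv_f)
    then have "g (inv \<phi> (\<phi> u) - u) = 0" using g_ideal ker by blast
    then show ?thesis using g_add[of "inv \<phi> (\<phi> u) - u" u] by (simp add: f_def)
  qed
  have \<phi>_ex: "\<exists>u. x = \<phi> u" for x using surj by blast
  show thesis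
  proof (rule that[of f])
    show "Vector_Spaces.linear scale sc f"
    proof (unfold_locales)
      fix x y a
      obtain u w where [simp]: "x = \<phi> u" "y = \<phi> w" using \<phi>_ex by blast
      show "f (x + y) = f x + f y" by (simp add: f_\<phi> g_add flip: \<phi>.add)
      show "f (scale a x) = sc a (f x)" by (simp add: f_\<phi> g_scale flip: \<phi>.scale)
    qed
    show "f (L n x) = T n (f x)" for n x
      using \<phi>_ex[of x] by (auto simp: f_\<phi> g_gen simp flip: L)
    show "f v = s" by (simp add: f_\<phi> g_1 flip: one)
    show "f x \<in> S" for x
      unfolding f_def g_def by (rule tensor_act_closed[OF s(1)])
  qed
qed

lemma T_commute: "x \<in> S \<Longrightarrow> T m (T n x) = T n (T m x) + sc (of_int (m - n)) (T (m + n) x)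
          + (if m = - n then sc (of_int (m^3 - m) / 12 * c) x else 0)"
  using T_bracket[of x m n] by (simp add: algebra_simps)

lemma T_0: "T n 0 = 0"
  using T_scale[of 0 n 0] subspace_0[OF subspace_S] by simp

lemma T_diff: "x \<in> S \<Longrightarrow> y \<in> S \<Longrightarrow> T n (x - y) = T n x - T n y"
  using T_add[of "x" "sc (-1) y" n] T_scale[of y n "-1"] subspace_neg[OF subspace_S] by simp

text \<open>
  The vector that is divided out to form \<open>K\<^bsub>1,2\<^esub>\<close> is singular in every action, because the
  brackets alone give it. The two scalar conditions, from \<open>T 1\<close> and \<open>T 2\<close>, are
  \<open>4h + 2 = 3/t\<close> and \<open>6h = (4h + c/2)/t\<close>.
\<close>

lemma singular_vector:
  assumes s: "s \<in> S" "T 0 s = sc h s" "\<And>n. n > 0 \<Longrightarrow> T n s = 0"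
    and t: "t \<noteq> 0" "c = 13 - 6 * t - 6 / t" "h = - 1 / 2 + 3 / (4 * t)"
  defines "x \<equiv> T (-1) (T (-1) s) - sc (1 / t) (T (-2) s)"
  shows "T 0 x = sc (h + 2) x" "\<And>n. n > 0 \<Longrightarrow> T n x = 0"
proof -
  have S: "T n s \<in> S" "T n (T m s) \<in> S" "sc a (T n s) \<in> S" for n m a
    using s(1) T_closed subspace_scale[OF subspace_S] by auto
  have Tx: "T n x = T n (T (-1) (T (-1) s)) - sc (1 / t) (T n (T (-2) s))" for n
    by (simp add: x_def T_diff T_scale S)
  have a1: "T n (T (-1) s) = T (-1) (T n s) + sc (of_int (n + 1)) (T (n - 1) s)" if "n \<ge> 0" for n
    using T_commute[OF s(1), of n "-1"] that by simp
  have a11: "T n (T (-1) (T (-1) s)) = T (-1) (T n (T (-1) s)) + sc (of_int (n + 1)) (T (n - 1) (T (-1) s))"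
    if "n \<ge> 0" for n
    using T_commute[OF S(1)[of "-1"], of n "-1"] that by simp
  have a2: "T n (T (-2) s) = T (-2) (T n s) + sc (of_int (n + 2)) (T (n - 2) s)
      + (if n = 2 then sc (c / 2) s else 0)" for n
    using T_commute[OF s(1), of n "-2"] by simp
  have z: "T 0 (T (-1) s) = sc (h + 1) (T (-1) s)"
    using a1[of 0] s by (simp add: T_scale scale_left_distrib)
  have "T (-1) (T 0 (T (-1) s)) = sc (h + 1) (T (-1) (T (-1) s))"
    unfolding z by (rule T_scale[OF S(1)])
  then have "T 0 (T (-1) (T (-1) s)) = sc (h + 2) (T (-1) (T (-1) s))"
  proof -
    have "T 0 (T (-1) (T (-1) s)) = T (-1) (T 0 (T (-1) s)) + T (-1) (T (-1) s)"
      using a11[of 0] by simp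
    also have "\<dots> = sc (h + 1) (T (-1) (T (-1) s)) + sc 1 (T (-1) (T (-1) s))"
      by (simp only: \<open>T (-1) (T 0 (T (-1) s)) = _\<close> scale_one)
    also have "\<dots> = sc (h + 1 + 1) (T (-1) (T (-1) s))"
      by (simp only: scale_left_distrib)
    finally show ?thesis by (simp only: add.assoc one_add_one)
  qed
  moreover have "T 0 (T (-2) s) = sc (h + 2) (T (-2) s)"
    using a2[of 0] s by (simp add: T_scale scale_left_distrib)
  ultimately show "T 0 x = sc (h + 2) x"
    unfolding Tx by (simp only: x_def scale_right_diff_distrib scale_scale mult.commute)
  fix n :: int assume "n > 0"
  then consider "n = 1" | "n = 2" | "n \<ge> 3" by linarith
  then show "T n x = 0"
  proof cases
    case 1
    have "T 1 (T (-1) s) = sc (2 * h) s" using a1[of 1] s by (simp add: T_0)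
    then have "T 1 (T (-1) (T (-1) s)) = sc (4 * h + 2) (T (-1) s)"
    proof -
      have "T 1 (T (-1) (T (-1) s)) = sc (2 * h) (T (-1) s) + sc (2 * (h + 1)) (T (-1) s)"
        using a11[of 1] z s(1) \<open>T 1 (T (-1) s) = sc (2 * h) s\<close> by (simp add: T_scale)
      also have "\<dots> = sc (2 * h + 2 * (h + 1)) (T (-1) s)" by (simp only: scale_left_distrib)
      also have "2 * h + 2 * (h + 1) = 4 * h + 2" by simp
      finally show ?thesis .
    qed
    moreover have "T 1 (T (-2) s) = sc 3 (T (-1) s)" using a2[of 1] s by (simp add: T_0)
    moreover have "4 * h + 2 = 3 / t" using t by (simp add: field_simps)
    ultimately show ?thesis using 1 by (simp add: Tx)
  next
    case 2
    have "T 1 (T (-1) s) = sc (2 * h) s" using a1[of 1] s by (simp add: T_0)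
    moreover have "T 2 (T (-1) s) = 0" using a1[of 2] s by (simp add: T_0)
    ultimately have "T 2 (T (-1) (T (-1) s)) = sc (6 * h) s"
      using a11[of 2] by (simp add: T_0)
    moreover have "T 2 (T (-2) s) = sc (4 * h + c / 2) s"
      using a2[of 2] s by (simp add: T_0 scale_left_distrib)
    moreover have "6 * h = (4 * h + c / 2) / t"
      using t(1) unfolding t(2,3) by (simp add: field_simps power2_eq_square)
    ultimately show ?thesis using 2 by (simp add: Tx)
  next
    case 3
    then have "T (n - 1) (T (-1) s) = 0" "T n (T (-1) s) = 0"
      using a1[of n] a1[of "n - 1"] s by (simp_all add: T_0)
    then show ?thesis using 3 s a11[of n] by (simp add: Tx a2 T_0)
  qed
qed

end

section \<open>Modules generated by a lowest weight vector\<close>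

context virasoro_module
begin

lemma L_add: "L n (x + y) = L n x + L n y"
  and L_scale: "L n (scale a x) = scale a (L n x)"
  and L_0: "L n 0 = 0"
  and L_diff: "L n (x - y) = L n x - L n y"
  and L_sum: "L n (sum f A) = (\<Sum>i\<in>A. L n (f i))"
proof -
  interpret l: Vector_Spaces.linear scale scale "L n" by (rule linear_L)
  show "L n (x + y) = L n x + L n y" "L n (scale a x) = scale a (L n x)" "L n 0 = 0"
    "L n (x - y) = L n x - L n y" "L n (sum f A) = (\<Sum>i\<in>A. L n (f i))"
    by (simp_all add: l.add l.scale l.zero l.diff l.sum)
qed

lemma L_commute: "L m (L n w) = L n (L m w) + scale (of_int (m - n)) (L (m + n) w)
         + (if m = - n then scale (of_int (m^3 - m) / 12 * c) w else 0)"
  using L_bracket[of m n w] by (simp add: algebra_simps)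

text \<open>
  For \<open>N = 1\<close> this removes one eigenvector from a vanishing sum; for large \<open>N\<close> it shows that
  generalized eigenvectors of a semisimple \<open>L\<^sub>0\<close> are eigenvectors.
\<close>

lemma shifted_L0_power_sum:
  assumes "finite I" and "\<And>n. n \<in> I \<Longrightarrow> L 0 (f n) = scale (e n) (f n)"
  shows "((\<lambda>x. L 0 x - scale \<mu> x) ^^ N) (\<Sum>n\<in>I. f n)
      = (\<Sum>n\<in>I. scale ((e n - \<mu>) ^ N) (f n))"
proof (induction N)
  case (Suc N)
  let ?g = "\<lambda>n. scale ((e n - \<mu>) ^ N) (f n)"
  have "((\<lambda>x. L 0 x - scale \<mu> x) ^^ Suc N) (\<Sum>n\<in>I. f n)
      = (\<Sum>n\<in>I. L 0 (?g n) - scale \<mu> (?g n))"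
    by (simp only: funpow.simps o_apply Suc.IH L_sum scale_sum_right sum_subtractf)
  also have "\<dots> = (\<Sum>n\<in>I. scale ((e n - \<mu>) ^ Suc N) (f n))"
    by (rule sum.cong) (simp_all add: L_scale assms(2) left_diff_distrib scale_left_diff_distrib
        mult.commute)
  finally show ?case .
qed simp

text \<open>
  Applying \<open>L\<^sub>0 - e j\<close> to a vanishing sum removes the \<open>j\<close>-th term and rescales the others by
  nonzero numbers.
\<close>

lemma eigenvectors_independent:
  assumes "finite I" and "\<And>n. n \<in> I \<Longrightarrow>
      L 0 (f n) = scale (e n) (f n)" and "inj_on e I"
    and "(\<Sum>n\<in>I. f n) = 0" and "n \<in> I"
  shows "f n = 0"
  using assms
proof (induction I arbitrary: f n rule: finite_induct)
  case (insert j I)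
  have *: "f n = 0" if "n \<in> I" for n
  proof -
    have "(\<Sum>n\<in>insert j I. scale (e n - e j) (f n)) = 0"
      using shifted_L0_power_sum[of "insert j I" f e 1 "e j"] insert.prems(1,3) insert.hyps
      by (simp add: L_0)
    then have "(\<Sum>n\<in>I. scale (e n - e j) (f n)) = 0" using insert.hyps by simp
    then have "scale (e n - e j) (f n) = 0"
      using that insert.prems(1,2) by (intro insert.IH[of "\<lambda>n. scale (e n - e j) (f n)"])
        (auto simp: L_scale mult.commute)
    moreover have "e n \<noteq> e j" using insert.prems(2) insert.hyps that by (auto simp: inj_on_def)
    ultimately show ?thesis by simp
  qed
  then show ?case using insert by (auto simp: sum.neutral)
qed simp

end

locale lowest_weight_module = virasoro_module scale L c
  for scale :: "complex \<Rightarrow> 'v::ab_group_add \<Rightarrow> 'v" and L c +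
  fixes h :: complex and v :: 'v
  assumes L_pos_v: "n > 0 \<Longrightarrow> L n v = 0"
    and L0_v: "L 0 v = scale h v"
    and generated: "subspace S \<Longrightarrow> v \<in> S \<Longrightarrow>
        (\<And>n w. w \<in> S \<Longrightarrow> L n w \<in> S) \<Longrightarrow> S = UNIV"
begin

lemma generated_induct [consumes 0, case_names gen L add scale]:
  assumes "P v" "\<And>n w. P w \<Longrightarrow> P (L n w)" "\<And>x y. P x \<Longrightarrow>
      P y \<Longrightarrow> P (x + y)"
    "\<And>a x. P x \<Longrightarrow> P (scale a x)"
  shows "P x"
proof -
  have "P 0" using assms(4)[of v 0] assms(1) by simp
  then have "subspace {x. P x}" using assms by (auto simp: subspace_def)
  from generated[OF this] assms show ?thesis by auto
qed

text \<open>
  The words \<open>L\<^bsub>-k\<^sub>1\<^esub> \<cdots> L\<^bsub>-k\<^sub>r\<^esub> v\<close>, \<open>k\<^sub>i > 0\<close>, in any order, graded by \<open>k\<^sub>1 + \<cdots> + k\<^sub>r\<close>.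
\<close>

inductive monomial :: "int \<Rightarrow> 'v \<Rightarrow> bool" where
  monomial_gen: "monomial 0 v"
| monomial_L: "monomial n x \<Longrightarrow> k > 0 \<Longrightarrow> monomial (n + k) (L (- k) x)"

definition level :: "int \<Rightarrow> 'v set" where
  "level n = span {x. monomial n x}"

lemma monomial_nonneg: "monomial n x \<Longrightarrow> n \<ge> 0"
  by (induction rule: monomial.induct) auto

lemma level_neg: "n < 0 \<Longrightarrow> level n = {0}"
  using monomial_nonneg[of n] by (force simp: level_def)

lemma monomial_0: "monomial 0 x \<Longrightarrow> x = v"
  by (erule monomial.cases) (auto dest: monomial_nonneg)

lemma level_0: "level 0 = range (\<lambda>a. scale a v)"
proof -
  have "{x. monomial 0 x} = {v}" using monomial_0 monomial_gen by blast
  then show ?thesis by (auto simp: level_def span_singleton)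
qed

text \<open>
  A monomial of degree \<open>n\<close> arises from one of smaller degree \<open>m\<close> by a single \<open>L\<^bsub>m-n\<^esub>\<close>.
\<close>

lemma finite_monomials: "finite {x. monomial n x}"
proof (induction "nat n" arbitrary: n rule: less_induct)
  case less
  have "{x. monomial n x} \<subseteq> insert v (\<Union>m\<in>{0..<n}. L (m - n) ` {x. monomial m x})"
  proof (intro subsetI, elim CollectE)
    fix x assume "monomial n x"
    then show "x \<in> insert v (\<Union>m\<in>{0..<n}. L (m - n) ` {x. monomial m x})"
      by (cases rule: monomial.cases) (auto dest: monomial_nonneg intro!: bexI)
  qed
  moreover have "finite (insert v (\<Union>m\<in>{0..<n}. L (m - n) ` {x. monomial m x}))"
    using less by auto
  ultimately show ?case by (rule finite_subset)
qed

lemma subspace_level: "subspace (level n)"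
  by (simp add: level_def)

lemma L_level_neg: "x \<in> level n \<Longrightarrow> k > 0 \<Longrightarrow> L (- k) x \<in> level (n + k)"
  unfolding level_def
proof (induction rule: span_induct_alt)
  case base
  then show ?case by (simp add: L_0 span_zero)
next
  case (step a x y)
  have "L (- k) x \<in> span {x. monomial (n + k) x}"
    using step by (intro span_base) (auto intro: monomial_L)
  with step show ?case by (simp add: L_add L_scale span_add span_scale)
qed

text \<open>
  A nonnegative mode is moved to the right through \<open>L\<^bsub>-j\<^esub>\<close>; the bracket has the mode \<open>k - j\<close> on a
  shorter monomial, which is why the induction is over all integers \<open>k\<close> at once.
\<close>

lemma L_monomial: "monomial n x \<Longrightarrow> L k x \<in> level (n - k)"
proof (induction arbitrary: k rule: monomial.induct)
  case monomial_gen
  consider "k > 0" | "k = 0" | "k < 0" by linarith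
  then show ?case
  proof cases
    case 3
    then have "monomial (- k) (L k v)"
      using monomial.monomial_L[OF monomial.monomial_gen, of "- k"] by simp
    then show ?thesis by (simp add: level_def span_base)
  qed (auto simp: L_pos_v L0_v level_0 level_neg)
next
  case (monomial_L n x j k)
  show ?case
  proof (cases "k \<ge> 0")
    case True
    have "L (- j) (L k x) \<in> level (n + j - k)"
      using L_level_neg[OF monomial_L.IH[of k] monomial_L.hyps(2)] by (simp add: algebra_simps)
    moreover have "L (k - j) x \<in> level (n + j - k)"
      using monomial_L.IH[of "k - j"] by (simp add: algebra_simps)
    moreover have "x \<in> level (n + j - k)" if "k = j"
      using that monomial_L.hyps by (simp add: level_def span_base)
    ultimately show ?thesis
      by (subst L_commute) (auto intro!: subspace_add[OF subspace_level]
          subspace_scale[OF subspace_level] subspace_0[OF subspace_level])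
  next
    case False
    then show ?thesis
      using monomial.monomial_L[OF monomial.monomial_L[OF monomial_L.hyps], of "- k"]
      by (simp add: level_def span_base)
  qed
qed

lemma L_level: "x \<in> level n \<Longrightarrow> L k x \<in> level (n - k)"
  unfolding level_def
proof (induction rule: span_induct_alt)
  case base
  then show ?case by (simp add: L_0 span_zero)
next
  case (step a x y)
  then show ?case using L_monomial[of n x k]
    by (auto simp: L_add L_scale level_def intro!: span_add span_scale)
qed

lemma L0_level: "x \<in> level n \<Longrightarrow> L 0 x = scale (h + of_int n) x"
  unfolding level_def
proof (induction rule: span_induct_alt)
  case base
  then show ?case by (simp add: L_0)
next
  case (step a x y)
  from step(1) have "monomial n x" by simp
  then have "L 0 x = scale (h + of_int n) x"
  proof (induction rule: monomial.induct)
    case monomial_gen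
    then show ?case by (simp add: L0_v)
  next
    case (monomial_L n x k)
    then show ?case
      by (subst L_commute) (simp add: L_scale L_add algebra_simps)
  qed
  with step show ?case by (simp add: L_add L_scale algebra_simps)
qed

lemma span_monomials: "span (\<Union>n. {x. monomial n x}) = UNIV"
proof (rule generated)
  show "v \<in> span (\<Union>n. {x. monomial n x})"
    using monomial_gen by (intro span_base) blast
  fix n w assume "w \<in> span (\<Union>n. {x. monomial n x})"
  then show "L n w \<in> span (\<Union>n. {x. monomial n x})"
  proof (induction rule: span_induct_alt)
    case base
    then show ?case by (simp add: L_0 span_zero)
  next
    case (step a x y)
    then obtain m where "monomial m x" by blast
    then have "L n x \<in> span {x. monomial (m - n) x}" using L_monomial by (simp add: level_def)
    then have "L n x \<in> span (\<Union>n. {x. monomial n x})"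
      by (rule set_rev_mp) (intro span_mono, blast)
    with step show ?case by (simp add: L_add L_scale span_add span_scale)
  qed
qed simp

lemma level_decomposition:
  obtains I :: "int set" and f where "finite I" "\<And>n. f n \<in> level n" "w = (\<Sum>n\<in>I. f n)"
proof -
  have "w \<in> span (\<Union>n. {x. monomial n x})" by (simp add: span_monomials)
  then have "\<exists>I f. finite (I :: int set) \<and> (\<forall>n. f n \<in> level n) \<and> w
      = (\<Sum>n\<in>I. f n)"
  proof (induction rule: span_induct_alt)
    case base
    then show ?case
      by (intro exI[of _ "{}"] exI[of _ "\<lambda>_. 0"]) (simp add: subspace_0[OF subspace_level])
  next
    case (step a x y)
    then obtain I f m where I: "finite I" "\<forall>n. f n \<in> level n" "y = (\<Sum>n\<in>I. f n)"
      and m: "monomial m x" by blast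
    define f' where "f' n = (if n \<in> I then f n else 0) + (if n = m then scale a x else 0)" for n
    have "scale a x + y = (\<Sum>n\<in>insert m I. f' n)"
      using I(1,3) by (simp add: f'_def sum.distrib sum.If_cases) (auto intro!: sum.cong)
    moreover have "scale a x \<in> level m"
      using m by (simp add: level_def span_base span_scale)
    then have "f' n \<in> level n" for n
      using I(2) by (auto simp: f'_def intro!: subspace_add[OF subspace_level]
          subspace_0[OF subspace_level])
    ultimately show ?case using I(1) by (intro exI[of _ "insert m I"] exI[of _ f']) auto
  qed
  then show thesis using that by blast
qed

text \<open>
  \<open>L\<^sub>0\<close> is semisimple, so a generalized eigenvector has only one component in the grading.
\<close>

lemma generalized_eigenvector:
  assumes "w \<in> generalized_eigenspace \<mu>"
  shows "w = 0 \<or> (\<exists>n. \<mu> = h + of_int n \<and> w \<in> level n)"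
proof -
  obtain N where N: "((\<lambda>x. L 0 x - scale \<mu> x) ^^ N) w = 0"
    using assms by (auto simp: generalized_eigenspace_def)
  obtain I f where I: "finite (I :: int set)" "\<And>n. f n \<in> level n" "w = (\<Sum>n\<in>I. f n)"
    using level_decomposition by blast
  have f: "L 0 (f n) = scale (h + of_int n) (f n)" for n using I(2) L0_level by blast
  have "(\<Sum>n\<in>I. scale ((h + of_int n - \<mu>) ^ N) (f n)) = 0"
    using N shifted_L0_power_sum[OF I(1), of f "\<lambda>n. h + of_int n" N \<mu>] f I(3) by simp
  then have *: "f n = 0" if "n \<in> I" "\<mu> \<noteq> h + of_int n" for n
    using that eigenvectors_independent[OF I(1), of "\<lambda>n. scale ((h + of_int n - \<mu>) ^ N) (f n)"
        "\<lambda>n. h + of_int n" n] by (force simp: L_scale f inj_on_def mult.commute)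
  show ?thesis
  proof (cases "\<exists>n\<in>I. \<mu> = h + of_int n")
    case True
    then obtain n where n: "n \<in> I" "\<mu> = h + of_int n" by blast
    have "w = (\<Sum>k\<in>{n}. f k)"
      unfolding I(3) using n I(1) * by (intro sum.mono_neutral_right) auto
    then show ?thesis using n I(2) by auto
  next
    case False
    then show ?thesis using * by (auto simp: I(3) intro!: sum.neutral)
  qed
qed

lemma generalized_eigenvector_L0:
  assumes "w \<in> generalized_eigenspace \<mu>"
  shows "L 0 w = scale \<mu> w"
  using generalized_eigenvector[OF assms] by (auto simp: L_0 L0_level)

lemma level_eigenspace: "level n \<subseteq> generalized_eigenspace (h + of_int n)"
  by (auto simp: generalized_eigenspace_def L0_level intro!: exI[of _ 1])

lemma eigenvector_level:
  "L 0 w = scale (h + of_int n) w \<Longrightarrow> w \<in> level n"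
  using generalized_eigenvector[of w "h + of_int n"] subspace_0[OF subspace_level[of n]]
  by (force simp: generalized_eigenspace_def intro: exI[of _ 1])

lemma zero_in_generalized_eigenspace: "0 \<in> generalized_eigenspace \<mu>"
  by (auto simp: generalized_eigenspace_def intro!: exI[of _ 0])

text \<open>
  The grading by degree has finite-dimensional pieces, is bounded below, and consists of the
  generalized eigenspaces.
\<close>

lemma Vc_module: "Vc_module scale L c"
proof unfold_locales
  show "\<exists>N. \<forall>n\<ge>N. L n w = 0" for w
  proof -
    obtain I f where I: "finite (I :: int set)" "\<And>n. f n \<in> level n" "w = (\<Sum>n\<in>I. f n)"
      using level_decomposition by blast
    have "L n (f k) = 0" if "n \<ge> Max (insert 0 I) + 1" "k \<in> I" for n k
    proof -
      have "k \<le> Max (insert 0 I)" using that I(1) by (intro Max_ge) auto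
      then have "k - n < 0" using that by linarith
      then show ?thesis using L_level[OF I(2), of n k] level_neg[of "k - n"] by blast
    qed
    then have "L n w = 0" if "n \<ge> Max (insert 0 I) + 1" for n
      unfolding I(3) L_sum by (intro sum.neutral ballI) (use that in blast)
    then show ?thesis by blast
  qed
  show "span (\<Union>h. generalized_eigenspace h) = UNIV"
  proof -
    have "(\<Union>n. {x. monomial n x}) \<subseteq> (\<Union>h. generalized_eigenspace h)"
    proof (intro UN_least subsetI)
      fix n x assume "x \<in> {x. monomial n x}"
      then have "x \<in> level n" unfolding level_def by (rule span_base)
      then show "x \<in> (\<Union>h. generalized_eigenspace h)" using level_eigenspace by blast
    qed
    then have "UNIV \<subseteq> span (\<Union>h. generalized_eigenspace h)"
      using span_mono span_monomials by metis
    then show ?thesis by blast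
  qed
  show "\<exists>B. finite B \<and> generalized_eigenspace \<mu> \<subseteq> span B" for \<mu>
  proof (cases "\<exists>n. \<mu> = h + of_int n")
    case True
    then obtain n where n: "\<mu> = h + of_int n" by blast
    have "generalized_eigenspace \<mu> \<subseteq> span {x. monomial n x}"
    proof
      fix w assume "w \<in> generalized_eigenspace \<mu>"
      then have "w = 0 \<or> (\<exists>k. \<mu> = h + of_int k \<and> w \<in> level k)"
        by (rule generalized_eigenvector)
      then show "w \<in> span {x. monomial n x}"
        unfolding n level_def add_left_cancel of_int_eq_iff using span_zero by blast
    qed
    with finite_monomials show ?thesis by (intro exI conjI)
  next
    case False
    then have "generalized_eigenspace \<mu> \<subseteq> span {}"
      using generalized_eigenvector[of _ \<mu>] unfolding span_empty by blast
    then show ?thesis using finite.emptyI by (intro exI conjI)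
  qed
  show "\<exists>N::int. \<forall>n<N. generalized_eigenspace (\<mu> + of_int n) = {0}" for \<mu>
  proof (cases "\<exists>m. \<mu> = h + of_int m")
    case True
    then obtain m where m: "\<mu> = h + of_int m" by blast
    have "generalized_eigenspace (\<mu> + of_int n) = {0}" if "n < - m" for n
    proof -
      have "w = 0" if w: "w \<in> generalized_eigenspace (\<mu> + of_int n)" for w
      proof -
        from generalized_eigenvector[OF w] obtain k
          where "w = 0 \<or> (\<mu> + of_int n = h + of_int k \<and> w \<in> level k)" by blast
        moreover have "k = m + n" if "\<mu> + of_int n = h + of_int k"
        proof -
          have "(of_int (m + n) :: complex) = of_int k" using that by (simp add: m)
          then show ?thesis by (simp only: of_int_eq_iff)
        qed
        ultimately show ?thesis using \<open>n < - m\<close> level_neg by auto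
      qed
      then show ?thesis using zero_in_generalized_eigenspace by auto
    qed
    then show ?thesis by blast
  next
    case False
    have "generalized_eigenspace (\<mu> + of_int n) = {0}" for n
    proof -
      have "\<mu> + of_int n \<noteq> h + of_int k" for k
      proof
        assume "\<mu> + of_int n = h + of_int k"
        then have "\<mu> = h + of_int (k - n)" by (simp add: algebra_simps)
        with False show False by blast
      qed
      then show ?thesis
        using generalized_eigenvector[of _ "\<mu> + of_int n"] zero_in_generalized_eigenspace by auto
    qed
    then show ?thesis by blast
  qed
qed

end

lemma (in verma_module) lowest_weight_module: "lowest_weight_module scale L c h v"
proof -
  obtain \<phi> where lin: "Vector_Spaces.linear uscale scale \<phi>"
    and L: "\<And>n u. \<phi> (ugen (Lgen n) * u) = L n (\<phi> u)"
    and C: "\<And>u. \<phi> (ugen Cgen * u) = scale c (\<phi> u)"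
    and one: "\<phi> 1 = v" and surj: "surj \<phi>" and ker: "{u. \<phi> u = 0} = verma_left_ideal c h"
    using iso_induced_module by blast
  interpret \<phi>: Vector_Spaces.linear uscale scale \<phi> by (rule lin)
  have ideal: "\<phi> x = 0"
    if "x \<in> {ugen (Lgen n) | n. n > 0} \<union> {ugen (Lgen 0) - uscale h 1, ugen Cgen
        - uscale c 1}" for x
  proof -
    have "1 * x \<in> verma_left_ideal c h"
      unfolding verma_left_ideal_def using that by (intro vuea.span_base) blast
    then show ?thesis using ker by auto
  qed
  show ?thesis
  proof unfold_locales
    show "L n v = 0" if "n > 0" for n
      using ideal[of "ugen (Lgen n)"] that L[of n 1] one by auto
    show "L 0 v = scale h v"
      using ideal[of "ugen (Lgen 0) - uscale h 1"] L[of 0 1] one by (simp add: \<phi>.diff \<phi>.scale)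
    fix S assume S: "subspace S" "v \<in> S" "\<And>n w. w \<in> S \<Longrightarrow> L n w \<in> S"
    have word: "\<phi> (abs_vir_uea (Poly_Mapping.single k 1)) \<in> S" for k
    proof (induction k)
      case Nil
      have "abs_vir_uea (Poly_Mapping.single [] 1) = 1"
        by (simp add: one_vir_uea.abs_eq flip: single_one zero_list_def)
      then show ?case using S one by simp
    next
      case (Cons x k)
      have "Poly_Mapping.single (x # k) (1::complex) = tgen x * Poly_Mapping.single k 1"
        by (simp add: tgen_def mult_single plus_list_def)
      then have "abs_vir_uea (Poly_Mapping.single (x # k) 1)
          = ugen x * abs_vir_uea (Poly_Mapping.single k 1)"
        by (simp add: times_vir_uea.abs_eq ugen.abs_eq)
      then show ?case using Cons S subspace_scale[OF S(1)] by (cases x) (auto simp: L C)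
    qed
    have "\<phi> (abs_vir_uea p) \<in> S" for p
    proof (induction p rule: vir_tensor_induct)
      case (single k a)
      have "Poly_Mapping.single k a = tscale a (Poly_Mapping.single k 1)"
        by (simp add: tscale_def mult_single)
      then have "abs_vir_uea (Poly_Mapping.single k a)
          = uscale a (abs_vir_uea (Poly_Mapping.single k 1))"
        by (simp add: uscale.abs_eq)
      then show ?case using word subspace_scale[OF S(1)] by (simp add: \<phi>.scale)
    next
      case (sum p q)
      then show ?case using subspace_add[OF S(1)] by (simp add: \<phi>.add flip: plus_vir_uea.abs_eq)
    qed
    moreover have "\<exists>p. x = \<phi> (abs_vir_uea p)" for x
      by (metis Quotient3_abs_rep[OF Quotient3_vir_uea] surj surj_def)
    ultimately show "S = UNIV" by (metis UNIV_eq_I)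
  qed
qed

lemma (in virasoro_quotient) lowest_weight_quotient:
  assumes "lowest_weight_module scaleV LV c h v"
  shows "lowest_weight_module scaleW LW c h (\<pi> v)"
proof -
  interpret v: lowest_weight_module scaleV LV c h v by (rule assms)
  interpret \<pi>: Vector_Spaces.linear scaleV scaleW \<pi> by (rule linear_proj)
  show ?thesis
  proof unfold_locales
    show "LW n (\<pi> v) = 0" if "n > 0" for n
      using v.L_pos_v[OF that] proj_L[of n v] by simp
    show "LW 0 (\<pi> v) = scaleW h (\<pi> v)"
      using v.L0_v proj_L[of 0 v] by (simp add: \<pi>.scale)
    fix S assume S: "W.subspace S" "\<pi> v \<in> S" "\<And>n w. w \<in> S \<Longrightarrow> LW n w \<in> S"
    have "\<pi> x \<in> S" for x
      by (induction x rule: v.generated_induct)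
         (use S W.subspace_add[OF S(1)] W.subspace_scale[OF S(1)] in
           \<open>auto simp: \<pi>.add \<pi>.scale proj_L\<close>)
    then show "S = UNIV" using surj_proj by (metis UNIV_eq_I surj_def)
  qed
qed

section \<open>Binomially weighted sums\<close>

locale complex_vector_space = vector_space scale
  for scale :: "complex \<Rightarrow> 'b::ab_group_add \<Rightarrow> 'b"
begin

text \<open>
  With \<open>S\<close> the shift of sequences, this is \<open>(1 - S)\<^sup>b Z\<close> evaluated at \<open>0\<close>. All expansions of
  \<open>(x - z)\<^sup>b\<close> below are of this form, and identities between them become identities between
  powers of \<open>1 - S\<close>.
\<close>

definition bsum :: "complex \<Rightarrow> (nat \<Rightarrow> 'b) \<Rightarrow> 'b" where
  "bsum b Z = Sum_any (\<lambda>i. scale ((-1) ^ i * (b gchoose i)) (Z i))"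

definition finsupp :: "(nat \<Rightarrow> 'b) \<Rightarrow> bool" where
  "finsupp Z \<longleftrightarrow> (\<exists>N. \<forall>i\<ge>N. Z i = 0)"

definition finsupp2 :: "(nat \<Rightarrow> nat \<Rightarrow> 'b) \<Rightarrow> bool" where
  "finsupp2 G \<longleftrightarrow> (\<exists>N. \<forall>i j. i + j \<ge> N \<longrightarrow> G i j = 0)"

lemma finsuppI: "(\<And>i. i \<ge> N \<Longrightarrow> Z i = 0) \<Longrightarrow> finsupp Z"
  by (auto simp: finsupp_def)

lemma finsupp_Suc: "finsupp Z \<Longrightarrow> finsupp (\<lambda>i. Z (Suc i))"
  unfolding finsupp_def by (metis le_SucI)

lemma finsupp_scale: "finsupp Z \<Longrightarrow> finsupp (\<lambda>i. scale (e i) (Z i))"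
  by (auto simp: finsupp_def)

lemma finsupp_add: "finsupp Z \<Longrightarrow> finsupp Z' \<Longrightarrow>
    finsupp (\<lambda>i. Z i + Z' i)"
  unfolding finsupp_def by (metis add.right_neutral max.bounded_iff)

lemma finsupp_diff: "finsupp Z \<Longrightarrow> finsupp Z' \<Longrightarrow>
    finsupp (\<lambda>i. Z i - Z' i)"
  unfolding finsupp_def by (metis diff_zero max.bounded_iff)

lemma Sum_any_eq_sum:
  assumes "\<And>i. i \<ge> N \<Longrightarrow> Z i = 0"
  shows "Sum_any Z = (\<Sum>i<N. Z (i::nat) :: 'b)"
  by (rule Sum_any.expand_superset) (use assms in \<open>auto simp: not_less[symmetric]\<close>)

lemma bsum_eq_sum:
  assumes "\<And>i. i \<ge> N \<Longrightarrow> Z i = 0"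
  shows "bsum b Z = (\<Sum>i<N. scale ((-1) ^ i * (b gchoose i)) (Z i))"
  unfolding bsum_def by (rule Sum_any_eq_sum) (simp add: assms)

lemma bsum_add:
  assumes "finsupp Z" "finsupp Z'"
  shows "bsum b (\<lambda>i. Z i + Z' i) = bsum b Z + bsum b Z'"
proof -
  from assms obtain N N' where "\<forall>i\<ge>N. Z i = 0" "\<forall>i\<ge>N'. Z' i = 0"
      by (auto simp: finsupp_def)
  then show ?thesis
    by (simp add: bsum_eq_sum[of "max N N'"] scale_right_distrib sum.distrib)
qed

lemma bsum_diff:
  assumes "finsupp Z" "finsupp Z'"
  shows "bsum b (\<lambda>i. Z i - Z' i) = bsum b Z - bsum b Z'"
proof -
  from assms obtain N N' where "\<forall>i\<ge>N. Z i = 0" "\<forall>i\<ge>N'. Z' i = 0"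
      by (auto simp: finsupp_def)
  then show ?thesis
    by (simp add: bsum_eq_sum[of "max N N'"] scale_right_diff_distrib sum_subtractf)
qed

lemma bsum_scale:
  assumes "finsupp Z"
  shows "bsum b (\<lambda>i. scale a (Z i)) = scale a (bsum b Z)"
proof -
  from assms obtain N where "\<forall>i\<ge>N. Z i = 0" by (auto simp: finsupp_def)
  then show ?thesis
    by (simp add: bsum_eq_sum[of N] scale_sum_right mult.commute)
qed

lemma bsum_zero: "bsum b (\<lambda>i. 0) = 0"
  by (simp add: bsum_def)

lemma bsum_cong: "(\<And>i. Z i = Z' i) \<Longrightarrow> bsum b Z = bsum b Z'"
  by (simp add: bsum_def)

lemma bsum_single: "bsum b (\<lambda>i. if i = k then z else 0) = scale ((-1) ^ k * (b gchoose k)) z"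
proof -
  have "bsum b (\<lambda>i. if i = k then z else 0)
      = (\<Sum>i<Suc k. scale ((-1) ^ i * (b gchoose i)) (if i = k then z else 0))"
    by (rule bsum_eq_sum) auto
  then show ?thesis by (simp add: if_distrib cong: if_cong)
qed

lemma bsum_neg1: "bsum (- 1) Z = Sum_any Z"
proof -
  have "(-1) ^ i * ((- 1 :: complex) gchoose i) = 1" for i
    using gbinomial_minus[of "1 :: complex" i] binomial_gbinomial[of i i, where 'a = complex]
    by simp
  then show ?thesis by (simp add: bsum_def)
qed

lemma bsum_0: "bsum 0 Z = Z 0"
proof -
  have "bsum 0 Z = (\<Sum>i<Suc 0. scale ((-1) ^ i * (0 gchoose i)) (Z i))"
    unfolding bsum_def by (rule Sum_any_eq_sum) (auto simp: gbinomial_0_left)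
  then show ?thesis by simp
qed

lemma gbinomial_Suc_top: "(b + 1 :: complex) gchoose Suc k = (b gchoose k) + (b gchoose Suc k)"
  by (rule gbinomial_Suc_Suc)

text \<open>
  \<open>(1 - S)\<^bsup>b+1\<^esup> = (1 - S)\<^sup>b - (1 - S)\<^sup>b S\<close>.
\<close>

lemma bsum_pascal:
  assumes "finsupp Z"
  shows "bsum (b + 1) Z = bsum b Z - bsum b (\<lambda>i. Z (Suc i))"
proof -
  from assms obtain N where N: "\<forall>i\<ge>N. Z i = 0" by (auto simp: finsupp_def)
  have "bsum (b + 1) Z = (\<Sum>i<Suc N. scale ((-1) ^ i * ((b + 1) gchoose i)) (Z i))"
    using N by (intro bsum_eq_sum) auto
  also have "\<dots> = Z 0 + (\<Sum>i<N. scale ((-1) ^ Suc i * (b gchoose Suc i)) (Z (Suc i)))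
      - (\<Sum>i<N. scale ((-1) ^ i * (b gchoose i)) (Z (Suc i)))"
    unfolding sum.lessThan_Suc_shift gbinomial_Suc_top
    by (simp add: algebra_simps sum.distrib sum_subtractf sum_negf)
  also have "Z 0 + (\<Sum>i<N. scale ((-1) ^ Suc i * (b gchoose Suc i)) (Z (Suc i)))
      = (\<Sum>i<Suc N. scale ((-1) ^ i * (b gchoose i)) (Z i))"
    unfolding sum.lessThan_Suc_shift by simp
  also have "\<dots> = bsum b Z" using N by (intro bsum_eq_sum[symmetric]) auto
  also have "(\<Sum>i<N. scale ((-1) ^ i * (b gchoose i)) (Z (Suc i))) = bsum b (\<lambda>i. Z (Suc i))"
    using N by (intro bsum_eq_sum[symmetric]) auto
  finally show ?thesis .
qed

text \<open>
  The derivative of \<open>(1 - S)\<^sup>b\<close> with respect to \<open>S\<close>: absorption \<open>i (b choose i) = b (b - 1 choose i - 1)\<close>.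
\<close>

lemma bsum_weight:
  assumes "finsupp Z"
  shows "bsum b (\<lambda>i. scale (of_nat i) (Z i)) = - scale b (bsum (b - 1) (\<lambda>i. Z (Suc i)))"
proof -
  from assms obtain N where N: "\<forall>i\<ge>N. Z i = 0" by (auto simp: finsupp_def)
  have absorb: "of_nat (Suc i) * (b gchoose Suc i) = b * ((b - 1) gchoose i)" for i
    using gbinomial_absorption[of i b] by simp
  have "bsum b (\<lambda>i. scale (of_nat i) (Z i))
      = (\<Sum>i<Suc N. scale ((-1) ^ i * (b gchoose i)) (scale (of_nat i) (Z i)))"
    using N by (intro bsum_eq_sum) auto
  also have "\<dots> = (\<Sum>i<N. scale (- (b * ((-1) ^ i * ((b - 1) gchoose i)))) (Z (Suc i)))"
  proof -
    have "(-1) ^ Suc i * (b gchoose Suc i) * of_nat (Suc i)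
        = - (b * ((-1) ^ i * ((b - 1) gchoose i)))" for i
    proof -
      have "(-1) ^ Suc i * (b gchoose Suc i) * of_nat (Suc i)
          = - ((-1) ^ i * (of_nat (Suc i) * (b gchoose Suc i)))" by simp
      then show ?thesis unfolding absorb by simp
    qed
    then show ?thesis unfolding sum.lessThan_Suc_shift scale_scale by (simp del: of_nat_Suc power_Suc)
  qed
  also have "\<dots> = - scale b (bsum (b - 1) (\<lambda>i. Z (Suc i)))"
    using N by (simp add: bsum_eq_sum[of N] scale_sum_right sum_negf)
  finally show ?thesis .
qed

lemma bsum_coweight: 
  assumes "finsupp Z"
  shows "bsum b (\<lambda>i. scale (b - of_nat i) (Z i)) = scale b (bsum (b - 1) Z)"
proof -
  have "bsum b (\<lambda>i. scale (b - of_nat i) (Z i))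
      = bsum b (\<lambda>i. scale b ((Z i))) - bsum b (\<lambda>i. scale (of_nat i) (Z i))"
    by (simp add: scale_left_diff_distrib bsum_diff finsupp_scale assms)
  also have "\<dots> = scale b (bsum (b - 1 + 1) Z) + scale b (bsum (b - 1) (\<lambda>i. Z (Suc i)))"
    by (simp add: bsum_weight bsum_scale assms)
  also have "\<dots> = scale b (bsum (b - 1) Z)"
    by (subst bsum_pascal) (simp_all add: assms scale_right_diff_distrib)
  finally show ?thesis .
qed

lemma finsupp2_row: "finsupp2 G \<Longrightarrow> finsupp (\<lambda>j. G i j)"
  unfolding finsupp_def finsupp2_def by (meson trans_le_add2)

lemma finsupp2_sum: "finsupp H \<Longrightarrow> finsupp2 (\<lambda>i j. H (i + j))"
  by (auto simp: finsupp_def finsupp2_def)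

lemma finsupp2_swap: "finsupp2 G \<Longrightarrow> finsupp2 (\<lambda>i j. G j i)"
  unfolding finsupp2_def by (metis add.commute)

lemma finsupp2_scale: "finsupp2 G \<Longrightarrow> finsupp2 (\<lambda>i j. scale (e i j) (G i j))"
  by (auto simp: finsupp2_def)

lemma finsupp_bsum: "finsupp2 G \<Longrightarrow> finsupp (\<lambda>i. bsum b (G i))"
  unfolding finsupp2_def finsupp_def
proof (elim exE)
  fix N assume N: "\<forall>i j. N \<le> i + j \<longrightarrow> G i j = 0"
  have "G i = (\<lambda>j. 0)" if "i \<ge> N" for i using N that by auto
  then show "\<exists>N. \<forall>i\<ge>N. bsum b (G i) = 0" by (auto simp: bsum_zero intro!: exI[of _ N])
qed

text \<open>
  Truncation is uniform in one index only; the other bound is a maximum over the finitely many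
  remaining rows.
\<close>

lemma finsupp2I:
  assumes "\<And>i j. j \<ge> N \<Longrightarrow> G i j = 0" and "\<And>j. finsupp (\<lambda>i. G i j)"
  shows "finsupp2 G"
proof -
  obtain K where K: "\<And>j i. i \<ge> K j \<Longrightarrow> G i j = 0"
    using assms(2) unfolding finsupp_def by metis
  define R where "R = N + Max (insert 0 (K ` {..<N}))"
  have "G i j = 0" if "i + j \<ge> R" for i j
  proof (cases "j < N")
    case True
    then have "K j \<le> Max (insert 0 (K ` {..<N}))" by (intro Max_ge) auto
    then have "K j \<le> i" using that True unfolding R_def by linarith
    then show ?thesis by (rule K)
  qed (simp add: assms(1))
  then show ?thesis unfolding finsupp2_def by blast
qed

lemma bsum_bsum_eq_sum:
  assumes "\<And>i j. i + j \<ge> N \<Longrightarrow> G i j = 0"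
  shows "bsum b (\<lambda>i. bsum b' (G i)) =
    (\<Sum>i<N. \<Sum>j<N. scale (((-1) ^ i * (b gchoose i)) * ((-1) ^ j * (b' gchoose j))) (G i j))"
proof -
  have 1: "bsum b' (G i) = (\<Sum>j<N. scale ((-1) ^ j * (b' gchoose j)) (G i j))" for i
    by (rule bsum_eq_sum) (simp add: assms)
  show ?thesis
    by (subst bsum_eq_sum[of N]) (simp_all add: 1 assms scale_sum_right)
qed

lemma bsum_swap:
  assumes "finsupp2 G"
  shows "bsum b (\<lambda>i. bsum b' (\<lambda>j. G i j))
      = bsum b' (\<lambda>j. bsum b (\<lambda>i. G i j))"
proof -
  from assms obtain N where N: "\<forall>i j. i + j \<ge> N \<longrightarrow> G i j = 0"
      by (auto simp: finsupp2_def)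
  let ?c = "\<lambda>b i. (-1) ^ i * (b gchoose i)"
  have "bsum b (\<lambda>i. bsum b' (\<lambda>j. G i j))
      = (\<Sum>i<N. \<Sum>j<N. scale (?c b i * ?c b' j) (G i j))"
    using N by (intro bsum_bsum_eq_sum) blast
  also have "\<dots> = (\<Sum>j<N. \<Sum>i<N. scale (?c b' j * ?c b i) (G i j))"
    by (subst sum.swap) (simp only: mult.commute)
  also have "\<dots> = bsum b' (\<lambda>j. bsum b (\<lambda>i. G i j))"
    using N by (intro bsum_bsum_eq_sum[symmetric]) (metis add.commute)
  finally show ?thesis .
qed

lemma bsum_bsum_diff:
  assumes "finsupp2 G" "finsupp2 G'"
  shows "bsum b (\<lambda>i. bsum b' (\<lambda>j. G i j - G' i j))
    = bsum b (\<lambda>i. bsum b' (\<lambda>j. G i j)) - bsum b (\<lambda>i. bsum b' (\<lambda>j. G' i j))"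
  by (simp add: bsum_diff finsupp2_row assms finsupp_bsum)

lemma bsum_bsum_add:
  assumes "finsupp2 G" "finsupp2 G'"
  shows "bsum b (\<lambda>i. bsum b' (\<lambda>j. G i j + G' i j))
    = bsum b (\<lambda>i. bsum b' (\<lambda>j. G i j)) + bsum b (\<lambda>i. bsum b' (\<lambda>j. G' i j))"
  by (simp add: bsum_add finsupp2_row assms finsupp_bsum)

text \<open>
  \<open>(1 - S)\<^sup>b (1 - S)\<^bsup>b'\<^esup> = (1 - S)\<^bsup>b+b'\<^esup>\<close>; on coefficients this is Vandermonde convolution.
\<close>

lemma bsum_vandermonde:
  assumes "finsupp H"
  shows "bsum b (\<lambda>i. bsum b' (\<lambda>j. H (i + j))) = bsum (b + b') H"
proof -
  from assms obtain N where N: "\<forall>i\<ge>N. H i = 0" by (auto simp: finsupp_def)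
  let ?c = "\<lambda>i j. ((-1) ^ i * (b gchoose i)) * ((-1) ^ j * (b' gchoose j))"
  let ?F = "\<lambda>i j. scale (?c i j) (H (i + j))"
  have "bsum b (\<lambda>i. bsum b' (\<lambda>j. H (i + j))) = (\<Sum>i<N. \<Sum>j<N. ?F i j)"
    by (rule bsum_bsum_eq_sum) (simp add: N)
  also have "\<dots> = (\<Sum>(i, j)\<in>{..<N} \<times> {..<N}. ?F i j)"
    by (simp add: sum.cartesian_product)
  also have "\<dots> = (\<Sum>(i, j)\<in>{(i, j). i + j < N}. ?F i j)"
  proof (rule sum.mono_neutral_right)
    show "\<forall>p\<in>{..<N} \<times> {..<N} - {(i, j). i
        + j < N}. (case p of (i, j) \<Rightarrow> ?F i j) = 0"
    proof (intro ballI)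
      fix p assume p: "p \<in> {..<N} \<times> {..<N} - {(i, j). i + j < N}"
      obtain i j where "p = (i, j)" by fastforce
      with p N have "H (i + j) = 0" by simp
      with \<open>p = (i, j)\<close> show "(case p of (i, j) \<Rightarrow> ?F i j) = 0" by simp
    qed
  qed auto
  also have "\<dots> = (\<Sum>k<N. \<Sum>i\<le>k. ?F i (k - i))"
    by (rule sum.triangle_reindex)
  also have "\<dots> = (\<Sum>k<N. scale ((-1) ^ k * ((b + b') gchoose k)) (H k))"
  proof (rule sum.cong[OF refl])
    fix k
    have "(\<Sum>i\<le>k. ?F i (k - i))
        = (\<Sum>i\<le>k. scale ((-1) ^ k * ((b gchoose i) * (b' gchoose (k - i)))) (H k))"
    proof (rule sum.cong[OF refl])
      fix i assume "i \<in> {..k}"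
      then have "(-1) ^ k = (-1) ^ i * ((-1) ^ (k - i) :: complex)" "i + (k - i) = k"
        by (simp_all flip: power_add)
      then show "?F i (k - i) = scale ((-1) ^ k * ((b gchoose i) * (b' gchoose (k - i)))) (H k)"
        by (simp add: mult_ac)
    qed
    also have "\<dots> = scale ((-1) ^ k * (\<Sum>i\<le>k. (b gchoose i) * (b' gchoose (k - i)))) (H k)"
      by (simp add: scale_sum_left sum_distrib_left)
    also have "(\<Sum>i\<le>k. (b gchoose i) * (b' gchoose (k - i))) = (b + b') gchoose k"
      using gbinomial_Vandermonde[of b b' k] by (simp add: atLeast0AtMost)
    finally show "(\<Sum>i\<le>k. ?F i (k - i)) = scale ((-1) ^ k * ((b + b') gchoose k)) (H k)" .
  qed
  also have "\<dots> = bsum (b + b') H"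
    using N by (intro bsum_eq_sum[symmetric]) auto
  finally show ?thesis .
qed

text \<open>
  This and the next lemma express the bracket of the vector fields \<open>(x - z)\<^sup>b d/dx\<close> and
  \<open>(x - z)\<^bsup>b'\<^esup> d/dx\<close>, expanded near \<open>x = 0\<close> and near \<open>x = \<infinity>\<close> respectively.
\<close>

lemma bsum_bsum_antisym:
  assumes "finsupp H"
  shows "bsum b (\<lambda>i. bsum b' (\<lambda>j. scale (of_nat j - of_nat i) (H (i + j))))
    = scale (b - b') (bsum (b + b' - 1) (\<lambda>k. H (Suc k)))"
proof -
  have fH: "finsupp (\<lambda>j. H (i + j))" for i
    using assms by (rule finsupp2_row[OF finsupp2_sum])
  have fH2: "finsupp2 (\<lambda>i j. H (i + j))" by (rule finsupp2_sum[OF assms])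
  have fS: "finsupp (\<lambda>k. H (Suc k))" using assms by (rule finsupp_Suc)
  have 1: "bsum b (\<lambda>i. bsum b' (\<lambda>j. scale (of_nat i) (H (i + j))))
      = - scale b (bsum (b + b' - 1) (\<lambda>k. H (Suc k)))"
  proof -
    have "bsum b (\<lambda>i. bsum b' (\<lambda>j. scale (of_nat i) (H (i + j))))
        = bsum b (\<lambda>i. scale (of_nat i) (bsum b' (\<lambda>j. H (i + j))))"
      by (simp add: bsum_scale fH)
    also have "\<dots> = - scale b (bsum (b - 1) (\<lambda>i. bsum b' (\<lambda>j. H (Suc (i + j)))))"
      using bsum_weight[OF finsupp_bsum[OF fH2], of b b'] by simp
    also have "\<dots> = - scale b (bsum (b - 1 + b') (\<lambda>k. H (Suc k)))"
      by (subst bsum_vandermonde[OF fS]) simp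
    finally show ?thesis by (simp add: algebra_simps)
  qed
  have 2: "bsum b (\<lambda>i. bsum b' (\<lambda>j. scale (of_nat j) (H (i + j))))
      = - scale b' (bsum (b + b' - 1) (\<lambda>k. H (Suc k)))"
  proof -
    have "bsum b (\<lambda>i. bsum b' (\<lambda>j. scale (of_nat j) (H (i + j))))
        = bsum b (\<lambda>i. scale (- b') (bsum (b' - 1) (\<lambda>j. H (Suc (i + j)))))"
      using bsum_weight[OF fH, of b'] by simp
    also have "\<dots> = scale (- b') (bsum b (\<lambda>i. bsum (b' - 1) (\<lambda>j. H (Suc (i + j)))))"
      by (intro bsum_scale finsupp_bsum finsupp2_sum[OF fS])
    also have "\<dots> = scale (- b') (bsum (b + (b' - 1)) (\<lambda>k. H (Suc k)))"
      by (subst bsum_vandermonde[OF fS]) simp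
    finally show ?thesis by (simp add: algebra_simps)
  qed
  have "bsum b (\<lambda>i. bsum b' (\<lambda>j. scale (of_nat j - of_nat i) (H (i + j))))
      = bsum b (\<lambda>i. bsum b' (\<lambda>j. scale (of_nat j) (H (i + j))))
        - bsum b (\<lambda>i. bsum b' (\<lambda>j. scale (of_nat i) (H (i + j))))"
    unfolding scale_left_diff_distrib by (intro bsum_bsum_diff finsupp2_scale fH2)
  then show ?thesis by (simp add: 1 2 scale_left_diff_distrib)
qed

lemma bsum_bsum_bracket:
  assumes "finsupp H"
  shows "bsum b (\<lambda>i. bsum b' (\<lambda>j. scale (b - b' - of_nat i + of_nat j) (H (i + j))))
    = scale (b - b') (bsum (b + b' - 1) H)"
proof -
  have fH2: "finsupp2 (\<lambda>i j. H (i + j))" by (rule finsupp2_sum[OF assms])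
  have "bsum b (\<lambda>i. bsum b' (\<lambda>j. scale (b - b' - of_nat i + of_nat j) (H (i + j))))
      = bsum b (\<lambda>i. bsum b' (\<lambda>j. scale (b - b') (H (i + j))
          + scale (of_nat j - of_nat i) (H (i + j))))"
    by (intro bsum_cong) (simp add: algebra_simps)
  also have "\<dots> = bsum b (\<lambda>i. bsum b' (\<lambda>j. scale (b - b') (H (i + j))))
      + bsum b (\<lambda>i. bsum b' (\<lambda>j. scale (of_nat j - of_nat i) (H (i + j))))"
    by (intro bsum_bsum_add finsupp2_scale fH2)
  also have "bsum b (\<lambda>i. bsum b' (\<lambda>j. scale (b - b') (H (i + j))))
      = scale (b - b') (bsum (b + b' - 1 + 1) H)"
    using bsum_vandermonde[OF assms, of b b']
    by (simp add: bsum_scale finsupp2_row[OF fH2] finsupp_bsum[OF fH2])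
  finally show ?thesis
    by (simp only: bsum_bsum_antisym[OF assms] bsum_pascal[OF assms] scale_right_diff_distrib)
       simp
qed

text \<open>
  The central terms in a bracket of two expansions at infinity: the cubic is absorbed into the
  binomial coefficient, which lowers \<open>b\<close> by three.
\<close>

lemma bsum_bsum_cubic:
  assumes "finsupp E"
  shows "bsum b (\<lambda>i. bsum b' (\<lambda>j. scale ((b - of_nat i) * (b - 1 - of_nat i) * (b
      - 2 - of_nat i)) (E (i + j))))
    = scale (b * (b - 1) * (b - 2)) (bsum (b + b' - 3) E)"
proof -
  have fE: "finsupp (\<lambda>j. E (i + j))" for i
    using assms by (rule finsupp2_row[OF finsupp2_sum])
  define Z where "Z i = bsum b' (\<lambda>j. E (i + j))" for i
  have fZ: "finsupp Z" unfolding Z_def[abs_def] by (intro finsupp_bsum finsupp2_sum assms)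
  have "bsum b (\<lambda>i. bsum b' (\<lambda>j. scale ((b - of_nat i) * (b - 1 - of_nat i) * (b
      - 2 - of_nat i)) (E (i + j))))
      = bsum b (\<lambda>i. scale (b - of_nat i) (scale (b - 1 - of_nat i) (scale (b - 2
          - of_nat i) (Z i))))"
    by (simp add: Z_def bsum_scale fE mult.assoc)
  also have "\<dots> = scale b (scale (b - 1) (bsum (b - 1 - 1) (\<lambda>i. scale (b - 2
      - of_nat i) (Z i))))"
    by (simp add: bsum_coweight fZ finsupp_scale del: scale_scale)
  also have "bsum (b - 1 - 1) (\<lambda>i. scale (b - 2 - of_nat i) (Z i))
      = scale (b - 2) (bsum (b - 2 - 1) Z)"
    using bsum_coweight[OF fZ, of "b - 2"] by simp
  also have "bsum (b - 2 - 1) Z = bsum (b - 2 - 1 + b') E"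
    unfolding Z_def[abs_def] by (rule bsum_vandermonde[OF assms])
  also have "b - 2 - 1 + b' = b + b' - 3" by simp
  finally show ?thesis by (simp only: scale_scale mult.assoc)
qed

text \<open>
  The same sum without signs, as in \<open>x\<^sup>a = \<Sum>\<^sub>i (a choose i) z\<^bsup>a-i\<^esup> (x - z)\<^sup>i\<close>.
\<close>

definition csum :: "complex \<Rightarrow> (nat \<Rightarrow> 'b) \<Rightarrow> 'b" where
  "csum a Z = Sum_any (\<lambda>i. scale (a gchoose i) (Z i))"

lemma csum_bsum: "csum a Z = bsum a (\<lambda>i. scale ((-1) ^ i) (Z i))"
  by (simp add: csum_def bsum_def mult.commute mult.left_commute flip: power_mult_distrib)

lemma csum_cong: "(\<And>i. Z i = Z' i) \<Longrightarrow> csum a Z = csum a Z'"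
  by (simp add: csum_def)

lemma csum_eq_sum:
  assumes "\<And>i. i \<ge> N \<Longrightarrow> Z i = 0"
  shows "csum a Z = (\<Sum>i<N. scale (a gchoose i) (Z i))"
  unfolding csum_def by (rule Sum_any_eq_sum) (simp add: assms)

lemma csum_0: "csum 0 Z = Z 0"
  by (simp add: csum_bsum bsum_0)

lemma csum_add: "finsupp Z \<Longrightarrow> finsupp Z' \<Longrightarrow>
    csum a (\<lambda>i. Z i + Z' i) = csum a Z + csum a Z'"
  by (simp add: csum_bsum scale_right_distrib bsum_add finsupp_scale)

lemma csum_diff: "finsupp Z \<Longrightarrow> finsupp Z' \<Longrightarrow>
    csum a (\<lambda>i. Z i - Z' i) = csum a Z - csum a Z'"
  by (simp add: csum_bsum scale_right_diff_distrib bsum_diff finsupp_scale)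

lemma csum_scale: "finsupp Z \<Longrightarrow> csum a (\<lambda>i. scale e (Z i)) = scale e (csum a Z)"
  using bsum_scale[OF finsupp_scale, of Z a e] by (simp add: csum_bsum mult.commute)

lemma csum_pascal:
  assumes "finsupp Z"
  shows "csum (a + 1) Z = csum a Z + csum a (\<lambda>i. Z (Suc i))"
  using bsum_scale[OF finsupp_scale[OF finsupp_Suc[OF assms]], of a "-1" "\<lambda>i. (-1) ^ i"]
  by (simp add: csum_bsum bsum_pascal finsupp_scale assms)

lemma csum_weight:
  assumes "finsupp Z"
  shows "csum a (\<lambda>i. scale (of_nat i) (Z i)) = scale a (csum (a - 1) (\<lambda>i. Z (Suc i)))"
  using bsum_weight[OF finsupp_scale[OF assms], of a "\<lambda>i. (-1) ^ i"]
    bsum_scale[OF finsupp_scale[OF finsupp_Suc[OF assms]], of "a - 1" "-1" "\<lambda>i. (-1) ^ i"]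
  by (simp add: csum_bsum mult.commute)

lemma csum_single: "csum a (\<lambda>i. if i = k then z else 0) = scale (a gchoose k) z"
proof -
  have "csum a (\<lambda>i. if i = k then z else 0)
      = (\<Sum>i<Suc k. scale (a gchoose i) (if i = k then z else 0))"
    by (rule csum_eq_sum) auto
  then show ?thesis by (simp add: if_distrib cong: if_cong)
qed

text \<open>
  For \<open>a \<noteq> 0\<close> the two supports coincide, so if one side is \<open>0\<close> because of an infinite support, so
  is the other.
\<close>

lemma Sum_any_scale:
  fixes Z :: "nat \<Rightarrow> 'b"
  shows "Sum_any (\<lambda>i. scale a (Z i)) = scale a (Sum_any Z)"
proof (cases "a = 0")
  case False
  then have eq: "{i. scale a (Z i) \<noteq> 0} = {i. Z i \<noteq> 0}" by simp
  show ?thesis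
  proof (cases "finite {i. Z i \<noteq> 0}")
    case True
    then show ?thesis
      unfolding Sum_any.expand_set eq scale_sum_right by simp
  next
    case False
    then show ?thesis unfolding Sum_any.expand_set eq by simp
  qed
qed simp

end

lemma bsum_linear:
  assumes "complex_vector_space s1" "complex_vector_space s2" "Vector_Spaces.linear s1 s2 f"
    and "complex_vector_space.finsupp Z"
  shows "f (complex_vector_space.bsum s1 b Z) = complex_vector_space.bsum s2 b (\<lambda>i. f (Z i))"
proof -
  interpret A: complex_vector_space s1 by fact
  interpret B: complex_vector_space s2 by fact
  interpret f: Vector_Spaces.linear s1 s2 f by fact
  from assms(4) obtain N where "\<forall>i\<ge>N. Z i = 0" by (auto simp: A.finsupp_def)
  then show ?thesis
    by (simp add: A.bsum_eq_sum[of N] B.bsum_eq_sum[of N] f.sum f.scale)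
qed

section \<open>Fields and the vector fields acting on them\<close>

lemma gbinomial_nat_less: "i < k \<Longrightarrow> (of_nat i :: complex) gchoose k = 0"
  by (simp flip: binomial_gbinomial add: binomial_eq_0)

lemma cubic_of_int: "(of_int (n ^ 3 - n) :: complex) = (of_int n + 1) * of_int n * (of_int n - 1)"
  by (simp add: power3_eq_cube algebra_simps)

lemma neg_one_powi_cancel:
  "(-1 :: complex) powi n * (-1) powi n = 1" "(-1 :: complex) powi n * ((-1) powi n * y) = y"
proof -
  show "(-1 :: complex) powi n * (-1) powi n = 1" by (simp flip: power_int_mult_distrib)
  then show "(-1 :: complex) powi n * ((-1) powi n * y) = y" by (simp flip: mult.assoc)
qed

lemma cubic_binomial_symmetry:
  "of_nat (a + 1) * of_nat (a + 2) * of_nat (a + 3) * (of_nat ((a + b + 3) choose (a + 3)) :: complex)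
    = of_nat (b + 1) * of_nat (b + 2) * of_nat (b + 3) * of_nat ((a + b + 3) choose (b + 3))"
proof -
  have *: "of_nat (a + 1) * of_nat (a + 2) * of_nat (a + 3) * (of_nat ((a + b + 3) choose (a
      + 3)) :: complex)
      = fact (a + b + 3) / (fact a * fact b)" for a b :: nat
  proof -
    have "(of_nat ((a + b + 3) choose (a + 3)) :: complex) = fact (a + b + 3) / (fact (a + 3) * fact b)"
      by (subst binomial_fact) (simp_all add: algebra_simps)
    moreover have "(fact (a + 3) :: complex) = of_nat (a + 1) * of_nat (a + 2) * of_nat (a + 3) * fact a"
      by (simp add: numeral_3_eq_3 algebra_simps)
    moreover have "(of_nat (a + 1) :: complex) \<noteq> 0" "(of_nat (a + 2) :: complex) \<noteq> 0"
      "(of_nat (a + 3) :: complex) \<noteq> 0"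
      by (simp_all only: of_nat_eq_0_iff)
    ultimately show ?thesis by simp
  qed
  show ?thesis using *[of a b] *[of b a] by (simp only: add.commute mult.commute)
qed

text \<open>
  The cocycle of \<open>x\<^sup>a d/dx\<close> and \<open>(x - z)\<^sup>b d/dx\<close> is the residue of a rational function without
  pole at infinity, so its values at \<open>x = 0\<close> and \<open>x = z\<close> determine each other. After negating the upper
  indices both sides are \<open>(p + q + 3)! / (p! q!)\<close> up to the same sign, with \<open>p = - a - 1\<close> and
  \<open>q = - b - 1\<close>.
\<close>

lemma cubic_gbinomial_neg:
  fixes a b :: int
  assumes "a < 0" "b < 0"
  shows "of_int a * (of_int a - 1) * (of_int a - 2)
      * ((-1) powi b * (-1) ^ nat (2 - a) * (of_int b gchoose nat (2 - a)))
    = of_int b * (of_int b - 1) * (of_int b - 2) * (of_int a gchoose nat (2 - b) :: complex)"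
proof -
  define p q where "p = nat (- a - 1)" and "q = nat (- b - 1)"
  have a: "a = - int (p + 1)" and b: "b = - int (q + 1)" using assms by (auto simp: p_def q_def)
  have g: "(of_int (- int (q + 1)) gchoose (p + 3) :: complex)
      = (-1) ^ (p + 3) * of_nat ((p + q + 3) choose (p + 3))" for p q
  proof -
    have "(of_int (- int (q + 1)) gchoose (p + 3) :: complex)
        = (-1) ^ (p + 3) * ((of_nat (q + 1) + of_nat (p + 3) - 1) gchoose (p + 3))"
      using gbinomial_minus[of "of_nat (q + 1)" "p + 3"] by simp
    also have "(of_nat (q + 1) + of_nat (p + 3) - 1 :: complex) = of_nat (p + q + 3)" by simp
    finally show ?thesis by (simp only: binomial_gbinomial)
  qed
  have n: "nat (2 - a) = p + 3" "nat (2 - b) = q + 3" unfolding a b by simp_all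
  have c: "of_int (- int (p + 1)) * (of_int (- int (p + 1)) - 1) * (of_int (- int (p + 1)) - 2)
      = - (of_nat (p + 1) * of_nat (p + 2) * of_nat (p + 3) :: complex)" for p
    by (simp add: algebra_simps)
  have s: "(-1) powi (- int (q + 1)) = - ((-1 :: complex) ^ q)"
    by (simp add: power_int_def nat_add_distrib flip: power_inverse)
  have "(of_nat ((p + q + 3) choose (q + 3)) :: complex) = of_nat ((q + p + 3) choose (q + 3))"
    by (simp add: add.commute)
  then show ?thesis
    using cubic_binomial_symmetry[of p q] unfolding n unfolding a b g c s
    by (simp add: power_add mult.assoc flip: power_mult_distrib)
qed

locale vir_fields =
  A: virasoro_module sA LA c + B: virasoro_module sB LB c
  for sA :: "complex \<Rightarrow> 'a::ab_group_add \<Rightarrow> 'a" and LA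
    and sB :: "complex \<Rightarrow> 'b::ab_group_add \<Rightarrow> 'b" and LB and c +
  assumes restricted: "\<exists>N. \<forall>n\<ge>N. LA n w = 0"
begin

sublocale B: complex_vector_space sB ..

text \<open>
  \<open>X m\<close> is the coefficient of \<open>z\<^bsup>-m-1\<^esup>\<close>, so a field is a linear map into Laurent series. A common
  factor \<open>z\<^bsup>-\<delta>\<^esup>\<close> is left out here; it enters only through the derivative in \<open>z\<close>.
\<close>

definition field :: "(int \<Rightarrow> 'a \<Rightarrow> 'b) \<Rightarrow> bool" where
  "field X \<longleftrightarrow> (\<forall>m. Vector_Spaces.linear sA sB (X m)) \<and>
      (\<forall>w. \<exists>N. \<forall>m\<ge>N. X m w = 0)"

definition fscale :: "complex \<Rightarrow>
    (int \<Rightarrow> 'a \<Rightarrow> 'b) \<Rightarrow> int \<Rightarrow> 'a \<Rightarrow> 'b" where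
  "fscale a X = (\<lambda>m w. sB a (X m w))"

text \<open>
  Let \<open>f = x\<^sup>a (x - z)\<^sup>b\<close>, and let \<open>x\<^sup>k\<close> stand for \<open>L\<^bsub>k-1\<^esub>\<close>. This is the expansion of \<open>f\<close> for
  \<open>\<bar>x\<bar> > \<bar>z\<bar>\<close>, acting on the target of the field.
\<close>

definition lft :: "int \<Rightarrow> int \<Rightarrow>
    (int \<Rightarrow> 'a \<Rightarrow> 'b) \<Rightarrow> int \<Rightarrow> 'a \<Rightarrow> 'b" where
  "lft a b X = (\<lambda>m w. B.bsum (of_int b) (\<lambda>i. LB (a + b - 1 - int i) (X (m + int i) w)))"

text \<open>
  The expansion of the same \<open>f\<close> for \<open>\<bar>x\<bar> < \<bar>z\<bar>\<close>, acting on the source of the field.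
\<close>

definition rgt :: "int \<Rightarrow> int \<Rightarrow>
    (int \<Rightarrow> 'a \<Rightarrow> 'b) \<Rightarrow> int \<Rightarrow> 'a \<Rightarrow> 'b" where
  "rgt a b X = (\<lambda>m w. sB ((-1) powi b)
      (B.bsum (of_int b) (\<lambda>i. X (m + b - int i) (LA (a + int i - 1) w))))"

text \<open>
  By contour deformation the difference is the residue at \<open>x = z\<close> of \<open>f(x) T(x) X(z)\<close>. For
  \<open>a = 0\<close> and \<open>b = n + 1\<close> it is the right-hand side of the iterate formula for \<open>L\<^sub>n\<close>; for \<open>b = 0\<close> it
  is the commutator with \<open>L\<^bsub>a-1\<^esub>\<close>.
\<close>

definition mode :: "int \<Rightarrow> int \<Rightarrow>
    (int \<Rightarrow> 'a \<Rightarrow> 'b) \<Rightarrow> int \<Rightarrow> 'a \<Rightarrow> 'b" where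
  "mode a b X = (\<lambda>m w. lft a b X m w - rgt a b X m w)"

lemma field_add: "field X \<Longrightarrow> X m (x + y) = X m x + X m y"
  and field_scale: "field X \<Longrightarrow> X m (sA a x) = sB a (X m x)"
  and field_0: "field X \<Longrightarrow> X m 0 = 0"
  and field_diff: "field X \<Longrightarrow> X m (x - y) = X m x - X m y"
proof -
  assume "field X"
  then interpret l: Vector_Spaces.linear sA sB "X m" by (simp add: field_def)
  show "X m (x + y) = X m x + X m y" "X m (sA a x) = sB a (X m x)" "X m 0 = 0"
    "X m (x - y) = X m x - X m y"
    by (simp_all add: l.add l.scale l.zero l.diff)
qed

lemma fieldI:
  assumes "\<And>m x y. X m (x + y) = X m x + X m y" "\<And>m a x. X m (sA a x) = sB a (X m x)"
    "\<And>w. \<exists>N. \<forall>m\<ge>N. X m w = 0"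
  shows "field X"
  unfolding field_def using assms by (auto intro!: Vector_Spaces.linear.intro
      A.vector_space_axioms B.vector_space_axioms module_hom.intro module_hom_axioms.intro
      A.module_axioms B.module_axioms)

lemma field_truncated: "field X \<Longrightarrow> \<exists>N. \<forall>m\<ge>N. X m w = 0"
  by (simp add: field_def)

lemma finsupp_lft:
  assumes "field X" and "\<And>i. f i 0 = 0"
  shows "B.finsupp (\<lambda>i. f i (X (m + int i) w))"
proof -
  obtain N where N: "\<forall>m\<ge>N. X m w = 0" using field_truncated[OF assms(1)] by blast
  show ?thesis by (rule B.finsuppI[of "nat (N - m)"]) (use N assms(2) in auto)
qed

lemma finsupp_rgt:
  assumes "\<And>i. f i 0 = 0"
  shows "B.finsupp (\<lambda>i. f i (LA (k + int i) w))"
proof -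
  obtain N where N: "\<forall>m\<ge>N. LA m w = 0" using restricted by blast
  show ?thesis by (rule B.finsuppI[of "nat (N - k)"]) (use N assms in auto)
qed

lemma finsupp_lft': "field X \<Longrightarrow> B.finsupp (\<lambda>i. LB (k - int i) (X (m + int i) w))"
  by (rule finsupp_lft[where f = "\<lambda>i. LB (k - int i)"]) (simp_all add: B.L_0)

lemma finsupp_rgt': "field X \<Longrightarrow> B.finsupp (\<lambda>i. X (m - int i) (LA (k + int i - 1) w))"
  using finsupp_rgt[where f = "\<lambda>i. X (m - int i)" and k = "k - 1"]
  by (simp add: field_0 algebra_simps)

lemma L_bsum: "B.finsupp Z \<Longrightarrow> LB n (B.bsum b Z) = B.bsum b (\<lambda>i. LB n (Z i))"
  by (rule bsum_linear[OF B.complex_vector_space_axioms B.complex_vector_space_axioms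
        B.linear_L])

lemma field_lft: assumes X: "field X" shows "field (lft a b X)"
proof (rule fieldI)
  show "lft a b X m (x + y) = lft a b X m x + lft a b X m y" for m x y
    unfolding lft_def by (simp add: field_add[OF X] B.L_add B.bsum_add finsupp_lft'[OF X])
  show "lft a b X m (sA e x) = sB e (lft a b X m x)" for m e x
    unfolding lft_def by (simp add: field_scale[OF X] B.L_scale B.bsum_scale finsupp_lft'[OF X])
  fix w
  obtain N where N: "\<forall>m\<ge>N. X m w = 0" using field_truncated[OF X] by blast
  then show "\<exists>N. \<forall>m\<ge>N. lft a b X m w = 0"
    by (intro exI[of _ N]) (simp add: lft_def B.L_0 B.bsum_zero)
qed

text \<open>
  Truncation: almost all \<open>LA k\<close> kill a given vector, and each of the remaining images is killed by
  the modes of \<open>X\<close> of high index.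
\<close>

lemma field_rgt: assumes X: "field X" shows "field (rgt a b X)"
proof (rule fieldI)
  show "rgt a b X m (x + y) = rgt a b X m x + rgt a b X m y" for m x y
    unfolding rgt_def
    by (simp add: field_add[OF X] A.L_add B.bsum_add finsupp_rgt'[OF X] B.scale_right_distrib)
  show "rgt a b X m (sA e x) = sB e (rgt a b X m x)" for m e x
    unfolding rgt_def
    by (simp add: field_scale[OF X] A.L_scale B.bsum_scale finsupp_rgt'[OF X] mult.commute)
  fix w
  obtain N where N: "\<forall>n\<ge>N. LA n w = 0" using restricted by blast
  have "\<forall>i. \<exists>K. \<forall>m\<ge>K. X m (LA (a + int i - 1) w) = 0" using X
      by (auto simp: field_def)
  then obtain K where K: "\<And>i m. m \<ge> K i \<Longrightarrow> X m (LA (a + int i - 1) w) = 0" by metis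
  define R where "R = Max (insert 0 ((\<lambda>i. K i - b + int i) ` {..nat (N - a + 1)}))"
  have "X (m + b - int i) (LA (a + int i - 1) w) = 0" if "m \<ge> R" for m i
  proof (cases "i \<le> nat (N - a + 1)")
    case True
    then have "K i - b + int i \<le> R" unfolding R_def by (intro Max_ge) auto
    then show ?thesis using that by (intro K) auto
  next
    case False
    then have "LA (a + int i - 1) w = 0" using N by auto
    then show ?thesis by (simp add: field_0[OF X])
  qed
  then show "\<exists>N. \<forall>m\<ge>N. rgt a b X m w = 0"
    by (intro exI[of _ R]) (simp add: rgt_def B.bsum_zero)
qed

lemma field_plus: assumes "field X" "field Y" shows "field (\<lambda>m w. X m w + Y m w)"
proof (rule fieldI)
  fix w
  obtain N N' where "\<forall>m\<ge>N. X m w = 0" "\<forall>m\<ge>N'. Y m w = 0"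
    using assms unfolding field_def by meson
  then show "\<exists>N. \<forall>m\<ge>N. X m w + Y m w = 0" by (intro exI[of _ "max N N'"]) auto
qed (simp_all add: field_add field_scale assms algebra_simps)

lemma field_scaled: assumes "field X" shows "field (\<lambda>m w. sB (e m) (X m w))"
proof (rule fieldI)
  fix w
  obtain N where "\<forall>m\<ge>N. X m w = 0" using assms unfolding field_def by meson
  then show "\<exists>N. \<forall>m\<ge>N. sB (e m) (X m w) = 0" by (intro exI[of _ N]) auto
qed (simp_all add: field_add field_scale assms algebra_simps)

lemma field_shift: assumes "field X" shows "field (\<lambda>m. X (m + k))"
proof (rule fieldI)
  fix w
  obtain N where "\<forall>m\<ge>N. X m w = 0" using assms unfolding field_def by meson
  then show "\<exists>N. \<forall>m\<ge>N. X (m + k) w = 0" by (intro exI[of _ "N - k"]) auto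
qed (simp_all add: field_add field_scale assms algebra_simps)

lemma field_minus: assumes "field X" "field Y" shows "field (\<lambda>m w. X m w - Y m w)"
  using field_plus[OF assms(1) field_scaled[OF assms(2), of "\<lambda>_. -1"]] by simp

lemma field_mode: "field X \<Longrightarrow> field (mode a b X)"
  unfolding mode_def by (intro field_minus field_lft field_rgt)

lemma lft_pascal:
  assumes "field X"
  shows "lft a (b + 1) X m w = lft (a + 1) b X m w - lft a b X (m + 1) w"
  using B.bsum_pascal[OF finsupp_lft'[OF assms, of "a + b" m w], of "of_int b"]
  by (simp add: lft_def algebra_simps)

lemma rgt_pascal:
  assumes "field X"
  shows "rgt a (b + 1) X m w = rgt (a + 1) b X m w - rgt a b X (m + 1) w"
  using B.bsum_pascal[OF finsupp_rgt'[OF assms, of "m + b + 1" a w], of "of_int b"]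
  unfolding rgt_def
  by (simp add: power_int_add B.scale_right_diff_distrib add.commute add.left_commute
      diff_add_eq add_diff_eq)

text \<open>
  \<open>x\<^sup>a (x - z)\<^bsup>b+1\<^esup> = x\<^bsup>a+1\<^esup> (x - z)\<^sup>b - z x\<^sup>a (x - z)\<^sup>b\<close>; a factor \<open>z\<close> shifts the index by one.
\<close>

lemma mode_pascal:
  "field X \<Longrightarrow> mode a (b + 1) X m w = mode (a + 1) b X m w - mode a b X (m + 1) w"
  by (simp add: mode_def lft_pascal rgt_pascal)

lemma lft_rgt_commute:
  assumes X: "field X"
  shows "lft a b (rgt a' b' X) m w = rgt a' b' (lft a b X) m w"
proof -
  let ?G = "\<lambda>i j. LB (a + b - 1 - int i) (X (m + b' + int i - int j) (LA (a' + int j - 1) w))"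
  obtain N where N: "\<forall>n\<ge>N. LA n w = 0" using restricted by blast
  have G: "B.finsupp2 ?G"
  proof (rule B.finsupp2I)
    show "?G i j = 0" if "j \<ge> nat (N - a' + 1)" for i j
      using that N by (auto simp: field_0[OF X] B.L_0)
    show "B.finsupp (\<lambda>i. ?G i j)" for j
      using finsupp_lft'[OF X, of "a + b - 1" "m + b' - int j"] by (simp add: algebra_simps)
  qed
  have "lft a b (rgt a' b' X) m w
      = B.bsum (of_int b) (\<lambda>i. sB ((-1) powi b') (B.bsum (of_int b') (?G i)))"
    using finsupp_rgt'[OF X]
    by (simp add: lft_def rgt_def B.L_scale L_bsum algebra_simps)
  also have "\<dots> = sB ((-1) powi b') (B.bsum (of_int b) (\<lambda>i. B.bsum (of_int b') (?G i)))"
    by (intro B.bsum_scale B.finsupp_bsum G)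
  also have "B.bsum (of_int b) (\<lambda>i. B.bsum (of_int b') (?G i))
      = B.bsum (of_int b') (\<lambda>j. B.bsum (of_int b) (\<lambda>i. ?G i j))"
    by (rule B.bsum_swap[OF G])
  finally show ?thesis by (simp add: lft_def rgt_def algebra_simps)
qed

text \<open>
  All central terms meet at total degree \<open>b + b' - 2\<close>. Their sum has coefficient
  \<open>(b + b' - 3 choose b + b' - 2)\<close>, which is nonzero only for \<open>b + b' = 2\<close>.
\<close>

lemma lft_lft_bracket:
  assumes X: "field X"
  shows "lft 0 b (lft 0 b' X) m w - lft 0 b' (lft 0 b X) m w
    = sB (of_int (b - b')) (lft 0 (b + b' - 1) X m w)
      + (if b - 1 = - (b' - 1) then sB (of_int ((b - 1) ^ 3 - (b - 1)) / 12 * c) (X m w) else 0)"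
proof -
  let ?b = "of_int b :: complex" and ?b' = "of_int b' :: complex"
  define H where "H k = LB (b + b' - 2 - int k) (X (m + int k) w)" for k
  define E where "E k = (if int k = b + b' - 2 then sB (c / 12) (X (m + int k) w) else 0)" for k
  let ?G = "\<lambda>i j. LB (b - 1 - int i) (LB (b' - 1 - int j) (X (m + int (i + j)) w))"
  let ?G' = "\<lambda>i j. LB (b' - 1 - int j) (LB (b - 1 - int i) (X (m + int (i + j)) w))"
  let ?U = "\<lambda>i j. sB (?b - ?b' - of_nat i + of_nat j) (H (i + j))"
  let ?W = "\<lambda>i j. sB ((?b - of_nat i) * (?b - 1 - of_nat i) * (?b - 2 - of_nat i)) (E (i + j))"
  have fX: "B.finsupp (\<lambda>k. X (m + int k) w)"
    using finsupp_lft[OF X, of "\<lambda>_ x. x"] by simp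
  have "B.finsupp2 (\<lambda>i j. X (m + int (i + j)) w)"
    using B.finsupp2_sum[OF fX] by simp
  then obtain N where N: "\<And>i j. i + j \<ge> N \<Longrightarrow> X (m + int (i + j)) w = 0"
    unfolding B.finsupp2_def by blast
  have fG: "B.finsupp2 ?G"
    unfolding B.finsupp2_def by (intro exI[of _ N] allI impI) (simp only: N B.L_0)
  have fG': "B.finsupp2 ?G'"
    unfolding B.finsupp2_def by (intro exI[of _ N] allI impI) (simp only: N B.L_0)
  have fH: "B.finsupp H" unfolding H_def[abs_def] by (rule finsupp_lft'[OF X])
  have fE: "B.finsupp E"
    by (rule B.finsuppI[of "nat (b + b' - 1)"]) (auto simp: E_def)
  have expand: "lft 0 b (lft 0 b' X) m w = B.bsum (of_int b) (\<lambda>i. B.bsum (of_int b')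
      (\<lambda>j. LB (b - 1 - int i) (LB (b' - 1 - int j) (X (m + int i + int j) w))))" for b b'
    by (simp only: lft_def add_0_left L_bsum[OF finsupp_lft'[OF X]])
  have "lft 0 b (lft 0 b' X) m w = B.bsum ?b (\<lambda>i. B.bsum ?b' (\<lambda>j. ?G i j))"
    unfolding expand by (intro B.bsum_cong) (simp add: add.assoc)
  moreover have "lft 0 b' (lft 0 b X) m w = B.bsum ?b' (\<lambda>j. B.bsum ?b (\<lambda>i. ?G' i j))"
    unfolding expand by (intro B.bsum_cong) (simp add: add_ac)
  ultimately have "lft 0 b (lft 0 b' X) m w - lft 0 b' (lft 0 b X) m w
      = B.bsum ?b (\<lambda>i. B.bsum ?b' (\<lambda>j. ?G i j - ?G' i j))"
    by (simp only: B.bsum_bsum_diff[OF fG fG'] B.bsum_swap[OF fG'])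
  also have "\<dots> = B.bsum ?b (\<lambda>i. B.bsum ?b' (\<lambda>j. ?U i j + ?W i j))"
  proof (intro B.bsum_cong)
    fix i j
    have "of_int ((b - 1 - int i) ^ 3 - (b - 1 - int i)) / 12 * c
        = (?b - of_nat i) * (?b - 1 - of_nat i) * (?b - 2 - of_nat i) * (c / 12)"
      unfolding cubic_of_int by simp
    then have W: "(if b - 1 - int i = - (b' - 1 - int j)
          then sB (of_int ((b - 1 - int i) ^ 3 - (b - 1 - int i)) / 12 * c) (X (m + int (i + j)) w)
          else 0) = ?W i j"
      by (auto simp: E_def)
    have "of_int (b - 1 - int i - (b' - 1 - int j)) = ?b - ?b' - of_nat i + of_nat j"
      "b - 1 - int i + (b' - 1 - int j) = b + b' - 2 - int (i + j)" by simp_all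
    then show "?G i j - ?G' i j = ?U i j + ?W i j"
      unfolding B.L_bracket W by (simp only: H_def)
  qed
  also have "\<dots> = B.bsum ?b (\<lambda>i. B.bsum ?b' (?U i))
      + B.bsum ?b (\<lambda>i. B.bsum ?b' (?W i))"
    by (intro B.bsum_bsum_add B.finsupp2_scale B.finsupp2_sum fH fE)
  also have "B.bsum ?b (\<lambda>i. B.bsum ?b' (?U i)) = sB (of_int (b - b')) (lft 0 (b + b' - 1) X m w)"
    unfolding B.bsum_bsum_bracket[OF fH] by (simp add: lft_def H_def[abs_def])
  also have "B.bsum ?b (\<lambda>i. B.bsum ?b' (?W i))
      = (if b - 1 = - (b' - 1) then sB (of_int ((b - 1) ^ 3 - (b - 1)) / 12 * c) (X m w) else 0)"
  proof -
    have cub: "of_int ((b - 1) ^ 3 - (b - 1)) = ?b * (?b - 1) * (?b - 2)"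
      unfolding cubic_of_int by simp
    have *: "B.bsum (?b + ?b' - 3) E = (if b + b' = 2 then sB (c / 12) (X m w) else 0)"
    proof (cases "b + b' \<ge> 2")
      case True
      define k where "k = nat (b + b' - 2)"
      have k: "b + b' = int k + 2" using True by (simp add: k_def)
      then have kc: "?b + ?b' - 3 = of_nat k - 1"
      proof -
        have "?b + ?b' = of_int (b + b')" by simp
        then show ?thesis unfolding k by simp
      qed
      have "E = (\<lambda>i. if i = k then sB (c / 12) (X (m + int k) w) else 0)"
        by (auto simp: E_def k fun_eq_iff)
      then have "B.bsum (?b + ?b' - 3) E
          = sB ((-1) ^ k * ((of_nat k - 1) gchoose k)) (sB (c / 12) (X (m + int k) w))"
        by (simp only: B.bsum_single kc)
      moreover have "(of_nat k - 1 :: complex) gchoose k = (if k = 0 then 1 else 0)"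
        using gbinomial_nat_less[of "k - 1" k] by (cases k) auto
      ultimately show ?thesis using k by auto
    next
      case False
      then have "E = (\<lambda>_. 0)" by (auto simp: E_def fun_eq_iff)
      then show ?thesis using False by (simp add: B.bsum_zero)
    qed
    have "b - 1 = - (b' - 1) \<longleftrightarrow> b + b' = 2" by auto
    then show ?thesis
      by (simp only: B.bsum_bsum_cubic[OF fE] * cub) simp
  qed
  finally show ?thesis .
qed

text \<open>
  Central terms could only come from modes \<open>L\<^sub>n\<close> with \<open>n \<in> {-1, 0, 1}\<close>, where the cocycle
  vanishes. The sign is that of a right action.
\<close>

lemma rgt_rgt_bracket:
  assumes X: "field X"
  shows "rgt 0 b (rgt 0 b' X) m w - rgt 0 b' (rgt 0 b X) m w
    = - sB (of_int (b - b')) (rgt 0 (b + b' - 1) X m w)"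
proof -
  let ?b = "of_int b :: complex" and ?b' = "of_int b' :: complex"
  let ?s = "(-1) powi b * (-1) powi b' :: complex"
  define H where "H k = X (m + b + b' - int k) (LA (int k - 2) w)" for k
  let ?G = "\<lambda>i j. X (m + b + b' - int (i + j)) (LA (int j - 1) (LA (int i - 1) w))"
  let ?G' = "\<lambda>i j. X (m + b + b' - int (i + j)) (LA (int i - 1) (LA (int j - 1) w))"
  obtain N where N: "\<forall>n\<ge>N. LA n w = 0" using restricted by blast
  have "B.finsupp2 (\<lambda>i j. ?G j i)"
  proof (rule B.finsupp2I)
    show "?G j i = 0" if "j \<ge> nat (N + 1)" for i j
      using that N by (auto simp: field_0[OF X] A.L_0)
    show "B.finsupp (\<lambda>i. ?G j i)" for j
      using finsupp_rgt'[OF X, of "m + b + b' - int j" 0] by (simp add: algebra_simps)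
  qed
  then have fG: "B.finsupp2 ?G" by (rule B.finsupp2_swap)
  have fG': "B.finsupp2 ?G'"
    using B.finsupp2_swap[OF fG] by (simp add: add.commute)
  have fH: "B.finsupp H"
    using finsupp_rgt'[OF X, of "m + b + b'" "-1"] by (simp add: H_def[abs_def] algebra_simps)
  have expand: "rgt 0 b (rgt 0 b' X) m w
      = sB ((-1) powi b * (-1) powi b') (B.bsum (of_int b) (\<lambda>i. B.bsum (of_int b')
          (\<lambda>j. X (m + b + b' - int (i + j)) (LA (int j - 1) (LA (int i - 1) w)))))"
    if "B.finsupp2 (\<lambda>i j. X (m + b + b' - int (i
        + j)) (LA (int j - 1) (LA (int i - 1) w)))" for b b'
    using B.bsum_scale[OF B.finsupp_bsum[OF that], of "of_int b" "(-1) powi b'" "of_int b'"]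
    by (simp add: rgt_def algebra_simps)
  have fG'': "B.finsupp2 (\<lambda>i j. X (m + b' + b - int (i + j)) (LA (int j - 1) (LA (int i - 1) w)))"
    using fG by (simp add: algebra_simps)
  have 1: "rgt 0 b (rgt 0 b' X) m w = sB ?s (B.bsum ?b (\<lambda>i. B.bsum ?b' (\<lambda>j. ?G i j)))"
    by (rule expand[OF fG])
  have "rgt 0 b' (rgt 0 b X) m w = sB ?s (B.bsum ?b' (\<lambda>j. B.bsum ?b (\<lambda>i. ?G' i j)))"
    using expand[OF fG''] by (simp add: algebra_simps)
  then have 2: "rgt 0 b' (rgt 0 b X) m w = sB ?s (B.bsum ?b (\<lambda>i. B.bsum ?b' (\<lambda>j. ?G' i j)))"
    unfolding B.bsum_swap[OF fG'] .
  have "rgt 0 b (rgt 0 b' X) m w - rgt 0 b' (rgt 0 b X) m w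
      = sB ?s (B.bsum ?b (\<lambda>i. B.bsum ?b' (\<lambda>j. ?G i j - ?G' i j)))"
    unfolding 1 2 B.bsum_bsum_diff[OF fG fG'] by (simp add: B.scale_right_diff_distrib)
  also have "B.bsum ?b (\<lambda>i. B.bsum ?b' (\<lambda>j. ?G i j - ?G' i j))
      = B.bsum ?b (\<lambda>i. B.bsum ?b' (\<lambda>j. sB (of_nat j - of_nat i) (H (i + j))))"
  proof (intro B.bsum_cong)
    fix i j
    have "(int j - 1) ^ 3 - (int j - 1) = 0" if "int j - 1 = - (int i - 1)"
    proof -
      have "j \<le> 2" using that by linarith
      then have "j \<in> {0, 1, 2}" by auto
      then show ?thesis by auto
    qed
    then have "LA (int j - 1) (LA (int i - 1) w) - LA (int i - 1) (LA (int j - 1) w)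
        = sA (of_nat j - of_nat i) (LA (int (i + j) - 2) w)"
      unfolding A.L_bracket by (auto simp: algebra_simps)
    then show "?G i j - ?G' i j = sB (of_nat j - of_nat i) (H (i + j))"
      by (simp add: H_def field_scale[OF X] flip: field_diff[OF X])
  qed
  also have "\<dots> = sB (?b - ?b') (B.bsum (?b + ?b' - 1) (\<lambda>k. H (Suc k)))"
    by (rule B.bsum_bsum_antisym[OF fH])
  also have "B.bsum (?b + ?b' - 1) (\<lambda>k. H (Suc k)) = sB (- ?s) (rgt 0 (b + b' - 1) X m w)"
  proof -
    have "?s * (-1) powi (b + b' - 1) = -1"
      by (simp add: power_int_add power_int_diff ac_simps neg_one_powi_cancel)
    then show ?thesis
      by (simp add: H_def rgt_def algebra_simps)
  qed
  finally show ?thesis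
    by (simp add: ac_simps neg_one_powi_cancel)
qed

lemma lft_diff: "field X \<Longrightarrow> field Y \<Longrightarrow>
    lft a b (\<lambda>m w. X m w - Y m w) m w = lft a b X m w - lft a b Y m w"
  by (simp add: lft_def B.L_diff B.bsum_diff finsupp_lft')

lemma rgt_diff: "field X \<Longrightarrow> field Y \<Longrightarrow>
    rgt a b (\<lambda>m w. X m w - Y m w) m w = rgt a b X m w - rgt a b Y m w"
  by (simp add: rgt_def B.bsum_diff finsupp_rgt' B.scale_right_diff_distrib)

lemma mode_diff: "field X \<Longrightarrow> field Y \<Longrightarrow>
    mode a b (\<lambda>m w. X m w - Y m w) m w = mode a b X m w - mode a b Y m w"
  by (simp add: mode_def lft_diff rgt_diff)

lemma mode_scale: "field X \<Longrightarrow> mode a b (\<lambda>m w. sB e (X m w)) m w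
    = sB e (mode a b X m w)"
  by (simp add: mode_def lft_def rgt_def B.L_scale B.bsum_scale finsupp_rgt' finsupp_lft'
      B.scale_right_diff_distrib mult.commute)

lemma mode_zero: "mode a b (\<lambda>m w. 0) m w = 0"
  by (simp add: mode_def lft_def rgt_def B.L_0 B.bsum_zero)

lemma mode_add: "field X \<Longrightarrow> field Y \<Longrightarrow>
    mode a b (\<lambda>m w. X m w + Y m w) m w = mode a b X m w + mode a b Y m w"
  using mode_diff[of X "\<lambda>m w. sB (-1) (Y m w)" a b m w] mode_scale[of Y a b "-1" m w]
    field_scaled[of Y "\<lambda>_. -1"]
  by simp

lemma mode_shift: "mode a b (\<lambda>m. X (m + k)) m w = mode a b X (m + k) w"
  by (simp add: mode_def lft_def rgt_def algebra_simps)

lemma mode_0: "mode a 0 X m w = LB (a - 1) (X m w) - X m (LA (a - 1) w)"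
  by (simp add: mode_def lft_def rgt_def B.bsum_0)

lemma mode_sum:
  assumes "\<And>i. field (Y i)"
  shows "field (\<lambda>m w. \<Sum>i<(N::nat). sB (e i) (Y i m w))"
    and "mode a b (\<lambda>m w. \<Sum>i<N. sB (e i) (Y i m w)) m w
        = (\<Sum>i<N. sB (e i) (mode a b (Y i) m w))"
proof (induction N)
  case 0
  {
    case 1
    show ?case by (rule fieldI) auto
  next
    case 2
    show ?case by (simp add: mode_zero)
  }
next
  case (Suc N)
  {
    case 1
    show ?case using field_plus[OF Suc(1) field_scaled[OF assms[of N], of "\<lambda>_. e N"]] by simp
  next
    case 2
    show ?case
      using mode_add[OF Suc(1) field_scaled[OF assms[of N], of "\<lambda>_. e N"]]
      by (simp add: Suc(2) mode_scale[OF assms])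
  }
qed

text \<open>
  The left and right expansions commute, so the brackets of the two sides combine.
\<close>

lemma mode_virasoro:
  assumes X: "field X"
  shows "mode 0 b (mode 0 b' X) m w - mode 0 b' (mode 0 b X) m w
    = sB (of_int (b - b')) (mode 0 (b + b' - 1) X m w)
      + (if b - 1 = - (b' - 1) then sB (of_int ((b - 1) ^ 3 - (b - 1)) / 12 * c) (X m w) else 0)"
proof -
  have "mode 0 b (mode 0 b' X) m w = (lft 0 b (lft 0 b' X) m w - lft 0 b (rgt 0 b' X) m w)
      - (rgt 0 b (lft 0 b' X) m w - rgt 0 b (rgt 0 b' X) m w)" for b b'
    by (simp only: mode_def lft_diff rgt_diff field_lft field_rgt X)
  then have "mode 0 b (mode 0 b' X) m w - mode 0 b' (mode 0 b X) m w
      = (lft 0 b (lft 0 b' X) m w - lft 0 b' (lft 0 b X) m w)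
        + (rgt 0 b (rgt 0 b' X) m w - rgt 0 b' (rgt 0 b X) m w)"
    by (simp add: lft_rgt_commute[OF X])
  then show ?thesis
    unfolding lft_lft_bracket[OF X] rgt_rgt_bracket[OF X]
    by (simp add: mode_def B.scale_right_diff_distrib)
qed

text \<open>
  \<open>[x\<^sup>a, (x - z)\<^sup>b] = a x\<^bsup>a-1\<^esup> (x - z)\<^sup>b - b x\<^sup>a (x - z)\<^bsup>b-1\<^esup>\<close> for vector fields, plus the one
  index where a central term appears.
\<close>

lemma ad_lft:
  assumes X: "field X" and a: "a < 0"
  shows "LB (a - 1) (lft 0 b X m w) - lft 0 b (\<lambda>m w. LB (a - 1) (X m w)) m w
    = sB (of_int a) (lft (a - 1) b X m w) - sB (of_int b) (lft a (b - 1) X m w)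
      + sB (c / 12 * (of_int a * (of_int a - 1) * (of_int a - 2)))
          (if a + b \<ge> 2 then sB ((-1) ^ nat (a + b - 2) * (of_int b gchoose nat (a + b - 2)))
             (X (m + (a + b - 2)) w) else 0)"
proof -
  let ?b = "of_int b :: complex" and ?a = "of_int a :: complex"
  define Z where "Z i = LB (a + b - 2 - int i) (X (m + int i) w)" for i
  define K where "K = c / 12 * (?a * (?a - 1) * (?a - 2))"
  define E where "E i = (if int i = a + b - 2 then sB K (X (m + int i) w) else 0)" for i
  have fZ: "B.finsupp Z" unfolding Z_def[abs_def] by (rule finsupp_lft'[OF X])
  have fE: "B.finsupp E"
    by (rule B.finsuppI[of "nat (a + b - 1)"]) (auto simp: E_def)
  have f1: "B.finsupp (\<lambda>i. LB (a - 1) (LB (b - 1 - int i) (X (m + int i) w)))"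
    using finsupp_lft[OF X, of "\<lambda>i x. LB (a - 1) (LB (b - 1 - int i) x)"] by (simp add: B.L_0)
  have f2: "B.finsupp (\<lambda>i. LB (b - 1 - int i) (LB (a - 1) (X (m + int i) w)))"
    using finsupp_lft[OF X, of "\<lambda>i x. LB (b - 1 - int i) (LB (a - 1) x)"] by (simp add: B.L_0)
  have "LB (a - 1) (lft 0 b X m w) - lft 0 b (\<lambda>m w. LB (a - 1) (X m w)) m w
      = B.bsum ?b (\<lambda>i. LB (a - 1) (LB (b - 1 - int i) (X (m + int i) w))
          - LB (b - 1 - int i) (LB (a - 1) (X (m + int i) w)))"
    unfolding B.bsum_diff[OF f1 f2]
    using L_bsum[OF finsupp_lft'[OF X], of "a - 1" ?b "b - 1" m w] by (simp add: lft_def)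
  also have "\<dots> = B.bsum ?b (\<lambda>i. (sB ?a (Z i) - sB (?b - of_nat i) (Z i)) + E i)"
  proof (intro B.bsum_cong)
    fix i
    have "of_int ((a - 1) ^ 3 - (a - 1)) / 12 * c = K"
      unfolding cubic_of_int by (simp add: K_def)
    then have W: "(if a - 1 = - (b - 1 - int i)
          then sB (of_int ((a - 1) ^ 3 - (a - 1)) / 12 * c) (X (m + int i) w) else 0) = E i"
      by (auto simp: E_def)
    have "of_int (a - 1 - (b - 1 - int i)) = ?a - (?b - of_nat i)"
      "a - 1 + (b - 1 - int i) = a + b - 2 - int i" by simp_all
    then show "LB (a - 1) (LB (b - 1 - int i) (X (m + int i) w))
        - LB (b - 1 - int i) (LB (a - 1) (X (m + int i) w))
        = (sB ?a (Z i) - sB (?b - of_nat i) (Z i)) + E i"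
      unfolding B.L_bracket W by (simp only: Z_def B.scale_left_diff_distrib)
  qed
  also have "\<dots> = sB ?a (B.bsum ?b Z) - sB ?b (B.bsum (?b - 1) Z) + B.bsum ?b E"
    by (simp only: B.bsum_add B.bsum_diff B.finsupp_diff B.finsupp_scale fZ fE B.bsum_scale
        B.bsum_coweight)
  also have "B.bsum ?b Z = lft (a - 1) b X m w"
    by (simp add: lft_def Z_def[abs_def])
  also have "B.bsum (?b - 1) Z = lft a (b - 1) X m w"
    by (simp add: lft_def Z_def[abs_def])
  also have "B.bsum ?b E = sB K
          (if a + b \<ge> 2 then sB ((-1) ^ nat (a + b - 2) * (?b gchoose nat (a + b - 2)))
             (X (m + (a + b - 2)) w) else 0)"
  proof (cases "a + b \<ge> 2")
    case True
    then have "E = (\<lambda>i. if i = nat (a + b - 2) then sB K (X (m + (a + b - 2)) w) else 0)"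
      by (auto simp: E_def fun_eq_iff)
    then have "B.bsum ?b E = sB ((-1) ^ nat (a + b - 2) * (?b gchoose nat (a + b - 2)))
        (sB K (X (m + (a + b - 2)) w))"
      by (simp only: B.bsum_single)
    then show ?thesis using True by (simp add: mult.commute)
  next
    case False
    then have "E = (\<lambda>_. 0)" by (auto simp: E_def fun_eq_iff)
    then show ?thesis using False by (simp add: B.bsum_zero)
  qed
  finally show ?thesis unfolding K_def .
qed

lemma ad_rgt:
  assumes X: "field X" and a: "a < 0"
  shows "rgt 0 b X m (LA (a - 1) w) - rgt 0 b (\<lambda>m w. X m (LA (a - 1) w)) m w
    = - sB (of_int a) (rgt (a - 1) b X m w) + sB (of_int b) (rgt a (b - 1) X m w)
      - sB (c / 12 * (of_int a * (of_int a - 1) * (of_int a - 2)))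
          (sB ((-1) powi b * ((-1) ^ nat (2 - a) * (of_int b gchoose nat (2 - a))))
             (X (m + (a + b - 2)) w))"
proof -
  let ?b = "of_int b :: complex" and ?a = "of_int a :: complex" and ?s = "(-1) powi b :: complex"
  define Z where "Z i = X (m + b - int i) (LA (a + int i - 2) w)" for i
  define K where "K = c / 12 * (?a * (?a - 1) * (?a - 2))"
  define E where "E i = (if i = nat (2 - a) then sB K (X (m + (a + b - 2)) w) else 0)" for i
  have fZ: "B.finsupp Z"
    using finsupp_rgt'[OF X, of "m + b" "a - 1"] by (simp add: Z_def[abs_def])
  have fE: "B.finsupp E"
    by (rule B.finsuppI[of "Suc (nat (2 - a))"]) (auto simp: E_def)
  have f1: "B.finsupp (\<lambda>i. X (m + b - int i) (LA (int i - 1) (LA (a - 1) w)))"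
    using finsupp_rgt'[OF X, of "m + b" 0 "LA (a - 1) w"] by simp
  have f2: "B.finsupp (\<lambda>i. X (m + b - int i) (LA (a - 1) (LA (int i - 1) w)))"
    using finsupp_rgt[where f = "\<lambda>i x. X (m + b - int i) (LA (a - 1) x)" and k = "-1"]
    by (simp add: field_0[OF X] A.L_0)
  have "rgt 0 b X m (LA (a - 1) w) - rgt 0 b (\<lambda>m w. X m (LA (a - 1) w)) m w
      = sB ?s (B.bsum ?b (\<lambda>i. X (m + b - int i) (LA (int i - 1) (LA (a - 1) w))
          - X (m + b - int i) (LA (a - 1) (LA (int i - 1) w))))"
    unfolding B.bsum_diff[OF f1 f2] by (simp add: rgt_def B.scale_right_diff_distrib)
  also have "B.bsum ?b (\<lambda>i. X (m + b - int i) (LA (int i - 1) (LA (a - 1) w))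
          - X (m + b - int i) (LA (a - 1) (LA (int i - 1) w)))
      = B.bsum ?b (\<lambda>i. (sB (of_nat i) (Z i) - sB ?a (Z i)) - E i)"
  proof (intro B.bsum_cong)
    fix i
    have "LA (int i - 1) (LA (a - 1) w) - LA (a - 1) (LA (int i - 1) w)
        = sA (of_nat i - ?a) (LA (a + int i - 2) w) - (if i = nat (2 - a) then sA K w else 0)"
    proof (cases "i = nat (2 - a)")
      case True
      then have i: "int i = 2 - a" using a by simp
      have "of_int ((int i - 1) ^ 3 - (int i - 1)) / 12 * c = - K"
        unfolding cubic_of_int i by (simp add: K_def field_simps)
      moreover have "int i - 1 = - (a - 1)" using i by simp
      moreover have "int i - 1 + (a - 1) = a + int i - 2" "of_int (int i - 1 - (a - 1)) = of_nat i - ?a"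
        by simp_all
      ultimately show ?thesis
        using A.L_bracket[of "int i - 1" "a - 1" w] True by (simp only: if_True) simp
    next
      case False
      then have "int i - 1 \<noteq> - (a - 1)" using a by auto
      moreover have "int i - 1 + (a - 1) = a + int i - 2" "of_int (int i - 1 - (a - 1)) = of_nat i - ?a"
        by simp_all
      ultimately show ?thesis
        using A.L_bracket[of "int i - 1" "a - 1" w] False by (simp only: if_False) simp
    qed
    moreover have "X (m + b - int i) (if i = nat (2 - a) then sA K w else 0) = E i"
    proof (cases "i = nat (2 - a)")
      case True
      then have "m + b - int i = m + (a + b - 2)" using a by simp
      with True show ?thesis by (simp only: E_def simp_thms if_True field_scale[OF X])
    qed (simp add: E_def field_0[OF X])
    ultimately show "X (m + b - int i) (LA (int i - 1) (LA (a - 1) w))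
        - X (m + b - int i) (LA (a - 1) (LA (int i - 1) w))
        = (sB (of_nat i) (Z i) - sB ?a (Z i)) - E i"
      unfolding field_diff[OF X, symmetric]
      by (simp only: field_diff[OF X] field_scale[OF X] Z_def B.scale_left_diff_distrib)
  qed
  also have "\<dots> = - sB ?b (B.bsum (?b - 1) (\<lambda>i. Z (Suc i))) - sB ?a (B.bsum ?b Z)
      - B.bsum ?b E"
    by (simp only: B.bsum_diff B.finsupp_diff B.finsupp_scale fZ fE B.bsum_scale B.bsum_weight)
  also have "sB ?s \<dots> = - sB ?a (rgt (a - 1) b X m w)
      + sB ?b (rgt a (b - 1) X m w) - sB ?s (B.bsum ?b E)"
  proof -
    have "(-1) powi (b - 1) = - ?s" by (simp add: power_int_diff)
    then have "sB ?s (B.bsum (?b - 1) (\<lambda>i. Z (Suc i))) = - rgt a (b - 1) X m w"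
      by (simp add: rgt_def Z_def[abs_def] algebra_simps)
    moreover have "sB ?s (B.bsum ?b Z) = rgt (a - 1) b X m w"
      by (simp add: rgt_def Z_def[abs_def] algebra_simps)
    ultimately show ?thesis
      by (simp add: B.scale_right_diff_distrib B.scale_left_commute[of ?s] del: B.scale_scale)
  qed
  also have "sB ?s (B.bsum ?b E) = sB K (sB (?s * ((-1) ^ nat (2 - a) * (?b gchoose nat (2 - a))))
             (X (m + (a + b - 2)) w))"
    unfolding E_def[abs_def] B.bsum_single by (simp add: ac_simps)
  finally show ?thesis unfolding K_def .
qed

text \<open>
  For \<open>a < 0 \<le> b\<close> the central terms at \<open>0\<close> and at infinity cancel; for \<open>a, b < 0\<close> only the one at
  \<open>0\<close> survives and is rewritten as a residue at \<open>z\<close>.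
\<close>

lemma mode_ad:
  assumes X: "field X" and a: "a < 0"
  shows "mode a 0 (mode 0 b X) m w - mode 0 b (mode a 0 X) m w
    = sB (of_int a) (mode (a - 1) b X m w) - sB (of_int b) (mode a (b - 1) X m w)
      - (if b < 0 then sB (c / 12 * (of_int b * (of_int b - 1) * (of_int b
          - 2) * (of_int a gchoose nat (2 - b))))
          (X (m + (a + b - 2)) w) else 0)"
proof -
  let ?b = "of_int b :: complex" and ?a = "of_int a :: complex"
  define x where "x = X (m + (a + b - 2)) w"
  let ?p = "?a * (?a - 1) * (?a - 2)"
  let ?r = "(-1) powi b * ((-1) ^ nat (2 - a) * (?b gchoose nat (2 - a)))"
  have fL: "field (\<lambda>m w. LB (a - 1) (X m w))"
  proof (rule fieldI)
    fix w obtain N where "\<forall>m\<ge>N. X m w = 0" using field_truncated[OF X] by blast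
    then show "\<exists>N. \<forall>m\<ge>N. LB (a - 1) (X m w) = 0"
        by (intro exI[of _ N]) (simp add: B.L_0)
  qed (simp_all add: field_add[OF X] field_scale[OF X] B.L_add B.L_scale)
  have fR: "field (\<lambda>m w. X m (LA (a - 1) w))"
  proof (rule fieldI)
    fix w show "\<exists>N. \<forall>m\<ge>N. X m (LA (a - 1) w) = 0" by (rule field_truncated[OF X])
  qed (simp_all add: field_add[OF X] field_scale[OF X] A.L_add A.L_scale)
  have M0: "mode a 0 X = (\<lambda>m w. LB (a - 1) (X m w) - X m (LA (a - 1) w))"
    by (intro ext) (rule mode_0)
  have lR: "lft 0 b (\<lambda>m w. X m (LA (a - 1) w)) m w = lft 0 b X m (LA (a - 1) w)"
    by (simp add: lft_def)
  have rL: "rgt 0 b (\<lambda>m w. LB (a - 1) (X m w)) m w = LB (a - 1) (rgt 0 b X m w)"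
    using L_bsum[OF finsupp_rgt'[OF X, of "m + b" 0 w], of "a - 1" ?b]
    by (simp add: rgt_def B.L_scale)
  have "mode a 0 (mode 0 b X) m w - mode 0 b (mode a 0 X) m w
      = (LB (a - 1) (lft 0 b X m w) - lft 0 b (\<lambda>m w. LB (a - 1) (X m w)) m w)
        + (rgt 0 b X m (LA (a - 1) w) - rgt 0 b (\<lambda>m w. X m (LA (a - 1) w)) m w)"
    unfolding mode_0 unfolding M0 mode_def lft_diff[OF fL fR] rgt_diff[OF fL fR] lR rL B.L_diff
    by simp
  also have "\<dots> = sB ?a (mode (a - 1) b X m w) - sB ?b (mode a (b - 1) X m w)
      + (sB (c / 12 * ?p) (if a + b \<ge> 2 then sB ((-1) ^ nat (a + b - 2) * (?b gchoose nat (a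
          + b - 2))) x else 0)
        - sB (c / 12 * ?p) (sB ?r x))"
    unfolding ad_lft[OF assms] ad_rgt[OF assms] x_def[symmetric]
    by (simp add: mode_def B.scale_right_diff_distrib)
  also have "sB (c / 12 * ?p) (if a + b \<ge> 2 then sB ((-1) ^ nat (a
      + b - 2) * (?b gchoose nat (a + b - 2))) x else 0)
        - sB (c / 12 * ?p) (sB ?r x)
      = - (if b < 0 then sB (c / 12 * (?b * (?b - 1) * (?b - 2) * (?a gchoose nat (2 - b)))) x else 0)"
  proof (cases "b < 0")
    case True
    have "c / 12 * ?p * ?r = c / 12 * (?b * (?b - 1) * (?b - 2) * (?a gchoose nat (2 - b)))"
      using cubic_gbinomial_neg[OF a True] by (simp add: mult.assoc)
    then show ?thesis using True a by simp
  next
    case False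
    define p q where "p = nat (- a)" and "q = nat b"
    have p: "a = - int p" and q: "b = int q" using a False by (auto simp: p_def q_def)
    have n: "nat (2 - a) = p + 2" unfolding p by simp
    have "(if a + b \<ge> 2 then (-1) ^ nat (a + b - 2) * (?b gchoose nat (a + b - 2)) else 0) = ?r"
    proof (cases "p + 2 \<le> q")
      case True
      then obtain k where k: "q = p + 2 + k" using le_Suc_ex by blast
      have "nat (a + b - 2) = k" unfolding p q k by simp
      moreover have "(?b gchoose k) = (?b gchoose (p + 2))"
        unfolding q of_int_of_nat_eq binomial_gbinomial[symmetric] k
        by (subst binomial_symmetric) simp_all
      moreover have "(-1) powi b * (-1) ^ (p + 2) = ((-1) ^ k :: complex)"
        unfolding q power_int_of_nat k by (simp add: power_add ac_simps)
      ultimately show ?thesis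
        unfolding n using True p q by (simp add: mult.assoc[symmetric] del: power_Suc)
    next
      case False
      then have "(?b gchoose (p + 2)) = 0" unfolding q by (simp add: gbinomial_nat_less)
      then show ?thesis unfolding n using False p q by simp
    qed
    then show ?thesis using False by (auto split: if_splits)
  qed
  finally show ?thesis by (simp add: x_def)
qed

section \<open>Local fields\<close>

text \<open>
  Locality of \<open>X\<close> with respect to \<open>T\<close> in the form of the commutator formula: \<open>x\<^sup>a\<close> acts on \<open>X\<close>
  through its Taylor expansion at \<open>x = z\<close>.
\<close>

definition local_field :: "(int \<Rightarrow> 'a \<Rightarrow> 'b) \<Rightarrow> bool" where
  "local_field X \<longleftrightarrow> field X \<and>
      (\<exists>N. \<forall>n\<ge>N. \<forall>m w. mode 0 n X m w = 0) \<and>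
     (\<forall>a m w. mode a 0 X m w = B.csum (of_int a) (\<lambda>i. mode 0 (int i) X (m + a - int i) w))"

lemma local_imp_field: "local_field X \<Longrightarrow> field X"
  and local_truncated: "local_field X \<Longrightarrow>
      \<exists>N. \<forall>n\<ge>N. \<forall>m w. mode 0 n X m w = 0"
  by (simp_all add: local_field_def)

lemma finsupp_mode:
  assumes "\<exists>N. \<forall>n\<ge>N. \<forall>m w. mode 0 n X m w = 0"
  shows "B.finsupp (\<lambda>i. mode 0 (b + int i) X (e i) w)"
proof -
  obtain N where "\<forall>n\<ge>N. \<forall>m w. mode 0 n X m w = 0" using assms by blast
  then show ?thesis by (intro B.finsuppI[of "nat (N - b)"]) auto
qed

lemma csum_mode_pascal:
  assumes "\<exists>N. \<forall>n\<ge>N. \<forall>m w. mode 0 n X m w = 0"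
  shows "B.csum (of_int (a + 1)) (\<lambda>i. mode 0 (b + int i) X (m + (a + 1) - int i) w)
    = B.csum (of_int a) (\<lambda>i. mode 0 (b + int i) X ((m + 1) + a - int i) w)
      + B.csum (of_int a) (\<lambda>i. mode 0 ((b + 1) + int i) X (m + a - int i) w)"
  using B.csum_pascal[OF finsupp_mode[OF assms, of b "\<lambda>i. m + (a + 1) - int i" w], of "of_int a"]
  by (simp add: algebra_simps)

text \<open>
  The Borcherds identity. The defect of the expansion satisfies the same recurrence as
  \<open>x\<^sup>a (x - z)\<^sup>b\<close> and vanishes for \<open>a = 0\<close> and for \<open>b = 0\<close>. Upwards in \<open>b\<close> the second boundary
  condition propagates; downwards the recurrence moves in \<open>a\<close> from the first.
\<close>

lemma local_expansion:
  assumes "local_field X"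
  shows "mode a b X m w = B.csum (of_int a) (\<lambda>i. mode 0 (b + int i) X (m + a - int i) w)"
proof -
  define D where "D a b m = mode a b X m w - B.csum (of_int a) (\<lambda>i. mode 0 (b
      + int i) X (m + a - int i) w)"
    for a b m
  have rec: "D a (b + 1) m = D (a + 1) b m - D a b (m + 1)" for a b m
    unfolding D_def mode_pascal[OF local_imp_field[OF assms]] csum_mode_pascal[OF local_truncated[OF assms]]
    by simp
  have D0: "D 0 b m = 0" for b m by (simp add: D_def B.csum_0)
  have Da: "D a 0 m = 0" for a m using assms by (simp add: D_def local_field_def)
  have "D a b m = 0"
  proof (induction b arbitrary: a m rule: int_induct[where k = 0])
    case base
    show ?case by (rule Da)
  next
    case (step1 b)
    then show ?case by (simp add: rec)
  next
    case (step2 b)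
    have step: "D (a + 1) (b - 1) m = D a (b - 1) (m + 1)" for a m
      using rec[of a "b - 1" m] step2 by simp
    show ?case
    proof (induction a arbitrary: m rule: int_induct[where k = 0])
      case base
      show ?case by (rule D0)
    next
      case (step1 a)
      then show ?case by (simp add: step)
    next
      case (step2 a)
      from step2(2)[of "m - 1"] step[of "a - 1" "m - 1"] show ?case by simp
    qed
  qed
  then show ?thesis by (simp add: D_def)
qed

text \<open>
  For \<open>a \<ge> 0\<close> both sides are polynomial in \<open>x\<close> and the expansion holds for every field, by
  induction on \<open>a\<close>; locality is a condition on negative \<open>a\<close> only.
\<close>

lemma localI:
  assumes "field X" and tr: "\<exists>N. \<forall>n\<ge>N. \<forall>m w. mode 0 n X m w = 0"
    and neg: "\<And>a m w. a < 0 \<Longrightarrow>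
      mode a 0 X m w = B.csum (of_int a) (\<lambda>i. mode 0 (int i) X (m + a - int i) w)"
  shows "local_field X"
proof -
  have pos: "mode (int a) b X m w
      = B.csum (of_int (int a)) (\<lambda>i. mode 0 (b + int i) X (m + int a - int i) w)"
    for a b m w
  proof (induction a arbitrary: b m)
    case 0
    show ?case by (simp add: B.csum_0)
  next
    case (Suc a)
    have "int (Suc a) = int a + 1" by simp
    then show ?case
      unfolding csum_mode_pascal[OF tr] \<open>int (Suc a) = int a + 1\<close>
      using mode_pascal[OF assms(1), of "int a" b m w] Suc[of b "m + 1"] Suc[of "b + 1" m] by simp
  qed
  have "mode a 0 X m w = B.csum (of_int a) (\<lambda>i. mode 0 (int i) X (m + a - int i) w)" for a m w
  proof (cases "a < 0")
    case False
    then show ?thesis using pos[of "nat a" 0 m w] by simp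
  qed (rule neg)
  with assms show ?thesis unfolding local_field_def by blast
qed

text \<open>
  Both sides of the expansion for \<open>L\<^bsub>b-1\<^esub> X\<close> are computed by commuting with the expansion for \<open>X\<close>.
  The terms produced by the brackets match by the Borcherds identity for \<open>(a - 1, b)\<close> and
  \<open>(a, b - 1)\<close>, and the central terms by residue calculus.
\<close>

lemma local_mode:
  assumes "local_field X"
  shows "local_field (mode 0 b X)"
proof (rule localI)
  have X: "field X" using assms by (rule local_imp_field)
  show "field (mode 0 b X)" by (rule field_mode[OF X])
  obtain N where N: "\<And>n m w. n \<ge> N \<Longrightarrow>
      mode 0 n X m w = 0" using local_truncated[OF assms] by blast
  have N': "mode 0 n X = (\<lambda>m w. 0)" if "n \<ge> N" for n using N[OF that] by (intro ext)
  show tr: "\<exists>N. \<forall>n\<ge>N. \<forall>m w. mode 0 n (mode 0 b X) m w = 0"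
  proof (intro exI allI impI)
    fix n m w assume n: "n \<ge> max (max N (N - b + 1)) (3 - b)"
    then show "mode 0 n (mode 0 b X) m w = 0"
      using mode_virasoro[OF X, of n b m w] N[of "n + b - 1"] N'[of n] by (simp add: mode_zero)
  qed
  fix a m w assume a: "(a :: int) < 0"
  let ?b = "of_int b :: complex" and ?a = "of_int a :: complex"
  define K where "K = c / 12 * (?b * (?b - 1) * (?b - 2))"
  define k where "k = nat (2 - b)"
  define E where "E i = (if i = k then if b < 0 then sB K (X (m + (a + b - 2)) w) else 0 else 0)" for i
  define Z1 where "Z1 i = mode 0 (int i) (mode 0 b X) (m + a - int i) w" for i
  define Z2 where "Z2 i = mode 0 (b - 1 + int i) X (m + a - int i) w" for i
  have f1: "B.finsupp Z1"
    unfolding Z1_def[abs_def] using finsupp_mode[OF tr, of 0 "\<lambda>i. m + a - int i" w] by simp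
  have f2: "B.finsupp Z2"
    unfolding Z2_def[abs_def] by (rule finsupp_mode[OF local_truncated[OF assms]])
  have f3: "B.finsupp E" by (rule B.finsuppI[of "Suc k"]) (auto simp: E_def)
  have "mode a 0 X = (\<lambda>m w. \<Sum>i<nat N. sB (?a gchoose i) (mode 0 (int i) X (m
      + (a - int i)) w))"
  proof (intro ext)
    fix m w
    have "mode a 0 X m w = B.csum ?a (\<lambda>i. mode 0 (int i) X (m + a - int i) w)"
      using assms by (simp add: local_field_def)
    also have "\<dots> = (\<Sum>i<nat N. sB (?a gchoose i) (mode 0 (int i) X (m + a - int i) w))"
      by (rule B.csum_eq_sum) (simp add: N)
    finally show "mode a 0 X m w = (\<Sum>i<nat N. sB (?a gchoose i) (mode 0 (int i) X (m
        + (a - int i)) w))"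
      by (simp add: algebra_simps)
  qed
  moreover have fs: "field (\<lambda>m. mode 0 (int i) X (m + (a - int i)))" for i
    by (rule field_shift[OF field_mode[OF X]])
  ultimately have "mode 0 b (mode a 0 X) m w
      = (\<Sum>i<nat N. sB (?a gchoose i) (mode 0 b (mode 0 (int i) X) (m + (a - int i)) w))"
    using mode_sum(2)[where Y = "\<lambda>i m. mode 0 (int i) X (m + (a - int i))" and a = 0 and b = b
        and N = "nat N" and e = "\<lambda>i. ?a gchoose i" and m = m and w = w]
    by (simp only: fs mode_shift simp_thms)
  also have "\<dots> = (\<Sum>i<nat N. sB (?a gchoose i) (mode 0 b (mode 0 (int i) X) (m + a - int i) w))"
    by (simp only: add_diff_eq)
  also have "\<dots> = B.csum ?a (\<lambda>i. mode 0 b (mode 0 (int i) X) (m + a - int i) w)"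
    by (rule B.csum_eq_sum[symmetric]) (simp add: N' mode_zero)
  also have "\<dots> = B.csum ?a (\<lambda>i. ((Z1 i + sB ?b (Z2 i)) - sB (of_nat i) (Z2 i)) + E i)"
  proof (rule B.csum_cong)
    fix i
    have E: "(if b - 1 = - (int i - 1) then sB (of_int ((b - 1) ^ 3 - (b - 1)) / 12 * c) (X (m
        + a - int i) w) else 0)
        = E i"
    proof -
      have cK: "of_int ((b - 1) ^ 3 - (b - 1)) / 12 * c = K"
        unfolding cubic_of_int by (simp add: K_def)
      show ?thesis
      proof (cases "b - 1 = - (int i - 1)")
        case True
        have ix: "i = k" "m + a - int i = m + (a + b - 2)" using True by (auto simp: k_def)
        have "K = 0" if "\<not> b < 0"
        proof -
          have "b \<in> {0, 1, 2}" using True that by auto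
          then show ?thesis by (auto simp: K_def)
        qed
        then show ?thesis
          unfolding cK ix(2) E_def if_P[OF True] if_P[OF ix(1)] by simp
      next
        case False
        then have "i \<noteq> k \<or> \<not> b < 0" by (auto simp: k_def)
        then show ?thesis using False unfolding E_def by auto
      qed
    qed
    have eq: "b + int i - 1 = b - 1 + int i" by simp
    have "mode 0 b (mode 0 (int i) X) (m + a - int i) w
        = mode 0 (int i) (mode 0 b X) (m + a - int i) w + (sB (of_int (b - int i)) (Z2 i) + E i)"
      using mode_virasoro[OF X, of b "int i" "m + a - int i" w] unfolding E Z2_def eq
      by (simp only: diff_eq_eq add.commute[of "mode 0 (int i) (mode 0 b X) (m + a - int i) w"])
    then show "mode 0 b (mode 0 (int i) X) (m + a - int i) w
        = ((Z1 i + sB ?b (Z2 i)) - sB (of_nat i) (Z2 i)) + E i"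
      unfolding Z1_def by (simp add: B.scale_left_diff_distrib)
  qed
  also have "\<dots> = B.csum ?a Z1 + sB ?b (B.csum ?a Z2)
      - sB ?a (B.csum (?a - 1) (\<lambda>i. Z2 (Suc i))) + B.csum ?a E"
    by (simp only: B.csum_add B.csum_diff B.csum_scale B.csum_weight B.finsupp_add B.finsupp_diff
        B.finsupp_scale f1 f2 f3)
  also have "B.csum ?a Z2 = mode a (b - 1) X m w"
    unfolding local_expansion[OF assms, of a "b - 1"] Z2_def[abs_def] ..
  also have "B.csum (?a - 1) (\<lambda>i. Z2 (Suc i)) = mode (a - 1) b X m w"
    unfolding local_expansion[OF assms, of "a - 1" b] by (simp add: Z2_def algebra_simps)
  also have "B.csum ?a E = (if b < 0 then
      sB (c / 12 * (?b * (?b - 1) * (?b - 2) * (?a gchoose nat (2 - b)))) (X (m + (a + b - 2)) w) else 0)"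
    unfolding E_def[abs_def] B.csum_single k_def K_def by (simp add: mult_ac)
  finally have "mode 0 b (mode a 0 X) m w = B.csum ?a Z1 + sB ?b (mode a (b - 1) X m w)
      - sB ?a (mode (a - 1) b X m w) + (if b < 0 then
      sB (c / 12 * (?b * (?b - 1) * (?b - 2) * (?a gchoose nat (2 - b)))) (X (m + (a + b - 2)) w) else 0)" .
  then show "mode a 0 (mode 0 b X) m w
      = B.csum ?a (\<lambda>i. mode 0 (int i) (mode 0 b X) (m + a - int i) w)"
    using mode_ad[OF X a, of b m w] unfolding Z1_def[abs_def] by (simp add: diff_eq_eq)
qed

lemma local_zero: "local_field (\<lambda>m w. 0)"
  unfolding local_field_def by (auto simp: mode_zero B.csum_def intro: fieldI)

lemma local_add:
  assumes "local_field X" "local_field Y"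
  shows "local_field (\<lambda>m w. X m w + Y m w)"
proof -
  note f = assms[THEN local_imp_field]
  obtain N N' where N: "\<forall>n\<ge>N. \<forall>m w. mode 0 n X m w
      = 0" "\<forall>n\<ge>N'. \<forall>m w. mode 0 n Y m w = 0"
    using assms[THEN local_truncated] by blast
  then have "\<forall>n\<ge>max N N'. \<forall>m w. mode 0 n (\<lambda>m w. X m w + Y m w) m w = 0"
    by (simp add: mode_add f)
  moreover have "mode a 0 (\<lambda>m w. X m w + Y m w) m w
      = B.csum (of_int a) (\<lambda>i. mode 0 (int i) (\<lambda>m w. X m w + Y m w) (m
          + a - int i) w)" for a m w
    using B.csum_add[of "\<lambda>i. mode 0 (int i) X (m
        + a - int i) w" "\<lambda>i. mode 0 (int i) Y (m + a - int i) w" "of_int a"]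
      finsupp_mode[OF local_truncated, OF assms(1), of 0] finsupp_mode[OF local_truncated,
          OF assms(2), of 0]
      local_expansion[OF assms(1), of a 0] local_expansion[OF assms(2), of a 0]
    by (simp add: mode_add f)
  ultimately show ?thesis unfolding local_field_def using field_plus[OF f] by blast
qed

lemma local_scale:
  assumes "local_field X"
  shows "local_field (\<lambda>m w. sB e (X m w))"
proof -
  note f = local_imp_field[OF assms]
  obtain N where N: "\<forall>n\<ge>N. \<forall>m w. mode 0 n X m w
      = 0" using local_truncated[OF assms] by blast
  then have "\<forall>n\<ge>N. \<forall>m w. mode 0 n (\<lambda>m w. sB e (X m w)) m w = 0"
    by (simp add: mode_scale f)
  moreover have "mode a 0 (\<lambda>m w. sB e (X m w)) m w
      = B.csum (of_int a) (\<lambda>i. mode 0 (int i) (\<lambda>m w. sB e (X m w)) (m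
          + a - int i) w)" for a m w
    using B.csum_scale[of "\<lambda>i. mode 0 (int i) X (m + a - int i) w" "of_int a" e]
      finsupp_mode[OF local_truncated, OF assms, of 0] local_expansion[OF assms, of a 0]
    by (simp add: mode_scale f)
  ultimately show ?thesis unfolding local_field_def using field_scaled[OF f, of "\<lambda>_. e"] by blast
qed

section \<open>Translation covariance\<close>

text \<open>
  \<open>d/dz\<close> on \<open>\<Sum>\<^sub>m X\<^sub>m z\<^bsup>-\<delta>-m-1\<^esup>\<close>.
\<close>

definition z_derivative :: "complex \<Rightarrow>
    (int \<Rightarrow> 'a \<Rightarrow> 'b) \<Rightarrow> int \<Rightarrow> 'a \<Rightarrow> 'b" where
  "z_derivative \<delta> X = (\<lambda>m w. sB (- (\<delta> + of_int m)) (X (m - 1) w))"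

lemma z_derivative_lft:
  assumes X: "field X"
  shows "z_derivative \<delta> (lft 0 b X) m w - lft 0 b (z_derivative \<delta> X) m w
      = - sB (of_int b) (lft 0 (b - 1) X m w)"
proof -
  define Z where "Z i = LB (b - 1 - int i) (X (m - 1 + int i) w)" for i
  have fZ: "B.finsupp Z" unfolding Z_def[abs_def] by (rule finsupp_lft'[OF X])
  have 1: "z_derivative \<delta> (lft 0 b X) m w
      = B.bsum (of_int b) (\<lambda>i. sB (- (\<delta> + of_int m)) (Z i))"
    unfolding B.bsum_scale[OF fZ] by (simp add: z_derivative_def lft_def Z_def[abs_def])
  have "lft 0 b (z_derivative \<delta> X) m w
      = B.bsum (of_int b) (\<lambda>i. sB (- (\<delta> + of_int m)) (Z i) - sB (of_nat i) (Z i))"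
    unfolding lft_def z_derivative_def
  proof (intro B.bsum_cong)
    fix i
    have "- (\<delta> + of_int (m + int i)) = - (\<delta> + of_int m) - of_nat i" "m + int i - 1
        = m - 1 + int i"
      by simp_all
    then show "LB (0 + b - 1 - int i) (sB (- (\<delta> + of_int (m + int i))) (X (m + int i - 1) w))
        = sB (- (\<delta> + of_int m)) (Z i) - sB (of_nat i) (Z i)"
      by (simp only: Z_def B.L_scale B.L_diff B.scale_left_diff_distrib add_0_left)
  qed
  also have "\<dots> = B.bsum (of_int b) (\<lambda>i. sB (- (\<delta> + of_int m)) (Z i))
      + sB (of_int b) (B.bsum (of_int b - 1) (\<lambda>i. Z (Suc i)))"
    by (simp add: B.bsum_diff B.finsupp_scale fZ B.bsum_weight)
  also have "B.bsum (of_int b - 1) (\<lambda>i. Z (Suc i)) = lft 0 (b - 1) X m w"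
    by (simp add: lft_def Z_def algebra_simps)
  finally show ?thesis by (simp add: 1)
qed

lemma z_derivative_rgt:
  assumes X: "field X"
  shows "z_derivative \<delta> (rgt 0 b X) m w - rgt 0 b (z_derivative \<delta> X) m w
      = - sB (of_int b) (rgt 0 (b - 1) X m w)"
proof -
  define Z where "Z i = X (m - 1 + b - int i) (LA (int i - 1) w)" for i
  let ?s = "(-1) powi b :: complex"
  have fZ: "B.finsupp Z"
    using finsupp_rgt'[OF X, of "m - 1 + b" 0 w] by (simp add: Z_def[abs_def])
  have 1: "z_derivative \<delta> (rgt 0 b X) m w
      = sB ?s (B.bsum (of_int b) (\<lambda>i. sB (- (\<delta> + of_int m)) (Z i)))"
    unfolding B.bsum_scale[OF fZ] by (simp add: z_derivative_def rgt_def Z_def[abs_def] mult.commute)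
  have "rgt 0 b (z_derivative \<delta> X) m w
      = sB ?s (B.bsum (of_int b) (\<lambda>i. sB (- (\<delta>
          + of_int m)) (Z i) - sB (of_int b - of_nat i) (Z i)))"
    unfolding rgt_def z_derivative_def
  proof (intro arg_cong[of _ _ "sB ?s"] B.bsum_cong)
    fix i
    have "- (\<delta> + of_int (m + b - int i)) = - (\<delta> + of_int m) - (of_int b - of_nat i)"
      "m + b - int i - 1 = m - 1 + b - int i"
      by simp_all
    then show "sB (- (\<delta> + of_int (m + b - int i))) (X (m + b - int i - 1) (LA (0 + int i - 1) w))
        = sB (- (\<delta> + of_int m)) (Z i) - sB (of_int b - of_nat i) (Z i)"
      by (simp only: Z_def B.scale_left_diff_distrib add_0_left)
  qed
  also have "\<dots> = sB ?s (B.bsum (of_int b) (\<lambda>i. sB (- (\<delta> + of_int m)) (Z i)))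
      - sB (of_int b) (sB ?s (B.bsum (of_int b - 1) Z))"
    by (simp add: B.bsum_diff B.finsupp_scale fZ B.bsum_coweight B.scale_right_diff_distrib mult.commute)
  also have "sB ?s (B.bsum (of_int b - 1) Z) = - rgt 0 (b - 1) X m w"
    by (simp add: rgt_def Z_def[abs_def] power_int_diff algebra_simps)
  finally show ?thesis by (simp add: 1)
qed

definition translation_covariant :: "complex \<Rightarrow>
    (int \<Rightarrow> 'a \<Rightarrow> 'b) \<Rightarrow> bool" where
  "translation_covariant \<delta> X \<longleftrightarrow> (\<forall>m w. mode 0 0 X m w
      = z_derivative \<delta> X m w)"

text \<open>
  \<open>d/dz\<close> and the action of \<open>L\<^bsub>-1\<^esub>\<close> have the same commutator with the action of \<open>(x - z)\<^sup>b\<close>, namely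
  \<open>- b (x - z)\<^bsup>b-1\<^esup>\<close>.
\<close>

lemma translation_covariant_mode:
  assumes X: "field X" and tc: "translation_covariant \<delta> X"
  shows "translation_covariant \<delta> (mode 0 b X)"
  unfolding translation_covariant_def
proof (intro allI)
  fix m w
  have e: "mode 0 0 X = z_derivative \<delta> X" using tc
      by (simp add: translation_covariant_def fun_eq_iff)
  have "mode 0 0 (mode 0 b X) m w
      = mode 0 b (z_derivative \<delta> X) m w - sB (of_int b) (mode 0 (b - 1) X m w)"
    using mode_virasoro[OF X, of 0 b m w] unfolding e by (simp add: algebra_simps)
  also have "\<dots> = z_derivative \<delta> (mode 0 b X) m w"
  proof -
    have "z_derivative \<delta> (mode 0 b X) m w
        = z_derivative \<delta> (lft 0 b X) m w - z_derivative \<delta> (rgt 0 b X) m w"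
      by (simp add: z_derivative_def mode_def B.scale_right_diff_distrib)
    then show ?thesis
      using z_derivative_lft[OF X, of \<delta> b m w] z_derivative_rgt[OF X, of \<delta> b m w]
      by (simp add: mode_def diff_eq_eq B.scale_right_diff_distrib)
  qed
  finally show "mode 0 0 (mode 0 b X) m w = z_derivative \<delta> (mode 0 b X) m w" .
qed

section \<open>The Virasoro module of local fields\<close>

lemma vector_space_fscale: "vector_space fscale"
  by unfold_locales
     (auto simp: fscale_def fun_eq_iff B.scale_right_distrib B.scale_left_distrib)

lemma fields_action:
  "virasoro_action fscale {X. local_field X \<and> translation_covariant \<delta> X}
      (\<lambda>n. mode 0 (n + 1)) c"
proof -
  interpret F: vector_space fscale by (rule vector_space_fscale)
  let ?S = "{X. local_field X \<and> translation_covariant \<delta> X}"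
  have plus: "X + Y = (\<lambda>m w. X m w + Y m w)" for X Y :: "int \<Rightarrow> 'a \<Rightarrow> 'b"
    by (simp add: fun_eq_iff)
  show ?thesis
  proof unfold_locales
    show "F.subspace ?S"
      unfolding F.subspace_def
    proof (intro conjI ballI allI)
      have "(0 :: int \<Rightarrow> 'a \<Rightarrow> 'b) = (\<lambda>m w. 0)" by (simp add: fun_eq_iff)
      then have "local_field 0" and "mode 0 0 0 m w = 0" for m w
        using local_zero mode_zero[of 0 0 m w] by (auto simp only:)
      then show "0 \<in> ?S" by (simp add: translation_covariant_def z_derivative_def)
      show "X + Y \<in> ?S" if "X \<in> ?S" "Y \<in> ?S" for X Y
        using that local_add[of X Y]
        by (simp add: plus translation_covariant_def mode_add local_imp_field z_derivative_def
            B.scale_right_distrib)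
      show "fscale e X \<in> ?S" if "X \<in> ?S" for e X
        using that local_scale[of X e]
        by (simp add: fscale_def translation_covariant_def mode_scale local_imp_field
            z_derivative_def mult.commute)
    qed
    fix X n assume X: "X \<in> ?S"
    then have fX: "field X" by (simp add: local_imp_field)
    show "mode 0 (n + 1) X \<in> ?S"
      using X by (simp add: local_mode translation_covariant_mode local_imp_field)
    show "mode 0 (n + 1) (X + Y) = mode 0 (n + 1) X + mode 0 (n + 1) Y" if "Y \<in> ?S" for Y
      using fX that by (intro ext) (simp add: plus mode_add local_imp_field)
    show "mode 0 (n + 1) (fscale e X) = fscale e (mode 0 (n + 1) X)" for e
      unfolding fscale_def by (intro ext) (rule mode_scale[OF fX])
    fix m
    show "mode 0 (m + 1) (mode 0 (n + 1) X) - mode 0 (n + 1) (mode 0 (m + 1) X)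
      = fscale (of_int (m - n)) (mode 0 (m + n + 1) X)
        + (if m = - n then fscale (of_int (m^3 - m) / 12 * c) X else 0)"
    proof (intro ext)
      fix k w
      have e: "m + 1 + (n + 1) - 1 = m + n + 1" "m + 1 - (n + 1) = m - n" "m + 1 - 1 = m" by simp_all
      show "(mode 0 (m + 1) (mode 0 (n + 1) X) - mode 0 (n + 1) (mode 0 (m + 1) X)) k w
        = (fscale (of_int (m - n)) (mode 0 (m + n + 1) X)
          + (if m = - n then fscale (of_int (m^3 - m) / 12 * c) X else 0)) k w"
        using mode_virasoro[OF fX, of "m + 1" "n + 1" k w] unfolding e
        by (simp add: fscale_def)
    qed
  qed
qed

lemma primary_commutator:
  assumes "local_field X" "translation_covariant \<delta> X"
    and h: "mode 0 1 X = fscale h X" "\<And>n. n \<ge> 2 \<Longrightarrow> mode 0 n X = 0"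
  shows "mode a 0 X m w = sB (of_int a * h - (\<delta> + of_int m + of_int a)) (X (m + a - 1) w)"
proof -
  have "mode a 0 X m w = B.csum (of_int a) (\<lambda>i. mode 0 (int i) X (m + a - int i) w)"
    using assms(1) by (simp add: local_field_def)
  also have "\<dots> = (\<Sum>i<2. sB (of_int a gchoose i) (mode 0 (int i) X (m + a - int i) w))"
    by (rule B.csum_eq_sum) (simp add: h(2))
  also have "\<dots> = mode 0 0 X (m + a) w + sB (of_int a) (mode 0 1 X (m + a - 1) w)"
    by (simp add: numeral_2_eq_2)
  also have "\<dots> = sB (of_int a * h - (\<delta> + of_int m + of_int a)) (X (m + a - 1) w)"
  proof -
    have "mode 0 0 X (m + a) w = sB (- (\<delta> + of_int m + of_int a)) (X (m + a - 1) w)"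
      using assms(2) by (simp add: translation_covariant_def z_derivative_def add.assoc)
    then show ?thesis
      unfolding h(1) fscale_def B.scale_scale
      by (simp only: B.scale_left_distrib[symmetric]) (simp add: add.commute)
  qed
  finally show ?thesis .
qed

text \<open>
  The commutator of a primary field with \<open>L\<^sub>n\<close> is a multiple of a mode of the field, so the
  vectors killed by all modes form a submodule.
\<close>

lemma primary_eq_0:
  assumes X: "local_field X" "translation_covariant \<delta> X"
    "mode 0 1 X = fscale h X" "\<And>n. n \<ge> 2 \<Longrightarrow> mode 0 n X = 0"
    and lw: "lowest_weight_module sA LA c h1 v1" and v1: "\<And>m. X m v1 = 0"
  shows "X m w = 0"
proof -
  interpret lowest_weight_module sA LA c h1 v1 by (rule lw)
  have fX: "field X" by (rule local_imp_field[OF X(1)])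
  show ?thesis
  proof (induction w arbitrary: m rule: generated_induct)
    case gen
    show ?case by (rule v1)
  next
    case (L n w)
    have "mode (n + 1) 0 X m w = 0"
      by (simp add: primary_commutator[OF X] L)
    then show ?case using L by (simp add: mode_0 B.L_0)
  next
    case (add x y)
    then show ?case by (simp add: field_add[OF fX])
  next
    case (scale a x)
    then show ?case by (simp add: field_scale[OF fX])
  qed
qed

end

section \<open>Solving the null vector equation\<close>

locale fusion_data =
  V1: verma_module sA LA c h1 v1 + V2: lowest_weight_module sB LB c h2 v2
  for sA :: "complex \<Rightarrow> 'a::ab_group_add \<Rightarrow> 'a" and LA c h1 v1
    and sB :: "complex \<Rightarrow> 'b::ab_group_add \<Rightarrow> 'b" and LB h2 v2 +
  fixes t s :: complex
  assumes t: "t \<noteq> 0" and c: "c = 13 - 6 * t - 6 / t"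
    and s: "s\<^sup>2 = 4 * t * h1 + (t - 1)\<^sup>2"
    and h2: "h2 = h1 + 1 / (4 * t) - 1 / (2 * t) * s"
    and s_nonint: "\<And>n::nat. n \<ge> 1 \<Longrightarrow> 1 / t * s \<noteq> of_nat n"
begin

definition h12 :: complex where "h12 = - 1 / 2 + 3 / (4 * t)"

text \<open>
  The exponent of the lowest power of \<open>z\<close> in \<open>\<psi>(z) v\<^sub>1\<close>.
\<close>

definition leading_exponent :: complex where "leading_exponent = h2 - h1 - h12"

text \<open>
  The indicial polynomial \<open>t y (y - 1) + y - h\<^sub>1\<close> of the null vector equation at \<open>y = x + N\<close>, where
  \<open>x\<close> is the leading exponent; see \<open>kappa_indicial\<close>.
\<close>

definition \<kappa> :: "nat \<Rightarrow> complex" where "\<kappa> N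
    = t * (of_nat N)\<^sup>2 - s * of_nat N"

sublocale V1: lowest_weight_module sA LA c h1 v1
  by (rule V1.lowest_weight_module)

sublocale V1: Vc_module sA LA c
  by (rule V1.Vc_module)

sublocale V2: Vc_module sB LB c
  by (rule V2.Vc_module)

sublocale vir_fields sA LA sB LB c
  by unfold_locales (rule V1.restricted)

lemma kappa_nonzero: "N \<ge> 1 \<Longrightarrow> \<kappa> N \<noteq> 0"
proof
  assume N: "N \<ge> 1" and "\<kappa> N = 0"
  then have "of_nat N * (t * of_nat N - s) = 0"
    by (simp add: \<kappa>_def power2_eq_square algebra_simps)
  then have "s = t * of_nat N" using N by simp
  then show False using s_nonint[OF N] t by simp
qed

text \<open>
  The relations in polynomial form, with \<open>inverse t\<close> as a variable of its own, so that the
  identities below are decided by Groebner bases.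
\<close>

lemma parameters:
  "4 * h1 = (s\<^sup>2 - (t - 1)\<^sup>2) * inverse t" "2 * leading_exponent = (t - 1 - s) * inverse t"
  "4 * h12 = 3 * inverse t - 2" "h2 = leading_exponent + h1 + h12" "c = 13 - 6 * t - 6 * inverse t"
  "t * inverse t = 1"
  using t s h2 c by (simp_all add: h12_def leading_exponent_def field_simps power2_eq_square)

lemma kappa_indicial:
  "t * ((leading_exponent + of_nat N) * (leading_exponent + of_nat N - 1)) + (leading_exponent
      + of_nat N) - h1 = \<kappa> N"
  using parameters unfolding \<kappa>_def by algebra

text \<open>
  The scalar identity behind the induction step for \<open>L\<^sub>1\<close>; the next lemma is the one for \<open>L\<^sub>2\<close>.
\<close>

lemma kappa_step1:
  "(of_nat K + 2 + (leading_exponent + 2 * h12)) * \<kappa> K + 2 * (h2 + of_nat K)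
      = \<kappa> (Suc K) * (of_nat K + (leading_exponent + 2 * h12))"
  using parameters unfolding \<kappa>_def of_nat_Suc by algebra

lemma kappa_step2:
  "(of_nat K + 4 + (leading_exponent + 3 * h12)) * \<kappa> K + (4 * (h2 + of_nat K)
      + 3 * (of_nat K + (leading_exponent + 2 * h12)) + c / 2)
    = \<kappa> (Suc (Suc K)) * (of_nat K + (leading_exponent + 3 * h12))"
proof -
  have "2 * (of_nat K + 4 + (leading_exponent + 3 * h12)) * \<kappa> K + (8 * (h2 + of_nat K)
      + 6 * (of_nat K + (leading_exponent + 2 * h12)) + c)
    = 2 * \<kappa> (Suc (Suc K)) * (of_nat K + (leading_exponent + 3 * h12))"
    using parameters unfolding \<kappa>_def of_nat_Suc by algebra
  then show ?thesis by (simp add: field_simps)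
qed

fun \<phi> :: "nat \<Rightarrow> 'b" where
  "\<phi> N = (if N = 0 then v2 else sB (inverse (\<kappa> N)) (\<Sum>k<N. LB (int k - int N) (\<phi> k)))"

declare \<phi>.simps [simp del]

lemma phi_0: "\<phi> 0 = v2"
  by (simp add: \<phi>.simps)

lemma phi_rec: "sB (\<kappa> N) (\<phi> N) = (\<Sum>k<N. LB (int k - int N) (\<phi> k))"
proof (cases "N = 0")
  case False
  then show ?thesis using kappa_nonzero[of N] by (subst \<phi>.simps) simp
qed (simp add: \<kappa>_def)

lemma phi_level: "\<phi> N \<in> V2.level (int N)"
proof (induction N rule: less_induct)
  case (less N)
  show ?case
  proof (cases "N = 0")
    case True
    then show ?thesis by (simp add: phi_0 V2.level_0 range_eqI[of _ _ 1])
  next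
    case False
    have "LB (int k - int N) (\<phi> k) \<in> V2.level (int N)" if "k < N" for k
      using V2.L_level[OF less[OF that], of "int k - int N"] by simp
    then have "sB (inverse (\<kappa> N)) (\<Sum>k<N. LB (int k - int N) (\<phi> k)) \<in> V2.level (int N)"
      by (intro V2.subspace_scale[OF V2.subspace_level] V2.subspace_sum[OF V2.subspace_level]) auto
    then show ?thesis using False by (subst \<phi>.simps) simp
  qed
qed

lemma L0_phi: "LB 0 (\<phi> N) = sB (h2 + of_nat N) (\<phi> N)"
  using V2.L0_level[OF phi_level[of N]] by simp

text \<open>
  Apply \<open>L\<^sub>1\<close> to the recursion, commute it past each \<open>L\<^bsub>k-N\<^esub>\<close> and use the induction hypothesis. The
  coefficients \<open>k + y\<close> and \<open>K + 2 - k\<close> of \<open>L\<^bsub>k-K\<^esub> \<phi>\<^sub>k\<close> add up to a constant, so the recursion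
  for \<open>\<phi>\<^sub>K\<close> applies to the sum.
\<close>

lemma L1_phi: "LB 1 (\<phi> 0) = 0" "LB 1 (\<phi> (Suc K))
    = sB (of_nat K + (leading_exponent + 2 * h12)) (\<phi> K)"
proof -
  show 0: "LB 1 (\<phi> 0) = 0" by (simp add: phi_0 V2.L_pos_v)
  show "LB 1 (\<phi> (Suc K)) = sB (of_nat K + (leading_exponent + 2 * h12)) (\<phi> K)"
  proof (induction K rule: less_induct)
    case (less K)
    let ?y = "leading_exponent + 2 * h12"
    have "sB (\<kappa> (Suc K)) (LB 1 (\<phi> (Suc K)))
        = (\<Sum>k<Suc K. LB 1 (LB (int k - int (Suc K)) (\<phi> k)))"
      by (simp only: V2.L_scale[symmetric] phi_rec V2.L_sum)
    also have "\<dots> = (\<Sum>k<Suc K. LB (int k - int (Suc K)) (LB 1 (\<phi> k)))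
        + (\<Sum>k<Suc K. sB (of_nat K + 2 - of_nat k) (LB (int k - int K) (\<phi> k)))"
      unfolding sum.distrib[symmetric]
    proof (rule sum.cong[OF refl])
      fix k
      have "1 + (int k - int (Suc K)) = int k - int K"
        "of_int (1 - (int k - int (Suc K))) = (of_nat K + 2 - of_nat k :: complex)" by simp_all
      then show "LB 1 (LB (int k - int (Suc K)) (\<phi> k)) = LB (int k - int (Suc K)) (LB 1 (\<phi> k))
          + sB (of_nat K + 2 - of_nat k) (LB (int k - int K) (\<phi> k))"
        using V2.L_commute[of 1 "int k - int (Suc K)" "\<phi> k"] by simp
    qed
    also have "(\<Sum>k<Suc K. LB (int k - int (Suc K)) (LB 1 (\<phi> k)))
        = (\<Sum>k<K. sB (of_nat k + ?y) (LB (int k - int K) (\<phi> k)))"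
      unfolding sum.lessThan_Suc_shift 0
      by (simp add: V2.L_0 less V2.L_scale)
    also have "(\<Sum>k<Suc K. sB (of_nat K + 2 - of_nat k) (LB (int k - int K) (\<phi> k)))
        = (\<Sum>k<K. sB (of_nat K + 2 - of_nat k) (LB (int k - int K) (\<phi> k))) + sB (2 * (h2
            + of_nat K)) (\<phi> K)"
      by (simp add: L0_phi)
    also have "(\<Sum>k<K. sB (of_nat k + ?y) (LB (int k - int K) (\<phi> k))) +
        ((\<Sum>k<K. sB (of_nat K + 2 - of_nat k) (LB (int k - int K) (\<phi> k))) + sB (2 * (h2
            + of_nat K)) (\<phi> K))
      = (\<Sum>k<K. sB (of_nat K + 2 + ?y) (LB (int k - int K) (\<phi> k))) + sB (2 * (h2
          + of_nat K)) (\<phi> K)"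
    proof -
      have "(\<Sum>k<K. sB (of_nat k + ?y) (LB (int k - int K) (\<phi> k)))
          + (\<Sum>k<K. sB (of_nat K + 2 - of_nat k) (LB (int k - int K) (\<phi> k)))
        = (\<Sum>k<K. sB (of_nat K + 2 + ?y) (LB (int k - int K) (\<phi> k)))"
        unfolding sum.distrib[symmetric] V2.scale_left_distrib[symmetric]
        by (intro sum.cong refl arg_cong2[of _ _ _ _ sB]) simp
      then show ?thesis by (simp only: add.assoc[symmetric])
    qed
    also have "(\<Sum>k<K. sB (of_nat K + 2 + ?y) (LB (int k - int K) (\<phi> k)))
        = sB ((of_nat K + 2 + ?y) * \<kappa> K) (\<phi> K)"
      by (simp only: V2.scale_sum_right[symmetric] phi_rec[symmetric] V2.scale_scale)
    also have "\<dots> + sB (2 * (h2 + of_nat K)) (\<phi> K)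
        = sB (\<kappa> (Suc K)) (sB (of_nat K + ?y) (\<phi> K))"
      by (simp only: V2.scale_left_distrib[symmetric] kappa_step1 V2.scale_scale)
    finally show ?case using kappa_nonzero[of "Suc K"] by (simp only: V2.scale_cancel_left) simp
  qed
qed

text \<open>
  The same argument as for \<open>L\<^sub>1\<close>; the term \<open>k = K\<close> now contributes the central charge, and
  \<open>k = K + 1\<close> uses the result for \<open>L\<^sub>1\<close>.
\<close>

lemma L2_phi: "LB 2 (\<phi> 0) = 0" "LB 2 (\<phi> (Suc 0)) = 0"
  "LB 2 (\<phi> (Suc (Suc K))) = sB (of_nat K + (leading_exponent + 3 * h12)) (\<phi> K)"
proof -
  show 0: "LB 2 (\<phi> 0) = 0" by (simp add: phi_0 V2.L_pos_v)
  show 1: "LB 2 (\<phi> (Suc 0)) = 0"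
  proof -
    have "sB (\<kappa> 1) (LB 2 (\<phi> 1)) = LB 2 (LB (-1) (\<phi> 0))"
      by (simp add: phi_rec flip: V2.L_scale)
    also have "\<dots> = 0"
      by (subst V2.L_commute) (simp add: phi_0 V2.L_pos_v V2.L_0)
    finally show ?thesis using kappa_nonzero[of 1] by simp
  qed
  show "LB 2 (\<phi> (Suc (Suc K))) = sB (of_nat K + (leading_exponent + 3 * h12)) (\<phi> K)"
  proof (induction K rule: less_induct)
    case (less K)
    let ?y = "leading_exponent + 3 * h12" and ?N = "Suc (Suc K)"
    let ?r = "4 * (h2 + of_nat K) + 3 * (of_nat K + (leading_exponent + 2 * h12)) + c / 2"
    have "sB (\<kappa> ?N) (LB 2 (\<phi> ?N)) = (\<Sum>k<?N. LB 2 (LB (int k - int ?N) (\<phi> k)))"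
      by (simp only: V2.L_scale[symmetric] phi_rec V2.L_sum)
    also have "\<dots> = (\<Sum>k<?N. LB (int k - int ?N) (LB 2 (\<phi> k)))
        + (\<Sum>k<?N. sB (of_nat K + 4 - of_nat k) (LB (int k - int K) (\<phi> k))
            + (if k = K then sB (c / 2) (\<phi> K) else 0))"
      unfolding sum.distrib[symmetric]
    proof (rule sum.cong[OF refl])
      fix k
      have "2 + (int k - int ?N) = int k - int K" "2 = - (int k - int ?N) \<longleftrightarrow> k = K"
        "of_int (2 - (int k - int ?N)) = (of_nat K + 4 - of_nat k :: complex)" by auto
      then show "LB 2 (LB (int k - int ?N) (\<phi> k)) = LB (int k - int ?N) (LB 2 (\<phi> k))
          + (sB (of_nat K + 4 - of_nat k) (LB (int k - int K) (\<phi> k))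
            + (if k = K then sB (c / 2) (\<phi> K) else 0))"
        using V2.L_commute[of 2 "int k - int ?N" "\<phi> k"] by (simp add: add.assoc)
    qed
    also have "(\<Sum>k<?N. LB (int k - int ?N) (LB 2 (\<phi> k)))
        = (\<Sum>k<K. sB (of_nat k + ?y) (LB (int k - int K) (\<phi> k)))"
      unfolding sum.lessThan_Suc_shift 0 1
      by (simp add: V2.L_0 less V2.L_scale)
    also have "(\<Sum>k<?N. sB (of_nat K + 4 - of_nat k) (LB (int k - int K) (\<phi> k))
            + (if k = K then sB (c / 2) (\<phi> K) else 0))
        = (\<Sum>k<K. sB (of_nat K + 4 - of_nat k) (LB (int k - int K) (\<phi> k))) + sB ?r (\<phi> K)"
    proof -
      have "sB ?r (\<phi> K) = sB (4 * (h2 + of_nat K)) (\<phi> K)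
          + sB (3 * (of_nat K + (leading_exponent + 2 * h12))) (\<phi> K) + sB (c / 2) (\<phi> K)"
        by (simp only: V2.scale_left_distrib)
      then show ?thesis by (simp add: L0_phi L1_phi sum.distrib add.assoc)
    qed
    also have "(\<Sum>k<K. sB (of_nat k + ?y) (LB (int k - int K) (\<phi> k))) +
        ((\<Sum>k<K. sB (of_nat K + 4 - of_nat k) (LB (int k - int K) (\<phi> k))) + sB ?r (\<phi> K))
      = (\<Sum>k<K. sB (of_nat K + 4 + ?y) (LB (int k - int K) (\<phi> k))) + sB ?r (\<phi> K)"
    proof -
      have "(\<Sum>k<K. sB (of_nat k + ?y) (LB (int k - int K) (\<phi> k)))
          + (\<Sum>k<K. sB (of_nat K + 4 - of_nat k) (LB (int k - int K) (\<phi> k)))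
        = (\<Sum>k<K. sB (of_nat K + 4 + ?y) (LB (int k - int K) (\<phi> k)))"
        unfolding sum.distrib[symmetric] V2.scale_left_distrib[symmetric]
        by (intro sum.cong refl arg_cong2[of _ _ _ _ sB]) simp
      then show ?thesis by (simp only: add.assoc[symmetric])
    qed
    also have "(\<Sum>k<K. sB (of_nat K + 4 + ?y) (LB (int k - int K) (\<phi> k)))
        = sB ((of_nat K + 4 + ?y) * \<kappa> K) (\<phi> K)"
      by (simp only: V2.scale_sum_right[symmetric] phi_rec[symmetric] V2.scale_scale)
    also have "\<dots> + sB ?r (\<phi> K) = sB (\<kappa> ?N) (sB (of_nat K + ?y) (\<phi> K))"
      by (simp only: V2.scale_left_distrib[symmetric] kappa_step2 V2.scale_scale)
    finally show ?case using kappa_nonzero[of ?N] by (simp only: V2.scale_cancel_left) simp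
  qed
qed

section \<open>The primary field and its null vector\<close>

text \<open>
  Chosen so that the coefficient of index \<open>m = - N\<close> in \<open>\<psi>(z) v\<^sub>1\<close> belongs to
  \<open>z\<^bsup>N + x\<^esup>\<close>, with \<open>x\<close> the leading exponent.
\<close>

definition \<delta> :: complex where "\<delta> = - leading_exponent - 1"

definition lscale :: "complex \<Rightarrow> (int \<Rightarrow> 'b) \<Rightarrow> int \<Rightarrow> 'b" where
  "lscale a u = (\<lambda>m. sB a (u m))"

text \<open>
  \<open>L\<^sub>n - z\<^sup>n (z d/dz + (n + 1) h\<^bsub>1,2\<^esub>)\<close> on series. A linear map \<open>\<psi>(z)\<close> from \<open>V\<^sub>1\<close> to series is
  primary of weight \<open>h\<^bsub>1,2\<^esub>\<close> exactly if it is a module homomorphism for this action.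
\<close>

definition twist :: "int \<Rightarrow> (int \<Rightarrow> 'b) \<Rightarrow> int \<Rightarrow> 'b" where
  "twist n u = (\<lambda>m. LB n (u m) + sB (\<delta> + of_int m + (of_int n + 1) * (1 - h12)) (u (m + n)))"

lemma twist_action: "virasoro_action lscale UNIV twist c"
proof -
  interpret F: vector_space lscale
    by unfold_locales
      (auto simp: lscale_def fun_eq_iff V2.scale_right_distrib V2.scale_left_distrib)
  show ?thesis
  proof unfold_locales
    fix u v :: "int \<Rightarrow> 'b" and n m :: int and a
    show "twist n (u + v) = twist n u + twist n v"
      by (simp add: twist_def fun_eq_iff V2.L_add V2.scale_right_distrib)
    show "twist n (lscale a u) = lscale a (twist n u)"
      by (simp add: twist_def lscale_def fun_eq_iff V2.L_scale V2.scale_right_distrib mult.commute)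
    show "twist m (twist n u) - twist n (twist m u) = lscale (of_int (m - n)) (twist (m + n) u)
         + (if m = - n then lscale (of_int (m^3 - m) / 12 * c) u else 0)"
    proof (rule ext)
      fix k
      let ?e = "\<lambda>k n. \<delta> + of_int k + (of_int n + 1) * (1 - h12)"
      have tt: "twist m (twist n u) k = LB m (LB n (u k)) + sB (?e k n) (LB m (u (k + n)))
          + sB (?e k m) (LB n (u (k + m))) + sB (?e k m * ?e (k + m) n) (u (k + (m + n)))" for m n
        by (simp add: twist_def V2.L_add V2.L_scale V2.scale_right_distrib add.assoc)
      have ee: "?e k m * ?e (k + m) n - ?e k n * ?e (k + n) m = of_int (m - n) * ?e k (m + n)"
        by (simp add: algebra_simps)
      have "twist m (twist n u) k - twist n (twist m u) k
          = (LB m (LB n (u k)) - LB n (LB m (u k)))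
            + sB (?e k m * ?e (k + m) n - ?e k n * ?e (k + n) m) (u (k + (m + n)))"
        unfolding tt V2.scale_left_diff_distrib by (simp add: add.commute[of n m])
      then show "(twist m (twist n u) - twist n (twist m u)) k = (lscale (of_int (m - n)) (twist (m + n) u)
         + (if m = - n then lscale (of_int (m^3 - m) / 12 * c) u else 0)) k"
        unfolding ee V2.L_bracket
        by (simp add: lscale_def twist_def V2.scale_right_distrib)
    qed
  qed (simp_all add: F.subspace_UNIV)
qed

definition phi_series :: "int \<Rightarrow> 'b" where
  "phi_series m = (if m \<le> 0 then \<phi> (nat (- m)) else 0)"

text \<open>
  The cases \<open>n = 0, 1, 2\<close> are the weights of \<open>\<phi>\<^sub>N\<close> and its commutators with \<open>L\<^sub>1\<close> and \<open>L\<^sub>2\<close>;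
  the others follow since \<open>L\<^sub>1\<close> and \<open>L\<^sub>2\<close> generate all \<open>L\<^sub>n\<close> with \<open>n > 0\<close>.
\<close>

lemma twist_phi_series: "twist 0 phi_series = lscale h1 phi_series" "n > 0 \<Longrightarrow>
    twist n phi_series = 0"
proof -
  show "twist 0 phi_series = lscale h1 phi_series"
  proof (rule ext)
    fix m
    show "twist 0 phi_series m = lscale h1 phi_series m"
    proof (cases "m \<le> 0")
      case True
      then have "of_nat (nat (- m)) = (- of_int m :: complex)" by simp
      moreover have "(h2 - of_int m) + (\<delta> + of_int m + (1 - h12)) = h1"
        by (simp add: \<delta>_def leading_exponent_def)
      ultimately show ?thesis using True
        by (simp add: twist_def lscale_def phi_series_def L0_phi flip: V2.scale_left_distrib)
    qed (simp add: twist_def lscale_def phi_series_def V2.L_0)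
  qed
  have 1: "twist 1 phi_series = 0"
  proof (rule ext)
    fix m
    have "m < 0 \<Longrightarrow> m = - int (Suc (nat (- m - 1)))" by simp
    then consider "m > 0" | "m = 0" | K where "m = - int (Suc K)"
      using linorder_less_linear by blast
    then show "twist 1 phi_series m = 0 m"
    proof cases
      case 3
      have "of_nat K + (leading_exponent + 2 * h12) + (\<delta> + of_int m + 2 * (1 - h12)) = 0"
        by (simp add: 3 \<delta>_def)
      then show ?thesis
        by (simp add: twist_def phi_series_def 3 L1_phi(2) nat_add_distrib flip: V2.scale_left_distrib)
    qed (simp_all add: twist_def phi_series_def V2.L_0 L1_phi(1))
  qed
  have 2: "twist 2 phi_series = 0"
  proof (rule ext)
    fix m
    have "m < 0 \<Longrightarrow> m \<noteq> -1 \<Longrightarrow>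
        m = - int (Suc (Suc (nat (- m - 2))))" by simp
    then consider "m > 0" | "m = 0" | "m = -1" | K where "m = - int (Suc (Suc K))"
      using linorder_less_linear by blast
    then show "twist 2 phi_series m = 0 m"
    proof cases
      case 4
      have "of_nat K + (leading_exponent + 3 * h12) + (\<delta> + of_int m + 3 * (1 - h12)) = 0"
        by (simp add: 4 \<delta>_def)
      then show ?thesis
        by (simp add: twist_def phi_series_def 4 L2_phi(3) nat_add_distrib flip: V2.scale_left_distrib)
    qed (simp_all add: twist_def phi_series_def V2.L_0 L2_phi(1,2))
  qed
  interpret T: virasoro_action lscale UNIV twist c by (rule twist_action)
  show "twist n phi_series = 0" if "n > 0"
  proof -
    have "twist (int K + 1) phi_series = 0" for K
    proof (induction K)
      case (Suc K)
      show ?case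
      proof (cases "K = 0")
        case False
        have "twist (int K + 1) (twist 1 phi_series) - twist 1 (twist (int K + 1) phi_series)
            = lscale (of_int (int K)) (twist (int K + 2) phi_series)"
          using T.T_bracket[of phi_series "int K + 1" 1] by (simp add: add.commute)
        then have "lscale (of_nat K) (twist (int K + 2) phi_series) = 0"
          unfolding 1 Suc T.T_0 by simp
        then have "twist (int K + 2) phi_series = 0" using False
            by (simp only: T.scale_eq_0_iff of_nat_eq_0_iff simp_thms)
        then show ?thesis by (simp add: add.commute)
      qed (simp add: 2)
    qed (simp add: 1)
    from this[of "nat (n - 1)"] that show ?thesis by simp
  qed
qed

text \<open>
  Truncation is not part of the universal property; it spreads from \<open>v\<^sub>1\<close> to all of \<open>V\<^sub>1\<close> by
  generation.
\<close>

lemma psi_ex: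
  "\<exists>\<psi>. field \<psi> \<and> (\<forall>m. \<psi> m v1 = phi_series m) \<and>
     (\<forall>n m w. \<psi> m (LA n w) = LB n (\<psi> m w)
        + sB (\<delta> + of_int m + (of_int n + 1) * (1 - h12)) (\<psi> (m + n) w))"
proof -
  interpret T: virasoro_action lscale UNIV twist c by (rule twist_action)
  obtain f where f: "Vector_Spaces.linear sA lscale f" "\<And>n x. f (LA n x)
      = twist n (f x)" "f v1 = phi_series"
    by (rule T.verma_universal_property[OF V1.verma_module_axioms UNIV_I twist_phi_series]) auto
  interpret f: Vector_Spaces.linear sA lscale f by (rule f(1))
  have "field (\<lambda>m w. f w m)"
  proof (rule fieldI)
    fix w
    show "\<exists>N. \<forall>m\<ge>N. f w m = 0"
    proof (induction w rule: V1.generated_induct)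
      case gen
      show ?case by (intro exI[of _ 1]) (simp add: f(3) phi_series_def)
    next
      case (L n w)
      then obtain N where "\<forall>m\<ge>N. f w m = 0" by blast
      then show ?case
        by (intro exI[of _ "max N (N - n)"]) (simp add: f(2) twist_def V2.L_0)
    next
      case (add x y)
      then obtain N N' where "\<forall>m\<ge>N. f x m = 0" "\<forall>m\<ge>N'. f y m = 0" by blast
      then show ?case by (intro exI[of _ "max N N'"]) (simp add: f.add)
    next
      case (scale a x)
      then obtain N where "\<forall>m\<ge>N. f x m = 0" by blast
      then show ?case by (intro exI[of _ N]) (simp add: f.scale lscale_def)
    qed
  qed (simp_all add: f.add f.scale lscale_def)
  then show ?thesis
    by (intro exI[of _ "\<lambda>m w. f w m"]) (simp add: f(2,3) twist_def)
qed

definition \<psi> :: "int \<Rightarrow> 'a \<Rightarrow> 'b" where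
  "\<psi> = (SOME \<psi>. field \<psi> \<and> (\<forall>m. \<psi> m v1 = phi_series m) \<and>
     (\<forall>n m w. \<psi> m (LA n w) = LB n (\<psi> m w)
        + sB (\<delta> + of_int m + (of_int n + 1) * (1 - h12)) (\<psi> (m + n) w)))"

lemma psi_field: "field \<psi>"
  and psi_v1: "\<psi> m v1 = phi_series m"
  and psi_L: "\<psi> m (LA n w) = LB n (\<psi> m w)
        + sB (\<delta> + of_int m + (of_int n + 1) * (1 - h12)) (\<psi> (m + n) w)"
  using someI_ex[OF psi_ex] unfolding \<psi>_def[symmetric] by blast+

lemma psi_ad: "mode a 0 \<psi> m w
    = sB (of_int a * h12 - (\<delta> + of_int m + of_int a)) (\<psi> (m + a - 1) w)"
proof -
  have "mode a 0 \<psi> m w = - sB (\<delta> + of_int m + of_int a * (1 - h12)) (\<psi> (m + a - 1) w)"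
    by (simp add: mode_0 psi_L add_diff_eq)
  also have "\<dots> = sB (- (\<delta> + of_int m + of_int a * (1 - h12))) (\<psi> (m + a - 1) w)"
    by (simp only: V2.scale_minus_left)
  also have "- (\<delta> + of_int m + of_int a * (1 - h12))
      = of_int a * h12 - (\<delta> + of_int m + of_int a)"
    by (simp add: algebra_simps)
  finally show ?thesis .
qed

lemma psi_mode1: "mode a 1 \<psi> m w = sB h12 (\<psi> (m + a) w)"
  using mode_pascal[OF psi_field, of a 0 m w]
  by (simp add: psi_ad flip: V2.scale_left_diff_distrib) (simp add: algebra_simps)

text \<open>
  The commutator with \<open>\<psi>\<close> is a first order operator in \<open>f\<close>, so it vanishes when \<open>f\<close> has a double
  zero at \<open>x = z\<close>.
\<close>

lemma psi_mode_ge2: "n \<ge> 2 \<Longrightarrow> mode a n \<psi> m w = 0"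
proof (induction n arbitrary: a m rule: int_ge_induct)
  case base
  show ?case using mode_pascal[OF psi_field, of a 1 m w] by (simp add: psi_mode1 add_ac)
next
  case (step n)
  then show ?case by (simp add: mode_pascal[OF psi_field])
qed

lemma psi_local: "local_field \<psi>"
proof (rule localI[OF psi_field])
  show "\<exists>N. \<forall>n\<ge>N. \<forall>m w. mode 0 n \<psi> m w = 0" using psi_mode_ge2 by blast
  fix a m w
  have "B.csum (of_int a) (\<lambda>i. mode 0 (int i) \<psi> (m + a - int i) w)
      = (\<Sum>i<2. sB (of_int a gchoose i) (mode 0 (int i) \<psi> (m + a - int i) w))"
    by (rule B.csum_eq_sum) (simp add: psi_mode_ge2)
  also have "\<dots> = mode 0 0 \<psi> (m + a) w + sB (of_int a) (mode 0 1 \<psi> (m + a - 1) w)"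
    by (simp add: numeral_2_eq_2)
  also have "\<dots> = mode a 0 \<psi> m w"
    unfolding psi_ad psi_mode1 V2.scale_scale by (simp flip: V2.scale_left_distrib) 
  finally show "mode a 0 \<psi> m w
      = B.csum (of_int a) (\<lambda>i. mode 0 (int i) \<psi> (m + a - int i) w)" by simp
qed

lemma psi_covariant: "translation_covariant \<delta> \<psi>"
  by (simp add: translation_covariant_def psi_ad z_derivative_def)

definition \<chi> :: "int \<Rightarrow> 'a \<Rightarrow> 'b" where
  "\<chi> = mode 0 0 (mode 0 0 \<psi>) - fscale (1 / t) (mode 0 (-1) \<psi>)"

text \<open>
  For \<open>u\<^sub>m = X\<^sub>m v\<^sub>1\<close>, with \<open>X\<close> primary of weight \<open>h\<^bsub>1,2\<^esub>\<close>, this is the coefficient of index \<open>m\<close> in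
  \<open>(L\<^bsub>-1\<^esub>\<^sup>2 - t\<^bsup>-1\<^esup> L\<^bsub>-2\<^esub>) X\<close> applied to \<open>v\<^sub>1\<close>. It is stated for arbitrary \<open>u\<close> because it is needed
  both for \<open>\<psi>\<close> and for an unknown intertwining operator.
\<close>

definition null_defect :: "(int \<Rightarrow> 'b) \<Rightarrow> int \<Rightarrow> 'b" where
  "null_defect u m = sB ((\<delta> + of_int m) * (\<delta> + of_int m - 1)) (u (m - 2))
     - sB (1 / t) (Sum_any (\<lambda>i. LB (- 2 - int i) (u (m + int i))) + LB (-1) (u (m - 1))
         + sB (\<delta> + of_int m - 1 + h1) (u (m - 2)))"

lemma null_defect_pos:
  assumes "\<And>m. m > 0 \<Longrightarrow> u m = 0" and "m > 2"
  shows "null_defect u m = 0"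
proof -
  have "u (m + int i) = 0" "u (m - 1) = 0" "u (m - 2) = 0" for i
    using assms by simp_all
  then show ?thesis by (simp add: null_defect_def V2.L_0)
qed

lemma null_defect_recursion:
  assumes u: "\<And>m. m > 0 \<Longrightarrow> u m = 0"
  shows "null_defect u (2 - int N)
    = sB (1 / t) (sB (\<kappa> N) (u (- int N)) - (\<Sum>k<N. LB (int k - int N) (u (- int k))))"
proof -
  define m where "m = 2 - int N"
  have u2: "u (m - 2) = u (- int N)" by (simp add: m_def)
  have sum: "Sum_any (\<lambda>i. LB (- 2 - int i) (u (m + int i))) + LB (-1) (u (m - 1))
      = (\<Sum>k<N. LB (int k - int N) (u (- int k)))"
  proof (cases N)
    case 0
    then show ?thesis by (simp add: m_def u V2.L_0)
  next
    case (Suc K)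
    have "Sum_any (\<lambda>i. LB (- 2 - int i) (u (m + int i)))
        = (\<Sum>i<K. LB (- 2 - int i) (u (m + int i)))"
      by (rule B.Sum_any_eq_sum) (auto simp: m_def Suc u V2.L_0)
    also have "\<dots> = (\<Sum>i<K. LB (int (K - Suc i) - int N) (u (- int (K - Suc i))))"
    proof (rule sum.cong[OF refl])
      fix i assume "i \<in> {..<K}"
      then have "int (K - Suc i) = int K - int i - 1" by (auto simp: of_nat_diff)
      then have "- 2 - int i = int (K - Suc i) - int N" "m + int i = - int (K - Suc i)"
        by (simp_all add: m_def Suc)
      then show "LB (- 2 - int i) (u (m + int i)) = LB (int (K - Suc i) - int N) (u (- int (K - Suc i)))"
        by (simp only:)
    qed
    also have "\<dots> = (\<Sum>k<K. LB (int k - int N) (u (- int k)))"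
      by (rule sum.nat_diff_reindex)
    finally show ?thesis by (simp add: Suc m_def)
  qed
  have "(\<delta> + of_int m) * (\<delta> + of_int m - 1)
      = 1 / t * (\<kappa> N + (\<delta> + of_int m - 1 + h1))"
    using t unfolding kappa_indicial[symmetric] by (simp add: \<delta>_def m_def field_simps)
  then have "sB ((\<delta> + of_int m) * (\<delta> + of_int m - 1)) (u (- int N))
      = sB (1 / t) (sB (\<kappa> N) (u (- int N)) + sB (\<delta> + of_int m - 1 + h1) (u (- int N)))"
    by (simp only: V2.scale_left_distrib V2.scale_scale[symmetric])
  then show ?thesis
    unfolding m_def[symmetric] null_defect_def sum u2
    by (simp only: V2.scale_right_diff_distrib[symmetric]) simp
qed

text \<open>
  Evaluating the iterate formula at \<open>v\<^sub>1\<close> leaves, on the right, only the modes \<open>L\<^bsub>-1\<^esub>\<close> and \<open>L\<^sub>0\<close>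
  on \<open>v\<^sub>1\<close>, so that the recursion for \<open>\<phi>\<close> can be used.
\<close>

lemma chi_v1: "\<chi> m v1 = 0"
proof -
  have 1: "mode 0 0 (mode 0 0 \<psi>) m v1
      = sB ((\<delta> + of_int m) * (\<delta> + of_int m - 1)) (phi_series (m - 2))"
  proof -
    have "mode 0 0 (mode 0 0 \<psi>) m v1 = z_derivative \<delta> (mode 0 0 \<psi>) m v1"
      using translation_covariant_mode[OF psi_field psi_covariant] by (simp add: translation_covariant_def)
    also have "\<dots> = sB (- (\<delta> + of_int m) * - (\<delta> + of_int m - 1)) (phi_series (m - 2))"
    proof -
      have "0 - (\<delta> + of_int (m - 1) + 0) = - (\<delta> + of_int m - 1)" "m - 1 - 1
          = m - 2" by simp_all
      then show ?thesis by (simp only: z_derivative_def psi_ad psi_v1 V2.scale_scale of_int_0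
          mult_zero_left add_0_right)
    qed
    finally show ?thesis by (simp only: minus_mult_minus)
  qed
  have l: "lft 0 (-1) \<psi> m v1 = Sum_any (\<lambda>i. LB (- 2 - int i) (phi_series (m + int i)))"
    by (simp add: lft_def B.bsum_neg1 psi_v1)
  have r: "rgt 0 (-1) \<psi> m v1
      = - (LB (-1) (phi_series (m - 1)) + sB (\<delta> + of_int m - 1 + h1) (phi_series (m - 2)))"
  proof -
    have "rgt 0 (-1) \<psi> m v1 = - Sum_any (\<lambda>i. \<psi> (m - 1 - int i) (LA (int i - 1) v1))"
      by (simp add: rgt_def B.bsum_neg1)
    also have "Sum_any (\<lambda>i. \<psi> (m - 1 - int i) (LA (int i - 1) v1))
        = (\<Sum>i<2. \<psi> (m - 1 - int i) (LA (int i - 1) v1))"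
      by (rule B.Sum_any_eq_sum) (simp add: V1.L_pos_v field_0[OF psi_field])
    also have "\<dots> = LB (-1) (phi_series (m - 1)) + sB (\<delta> + of_int m - 1
        + h1) (phi_series (m - 2))"
    proof -
      have "sB (\<delta> + of_int m - 1 + h1) (phi_series (m - 2))
          = sB (\<delta> + of_int m - 1) (phi_series (m - 2)) + sB h1 (phi_series (m - 2))"
        by (simp only: V2.scale_left_distrib)
      then show ?thesis
        by (simp add: numeral_2_eq_2 psi_L[of _ "-1"] psi_v1 V1.L0_v field_scale[OF psi_field]
            add.assoc add_diff_eq)
    qed
    finally show ?thesis .
  qed
  have "mode 0 (-1) \<psi> m v1 = lft 0 (-1) \<psi> m v1 - rgt 0 (-1) \<psi> m v1"
    by (simp add: mode_def)
  then have chi: "\<chi> m v1 = null_defect phi_series m"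
    by (simp add: \<chi>_def fscale_def 1 l r null_defect_def add.assoc)
  show ?thesis
  proof (cases "m \<le> 2")
    case False
    then show ?thesis unfolding chi by (intro null_defect_pos) (auto simp: phi_series_def)
  next
    case True
    define N where "N = nat (2 - m)"
    have m: "m = 2 - int N" using True by (simp add: N_def)
    have "null_defect phi_series m = 0"
      unfolding m by (subst null_defect_recursion) (simp_all add: phi_series_def phi_rec)
    then show ?thesis by (simp add: chi)
  qed
qed

lemma psi_lowest:
  "mode 0 1 \<psi> = fscale h12 \<psi>" "n > 0 \<Longrightarrow> mode 0 (n + 1) \<psi> = 0"
  by (simp_all add: fun_eq_iff fscale_def psi_mode1 psi_mode_ge2)

text \<open>
  Both reasons for \<open>\<chi> = 0\<close> meet here: singularity makes it primary, and the recursion makes it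
  kill \<open>v\<^sub>1\<close>.
\<close>

lemma chi_eq_0: "\<chi> = 0"
proof -
  interpret F: virasoro_action fscale "{X. local_field X \<and> translation_covariant \<delta> X}"
      "\<lambda>n. mode 0 (n + 1)" c
    by (rule fields_action)
  have S: "\<psi> \<in> {X. local_field X \<and> translation_covariant \<delta> X}" using psi_local
      psi_covariant by simp
  note chi = F.singular_vector[OF S _ _ t c h12_def, simplified, folded \<chi>_def, OF psi_lowest]
  have "mode 0 0 (mode 0 0 \<psi>) \<in> {X. local_field X \<and> translation_covariant \<delta> X}"
    "mode 0 (-1) \<psi> \<in> {X. local_field X \<and> translation_covariant \<delta> X}"
    using F.T_closed[OF F.T_closed[OF S, of "-1"], of "-1"] F.T_closed[OF S, of "-2"] by simp_all
  then have "\<chi> \<in> {X. local_field X \<and> translation_covariant \<delta> X}"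
    unfolding \<chi>_def by (intro F.subspace_diff[OF F.subspace_S] F.subspace_scale[OF F.subspace_S])
  moreover have "mode 0 n \<chi> = 0" if "n \<ge> 2" for n
    using chi(2)[of "n - 1"] that by simp
  ultimately have "\<chi> m w = 0" for m w
    by (intro primary_eq_0[OF _ _ chi(1) _ V1.lowest_weight_module_axioms chi_v1]) auto
  then show ?thesis by (simp add: fun_eq_iff)
qed

end

section \<open>Existence of the intertwining operator\<close>

locale fusion_setting =
  fusion_data sA LA c h1 v1 sB LB h2 v2 t s +
  V12: verma_module sV LV c "- 1 / 2 + 3 / (4 * t)" v12 +
  Q: virasoro_quotient sV LV sK LK c
    "{LV (-1) (LV (-1) v12) - sV (1 / t) (LV (-2) v12)}" \<pi>
  for sA :: "complex \<Rightarrow> 'a::ab_group_add \<Rightarrow> 'a" and LA c h1 v1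
    and sB :: "complex \<Rightarrow> 'b::ab_group_add \<Rightarrow> 'b" and LB h2 v2 t s
    and sV :: "complex \<Rightarrow> 'v::ab_group_add \<Rightarrow> 'v" and LV v12
    and sK :: "complex \<Rightarrow> 'k::ab_group_add \<Rightarrow> 'k" and LK \<pi>
begin

sublocale K: lowest_weight_module sK LK c h12 "\<pi> v12"
  unfolding h12_def by (rule Q.lowest_weight_quotient[OF V12.lowest_weight_module])

sublocale K: Vc_module sK LK c
  by (rule K.Vc_module)

lemma K_null_vector: "LK (-1) (LK (-1) (\<pi> v12)) = sK (1 / t) (LK (-2) (\<pi> v12))"
proof -
  interpret p: Vector_Spaces.linear sV sK \<pi> by (rule Q.linear_proj)
  have "LV (-1) (LV (-1) v12) - sV (1 / t) (LV (-2) v12) \<in> {x. \<pi> x = 0}"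
    unfolding Q.ker_proj V12.generated_submodule_def by blast
  then show ?thesis by (simp add: p.diff p.scale Q.proj_L)
qed

text \<open>
  The homomorphism from the Verma module to local fields that takes the generator to \<open>\<psi>\<close> takes
  the singular vector to \<open>\<chi> = 0\<close>, so it factors through \<open>K\<^bsub>1,2\<^esub>\<close>.
\<close>

lemma field_map_ex:
  "\<exists>field_map. Vector_Spaces.linear sK fscale field_map \<and> (\<forall>n x. field_map
      (LK n x) = mode 0 (n + 1) (field_map x)) \<and>
     field_map (\<pi> v12) = \<psi> \<and> (\<forall>x. local_field
         (field_map x) \<and> translation_covariant \<delta> (field_map x))"
proof -
  interpret F: virasoro_action fscale "{X. local_field X \<and> translation_covariant \<delta> X}"
      "\<lambda>n. mode 0 (n + 1)" c
    by (rule fields_action)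
  interpret p: Vector_Spaces.linear sV sK \<pi> by (rule Q.linear_proj)
  obtain g where g: "Vector_Spaces.linear sV fscale g" "\<And>n x. g (LV n x) = mode 0 (n + 1) (g x)"
    "g v12 = \<psi>" "\<And>x. g x \<in> {X. local_field X \<and> translation_covariant \<delta> X}"
  proof (rule F.verma_universal_property[OF V12.verma_module_axioms, of \<psi>])
    show "\<psi> \<in> {X. local_field X \<and> translation_covariant \<delta> X}" using psi_local
        psi_covariant by simp
    show "mode 0 (0 + 1) \<psi> = fscale (- 1 / 2 + 3 / (4 * t)) \<psi>" using psi_lowest(1)
        by (simp add: h12_def)
    show "mode 0 (n + 1) \<psi> = 0" if "n > 0" for n by (rule psi_lowest(2)[OF that])
  qed blast
  interpret g: Vector_Spaces.linear sV fscale g by (rule g(1))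
  let ?ker = "{x. g x = 0}"
  have "V12.subspace ?ker"
    by (auto simp: V12.subspace_def g.add g.scale g.zero)
  moreover have "\<forall>n. \<forall>w\<in>?ker. LV n w \<in> ?ker"
    using F.T_0 by (simp add: g(2))
  moreover have "g (LV (-1) (LV (-1) v12) - sV (1 / t) (LV (-2) v12)) = 0"
    using chi_eq_0 by (simp add: g.diff g.scale g(2,3) \<chi>_def)
  ultimately have "V12.generated_submodule {LV (-1) (LV (-1) v12)
      - sV (1 / t) (LV (-2) v12)} \<subseteq> ?ker"
    unfolding V12.generated_submodule_def by (intro Inter_lower) simp
  then have ker: "g x = 0" if "\<pi> x = 0" for x
    using that Q.ker_proj by blast
  define field_map where "field_map k = g (inv \<pi> k)" for k
  have field_map: "field_map (\<pi> x) = g x" for x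
  proof -
    have "\<pi> (inv \<pi> (\<pi> x) - x) = 0" using Q.surj_proj by (simp add: p.diff surj_f_inv_f)
    from ker[OF this] show ?thesis by (simp add: field_map_def g.diff)
  qed
  have ex: "\<exists>x. k = \<pi> x" for k using Q.surj_proj by blast
  show ?thesis
  proof (intro exI[of _ field_map] conjI allI)
    show "Vector_Spaces.linear sK fscale field_map"
    proof unfold_locales
      fix x y a
      obtain x' y' where [simp]: "x = \<pi> x'" "y = \<pi> y'" using ex by blast
      show "field_map (x + y) = field_map x + field_map y" by (simp add: field_map g.add flip: p.add)
      show "field_map (sK a x) = fscale a (field_map x)" by (simp add: field_map g.scale flip: p.scale)
    qed
    show "field_map (LK n x) = mode 0 (n + 1) (field_map x)" for n x
      using ex[of x] by (auto simp: field_map g(2) simp flip: Q.proj_L)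
    show "field_map (\<pi> v12) = \<psi>" by (simp add: field_map g(3))
    show "local_field (field_map x)" "translation_covariant \<delta> (field_map x)" for x
      using ex[of x] g(4) by (auto simp: field_map)
  qed
qed

definition field_map :: "'k \<Rightarrow> int \<Rightarrow> 'a \<Rightarrow> 'b" where
  "field_map = (SOME field_map. Vector_Spaces.linear sK fscale field_map \<and>
      (\<forall>n x. field_map (LK n x) = mode 0 (n + 1) (field_map x)) \<and>
     field_map (\<pi> v12) = \<psi> \<and> (\<forall>x. local_field
         (field_map x) \<and> translation_covariant \<delta> (field_map x)))"

lemma field_map_linear: "Vector_Spaces.linear sK fscale field_map"
  and field_map_L: "field_map (LK n x) = mode 0 (n + 1) (field_map x)"
  and field_map_generator: "field_map (\<pi> v12) = \<psi>"
  and field_map_local: "local_field (field_map x)"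
  and field_map_covariant: "translation_covariant \<delta> (field_map x)"
  using someI_ex[OF field_map_ex] unfolding field_map_def[symmetric] by blast+

lemma field_map_field: "field (field_map x)"
  by (rule local_imp_field[OF field_map_local])

text \<open>
  Nonzero coefficients occur only without logarithms and at exponents in one coset of \<open>\<int>\<close>; the
  index \<open>m\<close> is recovered from \<open>h = \<delta> + m\<close>.
\<close>

definition intertwiner :: "complex \<Rightarrow> nat \<Rightarrow> 'k \<Rightarrow> 'a
    \<Rightarrow> 'b" where
  "intertwiner h k x w = (if k = 0 \<and> (\<exists>m. h
      = \<delta> + of_int m) then field_map x (THE m. h = \<delta> + of_int m) w else 0)"

lemma intertwiner_eq: "intertwiner (\<delta> + of_int m) 0 x w = field_map x m w"
  by (auto simp: intertwiner_def)

lemma intertwiner_0: "k \<noteq> 0 \<Longrightarrow>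
    intertwiner h k x w = 0" "(\<And>m. h \<noteq> \<delta> + of_int m) \<Longrightarrow>
    intertwiner h k x w = 0"
  by (auto simp: intertwiner_def)

lemma intertwiner_cases:
  obtains m where "h = \<delta> + of_int m" "k
      = 0" "\<And>n x w. intertwiner (h + of_int n) k x w = field_map x (m + n) w"
  | "\<And>n x w. intertwiner (h + of_int n) k x w = 0"
proof (cases "k = 0 \<and> (\<exists>m. h = \<delta> + of_int m)")
  case True
  then obtain m where m: "h = \<delta> + of_int m" "k = 0" by blast
  show thesis
  proof (rule that(1)[OF m])
    show "intertwiner (h + of_int n) k x w = field_map x (m + n) w" for n x w
      using intertwiner_eq[of "m + n"] by (simp add: m add.assoc)
  qed
next
  case False
  have "intertwiner (h + of_int n) k x w = 0" for n x w
  proof (cases "k = 0")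
    case True
    with False have "h + of_int n \<noteq> \<delta> + of_int m" for m
      by (metis add_diff_cancel_right' add_diff_eq of_int_diff)
    then show ?thesis by (rule intertwiner_0(2))
  qed (rule intertwiner_0(1))
  then show thesis by (rule that(2))
qed

text \<open>
  The iterate formula is the definition of the modes on fields, the commutator formula is
  locality, and the derivative formula is translation covariance.
\<close>

lemma intertwining_operator_intertwiner: "intertwining_operator sK LK sA LA sB LB c intertwiner"
proof -
  interpret Gl: Vector_Spaces.linear sK fscale field_map by (rule field_map_linear)
  have add0: "h = h + of_int 0" for h :: complex by simp
  have zero_lin: "Vector_Spaces.linear sA sB (\<lambda>_. 0)" "Vector_Spaces.linear sK sB (\<lambda>_. 0)"
    by unfold_locales simp_all
  show ?thesis
  proof (intro intertwining_operator.intro intertwining_operator_axioms.intro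
      K.Vc_module_axioms V1.Vc_module_axioms V2.Vc_module_axioms)
    fix h :: complex and k :: nat and w1 w2
    show "\<exists>K. \<forall>k>K. \<forall>h w2. intertwiner h k w1 w2 = 0"
      by (intro exI[of _ 0]) (simp add: intertwiner_0(1))
    show "Vector_Spaces.linear sK sB (\<lambda>w1. intertwiner h k w1 w2)"
    proof (cases rule: intertwiner_cases[of h k])
      case (1 m)
      have "Vector_Spaces.linear sK sB (\<lambda>w1. field_map w1 m w2)"
        by unfold_locales (simp_all add: Gl.add Gl.scale fscale_def)
      then show ?thesis using 1(3)[of 0] by simp
    next
      case 2
      then show ?thesis using zero_lin(2) 2[of 0] by simp
    qed
    show "Vector_Spaces.linear sA sB (\<lambda>w2. intertwiner h k w1 w2)"
    proof (cases rule: intertwiner_cases[of h k])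
      case (1 m)
      then show ?thesis using 1(3)[of 0] field_map_field[of w1] by (simp add: field_def)
    next
      case 2
      then show ?thesis using zero_lin(1) 2[of 0] by simp
    qed
    show "\<exists>N. \<forall>n\<ge>N. \<forall>k. intertwiner (h + of_int n) k w1 w2 = 0"
    proof (cases rule: intertwiner_cases[of h 0])
      case (1 m)
      obtain N where "\<forall>m\<ge>N. field_map w1 m w2
          = 0" using field_truncated[OF field_map_field] by blast
      then have "intertwiner (h + of_int n) k w1 w2 = 0" if "n \<ge> N - m" for n k
        using that 1(3)[of n w1 w2] by (cases "k = 0") (auto simp: intertwiner_0(1))
      then show ?thesis by blast
    next
      case 2
      then have "intertwiner (h + of_int n) k w1 w2 = 0" for n k
        by (cases "k = 0") (auto simp: intertwiner_0(1))
      then show ?thesis by blast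
    qed
    fix n
    show "LB n (intertwiner h k w1 w2) = intertwiner h k w1 (LA n w2)
         + Sum_any (\<lambda>i::nat. sB (of_int (n + 1) gchoose i)
             (intertwiner (h + of_int (n + 1 - int i)) k (LK (int i - 1) w1) w2))"
    proof (cases rule: intertwiner_cases[of h k])
      case (1 m)
      have "mode (n + 1) 0 (field_map w1) m w2
          = B.csum (of_int (n + 1)) (\<lambda>i. mode 0 (int i) (field_map w1) (m + (n + 1) - int i) w2)"
        using local_expansion[OF field_map_local, of "n + 1" 0] by simp
      then have "LB n (field_map w1 m w2) - field_map w1 m (LA n w2)
          = Sum_any (\<lambda>i. sB (of_int (n + 1) gchoose i) (field_map (LK (int i - 1) w1) (m
              + (n + 1 - int i)) w2))"
        unfolding B.csum_def mode_0 by (simp add: field_map_L add_diff_eq)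
      moreover have "intertwiner h k x w = field_map x m w" for x w using 1(3)[of 0] by simp
      ultimately show ?thesis unfolding 1(3) by (simp only: diff_eq_eq add.commute)
    next
      case 2
      moreover have "intertwiner h k x w = 0" for x w using 2[of 0] by simp
      ultimately show ?thesis by (simp only: V2.L_0 V2.scale_zero_right add_0_left) simp
    qed
    show "intertwiner h k (LK n w1) w2
        = Sum_any (\<lambda>i::nat. sB ((-1) ^ i * (of_int (n + 1) gchoose i))
           (LB (n - int i) (intertwiner (h + of_nat i) k w1 w2)
            + sB ((-1) powi n) (intertwiner (h + of_int (n + 1 - int i)) k w1 (LA (int i - 1) w2))))"
    proof (cases rule: intertwiner_cases[of h k])
      case (1 m)
      have f: "B.finsupp (\<lambda>i. LB (n - int i) (field_map w1 (m + int i) w2))"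
        "B.finsupp (\<lambda>i. field_map w1 (m + (n + 1) - int i) (LA (0 + int i - 1) w2))"
        by (intro finsupp_lft' finsupp_rgt' field_map_field)+
      have "field_map (LK n w1) m w2
          = B.bsum (of_int (n + 1)) (\<lambda>i. LB (n - int i) (field_map w1 (m + int i) w2))
          + sB ((-1) powi n) (B.bsum (of_int (n + 1)) (\<lambda>i. field_map w1 (m + (n
              + 1) - int i) (LA (0 + int i - 1) w2)))"
        by (simp add: field_map_L mode_def lft_def rgt_def power_int_add)
      also have "\<dots> = B.bsum (of_int (n + 1)) (\<lambda>i. LB (n - int i) (field_map w1 (m + int i) w2)
          + sB ((-1) powi n) (field_map w1 (m + (n + 1) - int i) (LA (0 + int i - 1) w2)))"
        by (simp only: B.bsum_add B.bsum_scale B.finsupp_scale f)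
      moreover have "intertwiner h k x w = field_map x m w" "intertwiner (h + of_nat i) k x w
          = field_map x (m + int i) w" for x w i
        using 1(3)[of 0] 1(3)[of "int i"] by simp_all
      ultimately show ?thesis
        unfolding 1(3) B.bsum_def by (simp only: add_diff_eq add_0_left)
    next
      case 2
      moreover have "intertwiner h k x w = 0" "intertwiner (h + of_nat i) k x w = 0" for x w i
        using 2[of 0] 2[of "int i"] by simp_all
      ultimately show ?thesis
        by (simp only: V2.L_0 V2.scale_zero_right add_0_left) simp
    qed
    show "intertwiner h k (LK (-1) w1) w2 = sB (- h) (intertwiner (h - 1) k w1 w2)
         + sB (of_nat (k + 1)) (intertwiner (h - 1) (k + 1) w1 w2)"
    proof (cases rule: intertwiner_cases[of h k])
      case (1 m)
      have "field_map (LK (-1) w1) m w2 = sB (- h) (field_map w1 (m - 1) w2)"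
        using field_map_covariant[of w1]
            by (simp add: field_map_L translation_covariant_def z_derivative_def 1(1))
      then show ?thesis using 1(3)[of 0] 1(3)[of "-1"] by (simp add: intertwiner_0(1))
    next
      case 2
      then show ?thesis using 2[of 0] 2[of "-1"] by (simp add: intertwiner_0(1))
    qed
  qed
qed

section \<open>Surjectivity and uniqueness\<close>

lemma delta_eq: "\<delta> = h1 + h12 - h2 - 1"
  by (simp add: \<delta>_def leading_exponent_def)

lemma span_mem_Sum_any:
  fixes Z :: "nat \<Rightarrow> 'b"
  assumes "\<And>i. Z i \<in> V2.span S"
  shows "Sum_any Z \<in> V2.span S"
proof (cases "finite {i. Z i \<noteq> 0}")
  case True
  then show ?thesis unfolding Sum_any.expand_set using assms by (intro V2.span_sum)
next
  case False
  then show ?thesis unfolding Sum_any.expand_set by (simp add: V2.span_zero)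
qed

text \<open>
  By the commutator formula the span of the coefficients is a submodule, and it contains
  \<open>\<psi>\<^sub>0 v\<^sub>1 = v\<^sub>2\<close>.
\<close>

lemma surjective_intertwiner: "surjective_intertwining_operator sK LK sA LA sB LB c intertwiner"
proof -
  interpret Y: intertwining_operator sK LK sA LA sB LB c intertwiner
      by (rule intertwining_operator_intertwiner)
  let ?S = "{intertwiner h k w1 w2 | h k w1 w2. True}"
  have Y_in: "intertwiner h k w1 w2 \<in> V2.span ?S" for h k w1 w2
    by (intro V2.span_base) blast
  have "V2.span ?S = UNIV"
  proof (rule V2.generated)
    have v2: "intertwiner (\<delta> + of_int 0) 0 (\<pi> v12) v1 = v2"
      unfolding intertwiner_eq field_map_generator psi_v1 by (simp add: phi_series_def phi_0)
    show "v2 \<in> V2.span ?S"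
      using Y_in[of "\<delta> + of_int 0" 0 "\<pi> v12" v1] unfolding v2 .
    fix n w assume "w \<in> V2.span ?S"
    then show "LB n w \<in> V2.span ?S"
    proof (induction rule: V2.span_induct_alt)
      case base
      then show ?case by (simp add: V2.L_0 V2.span_zero)
    next
      case (step a x y)
      then obtain h k w1 w2 where "x = intertwiner h k w1 w2" by blast
      have "LB n (intertwiner h k w1 w2) \<in> V2.span ?S"
        by (subst Y.commutator_formula) (intro V2.span_add span_mem_Sum_any V2.span_scale Y_in)
      then have "LB n x \<in> V2.span ?S" by (simp only: \<open>x = intertwiner h k w1 w2\<close>)
      with step show ?case by (simp add: V2.L_add V2.L_scale V2.span_add V2.span_scale)
    qed
  qed simp
  then show ?thesis
    by (intro surjective_intertwining_operator.intro intertwining_operator_intertwiner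
        surjective_intertwining_operator_axioms.intro)
qed

text \<open>
  Only \<open>L\<^bsub>-1\<^esub>\<close> and \<open>L\<^sub>0\<close> contribute for a lowest weight vector; the first is rewritten by the
  derivative formula, which brings in the next power of the logarithm.
\<close>

lemma primary_commutator_general:
  assumes "intertwining_operator sK LK sA LA sB LB c Y"
  shows "LB n (Y h k (\<pi> v12) w) = Y h k (\<pi> v12) (LA n w)
    + (sB (of_int (n + 1) * h12 - (h + of_int (n + 1))) (Y (h + of_int n) k (\<pi> v12) w)
       + sB (of_nat (k + 1)) (Y (h + of_int n) (k + 1) (\<pi> v12) w))"
proof -
  interpret Y: intertwining_operator sK LK sA LA sB LB c Y by (rule assms)
  interpret yl: Vector_Spaces.linear sK sB "\<lambda>w1. Y h' k' w1 w'" for h' k' w' by (rule Y.linear_left)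
  let ?Z = "\<lambda>i. Y (h + of_int (n + 1 - int i)) k (LK (int i - 1) (\<pi> v12)) w"
  have "Sum_any (\<lambda>i. sB (of_int (n + 1) gchoose i) (?Z i))
      = (\<Sum>i<2. sB (of_int (n + 1) gchoose i) (?Z i))"
    by (rule B.Sum_any_eq_sum) (simp add: K.L_pos_v yl.zero)
  also have "\<dots> = ?Z 0 + sB (of_int (n + 1)) (sB h12 (Y (h + of_int n) k (\<pi> v12) w))"
    by (simp add: numeral_2_eq_2 K.L0_v yl.scale)
  also have "?Z 0 = sB (- (h + of_int (n + 1))) (Y (h + of_int n) k (\<pi> v12) w)
       + sB (of_nat (k + 1)) (Y (h + of_int n) (k + 1) (\<pi> v12) w)"
    using Y.derivative_formula[of "h + of_int (n + 1)" k "\<pi> v12" w]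
    by (simp add: diff_add_eq add_diff_eq)
  finally have sum: "Sum_any (\<lambda>i. sB (of_int (n + 1) gchoose i) (?Z i))
      = sB (- (h + of_int (n + 1))) (Y (h + of_int n) k (\<pi> v12) w)
         + sB (of_nat (k + 1)) (Y (h + of_int n) (k + 1) (\<pi> v12) w)
         + sB (of_int (n + 1)) (sB h12 (Y (h + of_int n) k (\<pi> v12) w))" .
  have "sB (e * h12 - d) x = sB (- d) x + sB e (sB h12 x)" for e d x
    by (simp add: V2.scale_left_diff_distrib)
  then have sum': "Sum_any (\<lambda>i. sB (of_int (n + 1) gchoose i) (?Z i))
      = sB (of_int (n + 1) * h12 - (h + of_int (n + 1))) (Y (h + of_int n) k (\<pi> v12) w)
       + sB (of_nat (k + 1)) (Y (h + of_int n) (k + 1) (\<pi> v12) w)"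
    unfolding sum by (simp only: add_ac)
  show ?thesis using Y.commutator_formula[of n h k "\<pi> v12" w] unfolding sum' .
qed

text \<open>
  Induct first over \<open>V\<^sub>1\<close>, by the commutator formula with the lowest weight vector of \<open>K\<^bsub>1,2\<^esub>\<close>,
  and then over \<open>K\<^bsub>1,2\<^esub>\<close>, by the iterate formula.
\<close>

lemma intertwining_determined:
  assumes Y: "intertwining_operator sK LK sA LA sB LB c Y"
    and Y': "intertwining_operator sK LK sA LA sB LB c Y'"
    and eq: "\<And>h k. Y' h k (\<pi> v12) v1 = sB a (Y h k (\<pi> v12) v1)"
  shows "Y' h k x w = sB a (Y h k x w)"
proof -
  interpret Y: intertwining_operator sK LK sA LA sB LB c Y by (rule Y)
  interpret Y': intertwining_operator sK LK sA LA sB LB c Y' by (rule Y')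
  interpret yl: Vector_Spaces.linear sK sB "\<lambda>w1. Y h' k' w1 w'" for h' k' w' by (rule Y.linear_left)
  interpret yl': Vector_Spaces.linear sK sB "\<lambda>w1. Y' h' k' w1 w'" for h' k' w'
      by (rule Y'.linear_left)
  interpret yr: Vector_Spaces.linear sA sB "\<lambda>w. Y h' k' w1 w" for h' k' w1 by (rule Y.linear_right)
  interpret yr': Vector_Spaces.linear sA sB "\<lambda>w. Y' h' k' w1 w" for h' k' w1
      by (rule Y'.linear_right)
  have gen_eq: "Y' h k (\<pi> v12) w = sB a (Y h k (\<pi> v12) w)" for h k w
  proof (induction w arbitrary: h k rule: V1.generated_induct)
    case gen
    show ?case by (rule eq)
  next
    case (L n w)
    have "LB n (sB a (Y h k (\<pi> v12) w)) = Y' h k (\<pi> v12) (LA n w)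
      + (sB (of_int (n + 1) * h12 - (h + of_int (n + 1))) (sB a (Y (h + of_int n) k (\<pi> v12) w))
         + sB (of_nat (k + 1)) (sB a (Y (h + of_int n) (k + 1) (\<pi> v12) w)))"
      using primary_commutator_general[OF Y', of n h k w] unfolding L .
    moreover have "LB n (sB a (Y h k (\<pi> v12) w)) = sB a (Y h k (\<pi> v12) (LA n w))
      + (sB (of_int (n + 1) * h12 - (h + of_int (n + 1))) (sB a (Y (h + of_int n) k (\<pi> v12) w))
         + sB (of_nat (k + 1)) (sB a (Y (h + of_int n) (k + 1) (\<pi> v12) w)))"
      unfolding V2.L_scale primary_commutator_general[OF Y, of n h k w]
      by (simp only: V2.scale_right_distrib V2.scale_left_commute[of a])
    ultimately show ?case by simp
  next
    case (add x y)
    then show ?case by (simp add: yr.add yr'.add V2.scale_right_distrib)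
  next
    case (scale e x)
    then show ?case by (simp add: yr.scale yr'.scale mult.commute)
  qed
  show ?thesis
  proof (induction x arbitrary: h k w rule: K.generated_induct)
    case gen
    show ?case by (rule gen_eq)
  next
    case (L n x)
    show ?case
      by (subst Y'.iterate_formula, subst Y.iterate_formula)
        (simp only: L B.Sum_any_scale[symmetric] V2.L_scale V2.scale_right_distrib
          V2.scale_left_commute[of a])
  next
    case (add x y)
    then show ?case by (simp add: yl.add yl'.add V2.scale_right_distrib)
  next
    case (scale e x)
    then show ?case by (simp add: yl.scale yl'.scale mult.commute)
  qed
qed

text \<open>
  The commutator with \<open>L\<^sub>0\<close> turns the coefficients of \<open>1, log z, (log z)\<^sup>2, \<dots>\<close> into a Jordan
  chain for \<open>L\<^sub>0\<close>. Such a chain has length one because \<open>L\<^sub>0\<close> is semisimple on \<open>V\<^sub>2\<close>.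
\<close>

lemma intertwining_no_logs:
  assumes Y: "intertwining_operator sK LK sA LA sB LB c Y"
  shows "LB 0 (Y h 0 (\<pi> v12) v1) = sB (h1 + h12 - h - 1) (Y h 0 (\<pi> v12) v1)"
    and "k > 0 \<Longrightarrow> Y h k (\<pi> v12) v1 = 0"
proof -
  interpret Y: intertwining_operator sK LK sA LA sB LB c Y by (rule Y)
  interpret yr: Vector_Spaces.linear sA sB "\<lambda>w. Y h' k' w1 w" for h' k' w1 by (rule Y.linear_right)
  define \<mu> where "\<mu> = h1 + h12 - h - 1"
  define u where "u k = Y h k (\<pi> v12) v1" for k
  have rec: "LB 0 (u k) - sB \<mu> (u k) = sB (of_nat (k + 1)) (u (k + 1))" for k
  proof -
    have "LB 0 (u k) = (sB h1 (u k) + sB (h12 - (h + 1)) (u k)) + sB (of_nat (k + 1)) (u (k + 1))"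
      using primary_commutator_general[OF Y, of 0 h k v1]
      by (simp only: u_def V1.L0_v yr.scale of_int_0 add_0_right add_0_left of_int_1 mult_1 add.assoc)
    also have "sB h1 (u k) + sB (h12 - (h + 1)) (u k) = sB (h1 + (h12 - (h + 1))) (u k)"
      by (simp only: V2.scale_left_distrib)
    also have "h1 + (h12 - (h + 1)) = \<mu>" by (simp add: \<mu>_def)
    finally show ?thesis by simp
  qed
  obtain K where K: "\<And>k. k > K \<Longrightarrow>
      u k = 0" using Y.log_polynomial unfolding u_def by blast
  \<comment> \<open>The last nonzero coefficient of a chain of length at least two would be preceded by a
    generalized eigenvector that is not an eigenvector.\<close>
  have step: "u (Suc k) = 0" if "u (Suc (Suc k)) = 0" for k
  proof -
    have "LB 0 (u (Suc k)) - sB \<mu> (u (Suc k)) = 0" using rec[of "Suc k"] that by simp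
    then have "((\<lambda>x. LB 0 x - sB \<mu> x) ^^ 2) (u k) = 0"
      by (simp add: numeral_2_eq_2 rec[of k, simplified] V2.L_scale V2.scale_left_commute[of \<mu>]
          flip: V2.scale_right_diff_distrib del: of_nat_Suc V2.scale_scale)
    then have "u k \<in> V2.generalized_eigenspace \<mu>"
      unfolding V2.generalized_eigenspace_def by blast
    then have "LB 0 (u k) = sB \<mu> (u k)" by (rule V2.generalized_eigenvector_L0)
    then have "sB (of_nat (k + 1)) (u (k + 1)) = 0" using rec[of k] by simp
    then show ?thesis by (simp del: of_nat_Suc of_nat_add)
  qed
  have all: "u (Suc k) = 0" for k
  proof (rule ccontr)
    assume nz: "u (Suc k) \<noteq> 0"
    have "u (Suc (k + j)) \<noteq> 0" for j
    proof (induction j)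
      case (Suc j)
      then show ?case using step[of "k + j"] by auto
    qed (use nz in simp)
    from this[of K] K[of "Suc (k + K)"] show False by simp
  qed
  show "Y h k (\<pi> v12) v1 = 0" if "k > 0"
    using all[of "k - 1"] that by (simp add: u_def)
  show "LB 0 (Y h 0 (\<pi> v12) v1) = sB (h1 + h12 - h - 1) (Y h 0 (\<pi> v12) v1)"
    using rec[of 0] all[of 0] by (simp add: u_def \<mu>_def)
qed

lemma intertwining_null_defect:
  assumes Y: "intertwining_operator sK LK sA LA sB LB c Y"
  shows "null_defect (\<lambda>m. Y (\<delta> + of_int m) 0 (\<pi> v12) v1) m = 0"
proof -
  interpret Y: intertwining_operator sK LK sA LA sB LB c Y by (rule Y)
  interpret yl: Vector_Spaces.linear sK sB "\<lambda>w1. Y h' k' w1 w'" for h' k' w' by (rule Y.linear_left)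
  interpret yr: Vector_Spaces.linear sA sB "\<lambda>w. Y h' k' w1 w" for h' k' w1 by (rule Y.linear_right)
  let ?w = "\<pi> v12"
  define u where "u m = Y (\<delta> + of_int m) 0 ?w v1" for m
  note logs = intertwining_no_logs(2)[OF Y]
  have d1: "Y h 0 (LK (-1) ?w) v1 = sB (- h) (Y (h - 1) 0 ?w v1)" for h
    using Y.derivative_formula[of h 0 ?w v1] logs by simp
  have d2: "Y h (Suc 0) (LK (-1) ?w) v1 = 0" for h
    using Y.derivative_formula[of h 1 ?w v1] logs by simp
  have "Y (\<delta> + of_int m) 0 (LK (-1) (LK (-1) ?w)) v1
      = sB (- (\<delta> + of_int m)) (sB (- (\<delta> + of_int m - 1)) (Y (\<delta>
          + of_int m - 1 - 1) 0 ?w v1))"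
    using Y.derivative_formula[of "\<delta> + of_int m" 0 "LK (-1) ?w" v1] unfolding d1 by (simp add: d2)
  then have lhs: "Y (\<delta> + of_int m) 0 (LK (-1) (LK (-1) ?w)) v1
      = sB ((\<delta> + of_int m) * (\<delta> + of_int m - 1)) (u (m - 2))"
    by (simp only: u_def V2.scale_scale minus_mult_minus) (simp add: algebra_simps)
  let ?A = "\<lambda>i. LB (- 2 - int i) (u (m + int i))"
  let ?B = "\<lambda>i. Y (\<delta> + of_int (m + (- 2 + 1 - int i))) 0 ?w (LA (int i - 1) v1)"
  have pos: "u m = 0" if "m > 0" for m
  proof -
    have "LB 0 (u m) = sB (h2 + of_int (- m)) (u m)"
      using intertwining_no_logs(1)[OF Y, of "\<delta> + of_int m"] by (simp add: u_def delta_eq)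
    then have "u m \<in> V2.level (- m)" by (rule V2.eigenvector_level)
    then show ?thesis using V2.level_neg[of "- m"] that by simp
  qed
  have fA: "B.finsupp ?A"
    by (rule B.finsuppI[of "nat (1 - m)"]) (auto simp: pos V2.L_0)
  have fB0: "?B i = 0" if "i \<ge> 2" for i using that by (simp add: V1.L_pos_v yr.zero)
  then have fB: "B.finsupp ?B" by (rule B.finsuppI)
  have "Y (\<delta> + of_int m) 0 (LK (-2) ?w) v1 = B.bsum (-1) (\<lambda>i. ?A i + ?B i)"
    using Y.iterate_formula[of "\<delta> + of_int m" 0 "-2" ?w v1]
    by (simp add: B.bsum_def u_def add.assoc)
  also have "\<dots> = Sum_any ?A + Sum_any ?B"
    using B.bsum_add[OF fA fB, of "-1"] unfolding B.bsum_neg1 .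
  also have "Sum_any ?B = (\<Sum>i<2. ?B i)"
    by (rule B.Sum_any_eq_sum) (rule fB0)
  also have "\<dots> = ?B 0 + sB h1 (u (m - 2))"
    by (simp add: numeral_2_eq_2 V1.L0_v yr.scale u_def)
  also have "?B 0 = LB (-1) (u (m - 1)) + sB (\<delta> + of_int m - 1) (u (m - 2))"
  proof -
    have "Y h 0 ?w (LA (-1) v1) = LB (-1) (Y h 0 ?w v1) + sB h (Y (h - 1) 0 ?w v1)" for h
      using primary_commutator_general[OF Y, of "-1" h 0 v1] logs by simp
    then show ?thesis by (simp add: u_def add_diff_eq)
  qed
  finally have rhs: "Y (\<delta> + of_int m) 0 (LK (-2) ?w) v1
      = Sum_any ?A + LB (-1) (u (m - 1)) + sB (\<delta> + of_int m - 1 + h1) (u (m - 2))"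
    by (simp add: V2.scale_left_distrib add.assoc)
  have "null_defect u m = Y (\<delta> + of_int m) 0 (LK (-1) (LK (-1) ?w)) v1
      - sB (1 / t) (Y (\<delta> + of_int m) 0 (LK (-2) ?w) v1)"
    unfolding lhs rhs null_defect_def ..
  also have "\<dots> = 0" unfolding K_null_vector by (simp add: yl.scale)
  finally show ?thesis unfolding u_def[abs_def] .
qed

text \<open>
  The weights confine the coefficients to the exponents \<open>x + N\<close>, with \<open>x\<close> the leading exponent
  and \<open>N \<ge> 0\<close>. The first one lies in \<open>\<complex> v\<^sub>2\<close>, and the recursion, in which \<open>\<kappa> N \<noteq> 0\<close> for
  \<open>N \<ge> 1\<close>, fixes the rest.
\<close>

lemma intertwining_generator:
  assumes Y: "intertwining_operator sK LK sA LA sB LB c Y"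
  shows "\<exists>a. \<forall>h k. Y h k (\<pi> v12) v1 = sB a (intertwiner h k (\<pi> v12) v1)"
proof -
  define u where "u m = Y (\<delta> + of_int m) 0 (\<pi> v12) v1" for m
  have lev: "u m \<in> V2.level (- m)" for m
  proof -
    have "LB 0 (u m) = sB (h2 + of_int (- m)) (u m)"
      using intertwining_no_logs(1)[OF Y, of "\<delta> + of_int m"] by (simp add: u_def delta_eq)
    then show ?thesis by (rule V2.eigenvector_level)
  qed
  have pos: "u m = 0" if "m > 0" for m
    using lev[of m] V2.level_neg[of "- m"] that by simp
  obtain a where a: "u 0 = sB a v2" using lev[of 0] V2.level_0 by auto
  have neg: "u (- int N) = sB a (\<phi> N)" for N
  proof (induction N rule: less_induct)
    case (less N)
    show ?case
    proof (cases "N = 0")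
      case True
      then show ?thesis by (simp add: a phi_0)
    next
      case False
      have "sB (1 / t) (sB (\<kappa> N) (u (- int N)) - (\<Sum>k<N. LB (int k - int N) (u (- int k)))) = 0"
        using null_defect_recursion[of u N, OF pos] intertwining_null_defect[OF Y, of "2 - int N"]
        by (simp add: u_def[abs_def])
      then have "sB (\<kappa> N) (u (- int N)) = (\<Sum>k<N. LB (int k - int N) (u (- int k)))"
        using t by simp
      also have "\<dots> = (\<Sum>k<N. sB a (LB (int k - int N) (\<phi> k)))"
        by (rule sum.cong) (simp_all add: less V2.L_scale)
      also have "\<dots> = sB (\<kappa> N) (sB a (\<phi> N))"
        by (simp only: V2.scale_sum_right[symmetric] phi_rec[symmetric] V2.scale_left_commute)
      finally show ?thesis using kappa_nonzero[of N] False by (simp only: V2.scale_cancel_left) simp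
    qed
  qed
  have "Y h k (\<pi> v12) v1 = sB a (intertwiner h k (\<pi> v12) v1)" for h k
  proof (cases "k = 0 \<and> (\<exists>m. h = \<delta> + of_int m)")
    case True
    then obtain m where m: "k = 0" "h = \<delta> + of_int m" by blast
    have "u m = sB a (phi_series m)"
      using pos[of m] neg[of "nat (- m)"] by (auto simp: phi_series_def)
    then show ?thesis unfolding m intertwiner_eq field_map_generator psi_v1 u_def .
  next
    case False
    have "Y h k (\<pi> v12) v1 = 0"
    proof (cases "k = 0")
      case True
      have "Y h 0 (\<pi> v12) v1 \<in> V2.generalized_eigenspace (h1 + h12 - h - 1)"
        using intertwining_no_logs(1)[OF Y, of h]
        by (auto simp: V2.generalized_eigenspace_def intro!: exI[of _ 1])
      moreover have "h1 + h12 - h - 1 \<noteq> h2 + of_int n" for n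
      proof
        assume "h1 + h12 - h - 1 = h2 + of_int n"
        then have "h = \<delta> + of_int (- n)" by (simp add: delta_eq algebra_simps)
        with False True show False by blast
      qed
      ultimately show ?thesis using V2.generalized_eigenvector True by blast
    next
      case False
      then show ?thesis by (intro intertwining_no_logs(2)[OF Y]) simp
    qed
    moreover have "intertwiner h k x w = 0" for x w using False by (auto simp: intertwiner_def)
    ultimately show ?thesis by simp
  qed
  then show ?thesis by blast
qed

lemma unique_surjective_intertwining_operator:
  "\<exists>Y. surjective_intertwining_operator sK LK sA LA sB LB c Y
     \<and> (\<forall>Y'. surjective_intertwining_operator sK LK sA LA sB LB c Y' \<longrightarrow>
           (\<exists>a. a \<noteq> 0 \<and> Y' = (\<lambda>h k w1 w2. sB a (Y h k w1 w2))))"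
proof (intro exI[of _ intertwiner] conjI allI impI surjective_intertwiner)
  fix Y' assume "surjective_intertwining_operator sK LK sA LA sB LB c Y'"
  then interpret Y': surjective_intertwining_operator sK LK sA LA sB LB c Y' .
  obtain a where "\<And>h k. Y' h k (\<pi> v12) v1 = sB a (intertwiner h k (\<pi> v12) v1)"
    using intertwining_generator[OF Y'.intertwining_operator_axioms] by blast
  then have eq: "Y' h k x w = sB a (intertwiner h k x w)" for h k x w
    by (rule intertwining_determined[OF intertwining_operator_intertwiner Y'.intertwining_operator_axioms])
  show "\<exists>a. a \<noteq> 0 \<and> Y' = (\<lambda>h k w1 w2. sB a (intertwiner h k w1 w2))"
  proof (cases "a = 0")
    case False
    then show ?thesis using eq by (intro exI[of _ a]) (simp add: fun_eq_iff)
  next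
    case True
    then have "{Y' h k w1 w2 | h k w1 w2. True} \<subseteq> {0}" using eq by auto
    then have "V2.span {Y' h k w1 w2 | h k w1 w2. True} \<subseteq> {0}"
      using V2.span_mono V2.span_empty V2.span_insert_0 by blast
    \<comment> \<open>The zero operator is surjective only onto the zero module,
        where any scalar will do.\<close>
    then have "x = 0" for x :: 'b using Y'.surjective by auto
    then have "Y' = (\<lambda>h k w1 w2. sB 1 (intertwiner h k w1 w2))"
      by (intro ext) metis
    then show ?thesis by (intro exI[of _ 1]) simp
  qed
qed

end

theorem theorem4p2:
  fixes t c h1 h2 :: complex
    and scaleV1 :: "complex \<Rightarrow> 'v1::ab_group_add \<Rightarrow> 'v1" and LV1 :: "int \<Rightarrow> 'v1 \<Rightarrow> 'v1" and v1 :: 'v1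
    and scaleV2 :: "complex \<Rightarrow> 'v2::ab_group_add \<Rightarrow> 'v2" and LV2 :: "int \<Rightarrow> 'v2 \<Rightarrow> 'v2" and v2 :: 'v2
    and scaleV12 :: "complex \<Rightarrow> 'v12::ab_group_add \<Rightarrow> 'v12" and LV12 :: "int \<Rightarrow> 'v12 \<Rightarrow> 'v12"
    and v12 :: 'v12
    and scaleK :: "complex \<Rightarrow> 'k::ab_group_add \<Rightarrow> 'k" and LK :: "int \<Rightarrow> 'k \<Rightarrow> 'k"
    and \<pi> :: "'v12 \<Rightarrow> 'k"
  assumes t: "t \<noteq> 0"
    and c: "c = 13 - 6 * t - 6 / t"
    and V1: "verma_module scaleV1 LV1 c h1 v1"
    and V2: "verma_module scaleV2 LV2 c h2 v2"
    and V12: "verma_module scaleV12 LV12 c (- 1 / 2 + 3 / (4 * t)) v12"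
    and K12: "virasoro_quotient scaleV12 LV12 scaleK LK c
                {LV12 (-1) (LV12 (-1) v12) - scaleV12 (1 / t) (LV12 (-2) v12)} \<pi>"
    and h2: "\<exists>s. s\<^sup>2 = 4 * t * h1 + (t - 1)\<^sup>2
               \<and> h2 = h1 + 1 / (4 * t) - 1 / (2 * t) * s
               \<and> (\<forall>n::nat. n \<ge> 1 \<longrightarrow> 1 / t * s \<noteq> of_nat n)"
  shows "\<exists>Y. surjective_intertwining_operator scaleK LK scaleV1 LV1 scaleV2 LV2 c Y
           \<and> (\<forall>Y'. surjective_intertwining_operator scaleK LK scaleV1 LV1 scaleV2 LV2 c Y' \<longrightarrow>
                 (\<exists>a. a \<noteq> 0 \<and> Y' = (\<lambda>h k w1 w2. scaleV2 a (Y h k w1 w2))))"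
proof -
  obtain s where s: "s\<^sup>2 = 4 * t * h1 + (t - 1)\<^sup>2" "h2 = h1 + 1 / (4 * t) - 1 / (2 * t) * s"
    "\<And>n::nat. n \<ge> 1 \<Longrightarrow> 1 / t * s \<noteq> of_nat n"
    using h2 by blast
  have "fusion_data scaleV1 LV1 c h1 v1 scaleV2 LV2 h2 v2 t s"
    by (intro fusion_data.intro fusion_data_axioms.intro V1 verma_module.lowest_weight_module V2 t c s)
  then have "fusion_setting scaleV1 LV1 c h1 v1 scaleV2 LV2 h2 v2 t s scaleV12 LV12 v12 scaleK LK \<pi>"
    by (intro fusion_setting.intro V12 K12)
  then show ?thesis by (rule fusion_setting.unique_surjective_intertwining_operator)
qed

end
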